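(* Let $z\in\mathbb{C}\setminus(-\infty,1]$ and $\alpha,\beta,\gamma\in\mathbb{C}^\ast$ such that $\Re(\alpha+\gamma)>0$, $\Re(\alpha+\beta+\gamma)>0$, $\Re(-\alpha-\beta-2\gamma-1)>0$, and $\alpha+2\gamma+2,\ \alpha+2\beta+2\gamma+2\notin\{0,-1,-2,\ldots\}$. Put $$u:=u(z,w):=\frac{2z^2w^2-z^2-w^2}{2zw\sqrt{(z^2-1)(w^2-1)}}.$$ Then $$P_\gamma^{(\alpha,\beta)}(2z^2-1)=\frac{\pi\sin(\pi(\alpha+2\beta+2\gamma))\Gamma(\alpha+2\gamma+2)\Gamma(\alpha+2\beta+2\gamma+2)}{2^{2\alpha+2\beta+4\gamma+2}\sin(\pi\gamma)\sin(\pi(\beta+\gamma))\Gamma(\gamma+1)\Gamma(\alpha+\gamma+1)\Gamma(\beta+\gamma+1)\Gamma(\alpha+\beta+\gamma+1)}$$ $$\times\frac{1}{z^{\alpha+2\beta+2\gamma+2}(z^2-1)^{\frac12\alpha}}\int_1^{z}P_\gamma^{(\alpha,\beta)}(2w^2-1)\frac{(w^2-1)^{\frac12(\alpha-2)}}{w^{\alpha+2\gamma+1}}(u^2-1)^{-\alpha-\beta-2\gamma-\frac32}\,C_{\alpha+2\gamma+1}^{-(\alpha+\beta+2\gamma+1)}(u)\,dw .$$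
   Context: $\mathbb{C}^\ast=\mathbb{C}\setminus\{0\}$. Let $\mathbf{F}(a,b;c;z)=\sum_{n\ge0}\frac{(a)_n(b)_n}{\Gamma(c+n)}\frac{z^n}{n!}$ (continued analytically to $\mathbb{C}\setminus[1,\infty)$) be the regularized Gauss hypergeometric function. Jacobi function of the first kind, $z\in\mathbb{C}\setminus(-\infty,-1]$: $P_\gamma^{(\alpha,\beta)}(z)=\frac{\Gamma(\alpha+\gamma+1)}{\Gamma(\gamma+1)}\mathbf{F}\big(-\gamma,\alpha+\beta+\gamma+1;\alpha+1;\frac{1-z}{2}\big)$. Gegenbauer function of the first kind, $z\in\mathbb{C}\setminus(-\infty,-1]$: $C_\lambda^\alpha(z)=\frac{\sqrt\pi\,\Gamma(2\alpha+\lambda)}{2^{2\alpha-1}\Gamma(\alpha)\Gamma(\lambda+1)}\mathbf{F}\big(-\lambda,2\alpha+\lambda;\alpha+\frac12;\frac{1-z}{2}\big)$. Convention: the basic range is $z>1$ real (all powers and roots of positive numbers positive; $u\ge1$ for $1<w\le z$); for complex $z$ both sides are understood by analytic continuation. Parameters are assumed such that all Gamma factors and functions are defined and $\sin(\pi\gamma)\sin(\pi(\beta+\gamma))\neq0$. *)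

theory Defs
  imports "HOL-Analysis.Analysis"
begin

text \<open>
  Regularized Gauss hypergeometric function. The reciprocal Gamma function makes the terms with
  \<open>c + n \<in> {0, -1, -2, \<dots>}\<close> vanish. On the connected set \<open>\<complex> - [1, \<infinity>)\<close> the holomorphic
  continuation of the series is unique, so the description is well-defined there; no meaning is
  intended for arguments on the cut.
\<close>

definition hypergeo_reg :: "complex \<Rightarrow> complex \<Rightarrow> complex \<Rightarrow> complex \<Rightarrow> complex" where
  "hypergeo_reg a b c z = (THE v. \<exists>f. f holomorphic_on (- complex_of_real ` {1..}) \<and>
     (\<forall>x. norm x < 1 \<longrightarrow>
        (\<lambda>n. pochhammer a n * pochhammer b n * rGamma (c + of_nat n) * (x ^ n / fact n)) sums f x) \<and>
     v = f z)"

definition jacobi_P :: "complex \<Rightarrow> complex \<Rightarrow> complex \<Rightarrow> complex \<Rightarrow> complex" where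
  "jacobi_P \<alpha> \<beta> \<gamma> z =
     Gamma (\<alpha> + \<gamma> + 1) / Gamma (\<gamma> + 1) *
     hypergeo_reg (- \<gamma>) (\<alpha> + \<beta> + \<gamma> + 1) (\<alpha> + 1) ((1 - z) / 2)"

text \<open>The order of arguments is: upper index \<open>\<alpha>\<close>, degree \<open>\<lambda>\<close>, variable.\<close>

definition gegenbauer_C :: "complex \<Rightarrow> complex \<Rightarrow> complex \<Rightarrow> complex" where
  "gegenbauer_C \<alpha> l z =
     of_real (sqrt pi) * Gamma (2 * \<alpha> + l) / (2 powr (2 * \<alpha> - 1) * Gamma \<alpha> * Gamma (l + 1)) *
     hypergeo_reg (- l) (2 * \<alpha> + l) (\<alpha> + 1 / 2) ((1 - z) / 2)"

definition u_arg :: "real \<Rightarrow> real \<Rightarrow> real" where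
  "u_arg z w = (2 * z\<^sup>2 * w\<^sup>2 - z\<^sup>2 - w\<^sup>2) / (2 * z * w * sqrt ((z\<^sup>2 - 1) * (w\<^sup>2 - 1)))"

text \<open>
  The integrand for real \<open>1 < w \<le> z\<close>. All bases of powers are nonnegative reals, so the complex
  \<open>powr\<close> takes the intended positive-base value (up to the endpoints \<open>w = 1\<close> and \<open>w = z\<close>).
\<close>

definition jacobi_integrand ::
    "complex \<Rightarrow> complex \<Rightarrow> complex \<Rightarrow> real \<Rightarrow> real \<Rightarrow> complex" where
  "jacobi_integrand \<alpha> \<beta> \<gamma> z w =
     jacobi_P \<alpha> \<beta> \<gamma> (of_real (2 * w\<^sup>2 - 1)) *
     (of_real (w\<^sup>2 - 1) powr ((\<alpha> - 2) / 2) / of_real w powr (\<alpha> + 2 * \<gamma> + 1)) *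
     of_real ((u_arg z w)\<^sup>2 - 1) powr (- \<alpha> - \<beta> - 2 * \<gamma> - 3 / 2) *
     gegenbauer_C (- (\<alpha> + \<beta> + 2 * \<gamma> + 1)) (\<alpha> + 2 * \<gamma> + 1) (of_real (u_arg z w))"

end

theory Submission
  imports Defs "HOL-Complex_Analysis.Complex_Analysis"
begin

text \<open>
  Put \<open>a = - \<gamma>\<close>, \<open>b = \<alpha> + \<beta> + \<gamma> + 1\<close>, \<open>c = \<alpha> + 1\<close>, \<open>m = a - b\<close>, \<open>l = \<alpha> + 2 \<gamma> + 1 = c - 2 a\<close> and use
  the variables \<open>y = 1 - 1 / w\<^sup>2\<close>, \<open>Y = 1 - 1 / z\<^sup>2\<close> in \<open>(0, 1)\<close>. Then \<open>u = cosh \<theta>\<close> with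
  \<open>exp (- 2 \<theta>) = y / Y\<close>, and by a quadratic transformation the Gegenbauer factor together with the
  power of \<open>u\<^sup>2 - 1\<close> is, up to powers of \<open>y\<close> and \<open>Y\<close>, the integral of
  \<open>(Y - r)\<^bsup>m - 1\<^esup> (r - y)\<^bsup>m - 1\<^esup> r\<^bsup>l\<^esup>\<close> over \<open>r \<in> (y, Y)\<close>. So the integral operator is a composition
  of two fractional integrals of order \<open>m\<close> with a power weight in between. Write \<open>F\<close> for the
  regularized hypergeometric function. By a Pfaff transformation the Jacobi function is a power of
  \<open>w\<close> times \<open>F(a, c - b; c; y)\<close>; the first fractional integral replaces the parameter \<open>a\<close> by \<open>b\<close>, the
  second replaces \<open>c - b\<close> by \<open>c - a\<close>, and \<open>F(b, c - a; c; Y)\<close> is by the other Pfaff transformation a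
  power of \<open>z\<close> times the Jacobi function at \<open>z\<close>.
\<close>


text \<open>Much of the proof makes sense of the two sides. The definite description of
  \<open>F\<close> is meaningful only once a continuation exists, and the Gegenbauer factor calls
  for it at the parameters -l and 2m + l, whose signs are not controlled, with (1 - u)/2 tending to
  minus infinity as w tends to 1; so the continuation is constructed for all parameters. Moreover 1
  - z^2 meets the cut on the imaginary axis, so the left-hand side must be continued past it. The
  integral identity itself is proved for real z > 1. The two fractional integrals compose because a
  = b + m and c - b = (c - a) + m: each lowers one numerator parameter by m, and the weight r^l with
  l = c - 2a turns the power r^(a-1) left by the first into the power r^(c-a-1) needed by the
  second. The integrals contribute Gamma(b) Gamma(c-a) / (Gamma(a) Gamma(c-b)), the Gegenbauer
  function Gamma(2m+l) / Gamma(l+1). Reflecting Gamma(a), Gamma(c-b) and Gamma(2m+l) produces the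
  three sines; the power of 2 comes from u^2 - 1 = sinh(\<theta>)^2 and dy/dw = 2/w^3.\<close>

section \<open>Beta integrals and fractional integration of power series\<close>

text \<open>Fractional integration by parts: the adjoint of the fractional integral over (0, s) is
  the one over (r, infinity). The hypothesis \<open>outer\<close> is Tonelli's test for the double
  integral. The first conclusion later yields integrability of the Jacobi integrand, the second its
  integral.\<close>

lemma convolution_Fubini:
  fixes g h :: "real \<Rightarrow> complex" and q :: complex
  assumes [measurable]: "g \<in> borel_measurable borel" "h \<in> borel_measurable borel"
    and inner: "\<And>s. s > 0 \<Longrightarrow> set_integrable lborel {0<..<s} (\<lambda>r. g r * of_real (s - r) powr (q - 1))"
    and outer: "set_integrable lborel {0<..}
      (\<lambda>s. norm (h s) * (LINT r:{0<..<s}|lborel. norm (g r) * (s - r) powr (Re q - 1)))"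
  shows "set_integrable lborel {0<..}
      (\<lambda>r. g r * (LINT s:{r<..}|lborel. h s * of_real (s - r) powr (q - 1)))"
    and "(LINT s:{0<..}|lborel. h s * (LINT r:{0<..<s}|lborel. g r * of_real (s - r) powr (q - 1))) =
      (LINT r:{0<..}|lborel. g r * (LINT s:{r<..}|lborel. h s * of_real (s - r) powr (q - 1)))"
proof -
  define f where "f = (\<lambda>s r. if 0 < r \<and> r < s then h s * g r * of_real (s - r) powr (q - 1) else 0)"
  have [measurable]: "case_prod f \<in> borel_measurable (lborel \<Otimes>\<^sub>M lborel)"
    unfolding f_def by measurable
  have A: "f s r = indicator {0<..} s *\<^sub>R (h s * (indicator {0<..<s} r *\<^sub>R (g r * of_real (s - r) powr (q - 1))))"
    and B: "f s r = indicator {0<..} r *\<^sub>R (g r * (indicator {r<..} s *\<^sub>R (h s * of_real (s - r) powr (q - 1))))"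
    for s r by (auto simp: f_def indicator_def)
  have "norm (f s r) = indicator {0<..} s *\<^sub>R (norm (h s) *
      (indicator {0<..<s} r *\<^sub>R (norm (g r) * (s - r) powr (Re q - 1))))" for s r
    by (auto simp: f_def indicator_def norm_mult norm_powr_real_powr)
  then have C: "(LINT r|lborel. norm (f s r)) = indicator {0<..} s *\<^sub>R (norm (h s) *
     (LINT r:{0<..<s}|lborel. norm (g r) * (s - r) powr (Re q - 1)))" for s
    by (simp add: set_lebesgue_integral_def)
  have int: "integrable (lborel \<Otimes>\<^sub>M lborel) (case_prod f)"
  proof (rule lborel_pair.Fubini_integrable)
    show "integrable lborel (\<lambda>s. LINT r|lborel. norm (case_prod f (s, r)))"
      using outer unfolding set_integrable_def by (simp add: C)
    show "AE s in lborel. integrable lborel (\<lambda>r. case_prod f (s, r))"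
    proof (intro AE_I2)
      fix s :: real
      show "integrable lborel (\<lambda>r. case_prod f (s, r))"
      proof (cases "s > 0")
        case True
        from inner[OF this] show ?thesis
          unfolding set_integrable_def case_prod_conv A
          by (intro integrable_scaleR_right integrable_mult_right)
      next
        case False
        then have "(\<lambda>r. case_prod f (s, r)) = (\<lambda>r. 0)" by (auto simp: f_def)
        then show ?thesis by simp
      qed
    qed
  qed measurable
  have D: "(LINT s|lborel. f s r) = indicator {0<..} r *\<^sub>R (g r *
      (LINT s:{r<..}|lborel. h s * of_real (s - r) powr (q - 1)))" for r
    unfolding B set_lebesgue_integral_def
    by (simp only: integral_scaleR_right integral_mult_right_zero)
  have E: "(LINT r|lborel. f s r) = indicator {0<..} s *\<^sub>R (h s *
      (LINT r:{0<..<s}|lborel. g r * of_real (s - r) powr (q - 1)))" for s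
    unfolding A set_lebesgue_integral_def
    by (simp only: integral_scaleR_right integral_mult_right_zero)
  show "set_integrable lborel {0<..}
      (\<lambda>r. g r * (LINT s:{r<..}|lborel. h s * of_real (s - r) powr (q - 1)))"
    using lborel_pair.integrable_snd[OF int] unfolding set_integrable_def by (simp add: D)
  show "(LINT s:{0<..}|lborel. h s * (LINT r:{0<..<s}|lborel. g r * of_real (s - r) powr (q - 1))) =
      (LINT r:{0<..}|lborel. g r * (LINT s:{r<..}|lborel. h s * of_real (s - r) powr (q - 1)))"
    using lborel_pair.Fubini_integral[OF int]
    by (simp add: D E set_lebesgue_integral_def)
qed

lemma set_integrable_lborel_scale:
  fixes f :: "real \<Rightarrow> 'a :: euclidean_space"
  assumes "s > 0"
  shows "set_integrable lborel {0<..<s} f \<longleftrightarrow> set_integrable lborel {0<..<1} (\<lambda>t. f (s * t))"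
proof -
  have "(\<lambda>x. indicator {0<..<s} (s * x) *\<^sub>R f (s * x)) = (\<lambda>x. indicator {0<..<1} x *\<^sub>R f (s * x))"
    using assms by (auto simp: indicator_def zero_less_mult_iff)
  then show ?thesis
    using assms lborel_integrable_real_affine_iff[of s "\<lambda>x. indicator {0<..<s} x *\<^sub>R f x" 0]
    unfolding set_integrable_def by simp
qed

lemma set_integral_lborel_scale:
  fixes f :: "real \<Rightarrow> 'a :: euclidean_space"
  assumes "s > 0"
  shows "(LINT r:{0<..<s}|lborel. f r) = s *\<^sub>R (LINT t:{0<..<1}|lborel. f (s * t))"
proof -
  have "(\<lambda>x. indicator {0<..<s} (s * x) *\<^sub>R f (s * x)) = (\<lambda>x. indicator {0<..<1} x *\<^sub>R f (s * x))"
    using assms by (auto simp: indicator_def zero_less_mult_iff)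
  then show ?thesis
    using assms lborel_integral_real_affine[of s "\<lambda>x. indicator {0<..<s} x *\<^sub>R f x" 0]
    unfolding set_lebesgue_integral_def by simp
qed

lemma Beta_kernel_complex_01:
  fixes p q :: complex
  assumes "Re p > 0" "Re q > 0"
  shows "set_integrable lborel {0<..<1} (\<lambda>t. of_real t powr (p - 1) * of_real (1 - t) powr (q - 1))"
proof -
  have "set_integrable lborel {0<..<1} (\<lambda>t. t powr (Re p - 1) * (1 - t) powr (Re q - 1))"
    by (rule set_integrable_subset[OF integrable_Beta]) (use assms in auto)
  then show ?thesis
    unfolding set_integrable_def
    by (rule Bochner_Integration.integrable_bound)
      (auto simp: norm_mult norm_powr_real_powr indicator_def)
qed

lemma Beta_kernel_real_integral:
  fixes p q s :: real
  assumes "p > 0" "q > 0" "s > 0"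
  shows "(LINT r:{0<..<s}|lborel. r powr (p - 1) * (s - r) powr (q - 1)) = s powr (p + q - 1) * Beta p q"
proof -
  let ?f = "\<lambda>t::real. t powr (p - 1) * (1 - t) powr (q - 1)"
  have i: "set_integrable lborel {0<..<1} ?f"
    by (rule set_integrable_subset[OF integrable_Beta]) (use assms in auto)
  have "((\<lambda>t. ?f t) has_integral Beta p q) {0<..<1}"
    using has_integral_Beta_real[OF assms(1,2)] by (simp add: has_integral_Icc_iff_Ioo)
  then have B: "(LINT t:{0<..<1}|lborel. ?f t) = Beta p q"
    using set_borel_integral_eq_integral(2)[OF i] by (simp add: integral_unique)
  have "(LINT r:{0<..<s}|lborel. r powr (p - 1) * (s - r) powr (q - 1)) =
     s * (LINT t:{0<..<1}|lborel. (s * t) powr (p - 1) * (s - s * t) powr (q - 1))"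
    by (subst set_integral_lborel_scale) (use assms in auto)
  also have "(LINT t:{0<..<1}|lborel. (s * t) powr (p - 1) * (s - s * t) powr (q - 1)) =
     (LINT t:{0<..<1}|lborel. s powr (p + q - 2) * ?f t)"
  proof (rule set_lebesgue_integral_cong)
    show "\<forall>t. t \<in> {0<..<1} \<longrightarrow> (s * t) powr (p - 1) * (s - s * t) powr (q - 1) = s powr (p + q - 2) * ?f t"
    proof safe
      fix t :: real assume "t \<in> {0<..<1}"
      then have "(s - s * t) powr (q - 1) = s powr (q - 1) * (1 - t) powr (q - 1)"
        using assms powr_mult[of s "1 - t" "q - 1"] by (simp add: right_diff_distrib)
      moreover have "(s * t) powr (p - 1) = s powr (p - 1) * t powr (p - 1)"
        using assms \<open>t \<in> _\<close> by (simp add: powr_mult)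
      moreover have "s powr (p - 1) * s powr (q - 1) = s powr (p + q - 2)"
        by (simp add: powr_add[symmetric])
      ultimately show "(s * t) powr (p - 1) * (s - s * t) powr (q - 1) = s powr (p + q - 2) * ?f t"
        by (simp add: algebra_simps)
    qed
  qed auto
  also have "\<dots> = s powr (p + q - 2) * Beta p q"
    by (simp add: B)
  also have "s * (s powr (p + q - 2) * Beta p q) = s powr (p + q - 1) * Beta p q"
    using assms powr_add[of s 1 "p + q - 2"] by simp
  finally show ?thesis .
qed

text \<open>The constant stays an integral over (0, 1): its value is found in
  \<open>Beta_integral_complex\<close>, whose proof relies on this scaling.\<close>

lemma Beta_kernel_complex:
  fixes p q :: complex
  assumes "Re p > 0" "Re q > 0" "s > 0"
  shows "set_integrable lborel {0<..<s} (\<lambda>r. of_real r powr (p - 1) * of_real (s - r) powr (q - 1))"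
    and "(LINT r:{0<..<s}|lborel. of_real r powr (p - 1) * of_real (s - r) powr (q - 1)) =
       of_real s powr (p + q - 1) * (LINT t:{0<..<1}|lborel. of_real t powr (p - 1) * of_real (1 - t) powr (q - 1))"
proof -
  let ?f = "\<lambda>t::real. of_real t powr (p - 1) * of_real (1 - t) powr (q - 1) :: complex"
  have eq: "of_real (s * t) powr (p - 1) * of_real (s - s * t) powr (q - 1) = of_real s powr (p + q - 2) * ?f t"
    if "t \<in> {0<..<1}" for t
  proof -
    have "complex_of_real (s - s * t) powr (q - 1) = of_real s powr (q - 1) * of_real (1 - t) powr (q - 1)"
      using assms that powr_times_real[of "of_real s" "of_real (1 - t)" "q - 1"]
      by (simp add: right_diff_distrib)
    moreover have "complex_of_real (s * t) powr (p - 1) = of_real s powr (p - 1) * of_real t powr (p - 1)"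
      using assms that powr_times_real[of "of_real s" "of_real t" "p - 1"] by simp
    moreover have "complex_of_real s powr (p - 1) * of_real s powr (q - 1) = of_real s powr (p + q - 2)"
      by (simp add: powr_add[symmetric])
    ultimately show ?thesis
      by (simp add: algebra_simps)
  qed
  have "set_integrable lborel {0<..<1} (\<lambda>t. of_real s powr (p + q - 2) * ?f t)"
    using Beta_kernel_complex_01[OF assms(1,2)] by simp
  also have "?this \<longleftrightarrow> set_integrable lborel {0<..<1}
      (\<lambda>t. of_real (s * t) powr (p - 1) * of_real (s - s * t) powr (q - 1) :: complex)"
    by (rule set_integrable_cong) (use eq in auto)
  finally show "set_integrable lborel {0<..<s} (\<lambda>r. of_real r powr (p - 1) * of_real (s - r) powr (q - 1) :: complex)"
    using assms by (subst set_integrable_lborel_scale) auto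
  have "(LINT r:{0<..<s}|lborel. of_real r powr (p - 1) * of_real (s - r) powr (q - 1)) =
     s *\<^sub>R (LINT t:{0<..<1}|lborel. of_real (s * t) powr (p - 1) * of_real (s - s * t) powr (q - 1) :: complex)"
    using assms by (subst set_integral_lborel_scale) auto
  also have "(LINT t:{0<..<1}|lborel. of_real (s * t) powr (p - 1) * of_real (s - s * t) powr (q - 1)) =
     (LINT t:{0<..<1}|lborel. of_real s powr (p + q - 2) * ?f t)"
    by (rule set_lebesgue_integral_cong) (use eq in auto)
  also have "s *\<^sub>R (LINT t:{0<..<1}|lborel. of_real s powr (p + q - 2) * ?f t) =
     of_real s powr (p + q - 1) * (LINT t:{0<..<1}|lborel. ?f t)"
    using assms powr_add[of "of_real s" 1 "p + q - 2"] by (simp add: scaleR_conv_of_real)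
  finally show "(LINT r:{0<..<s}|lborel. of_real r powr (p - 1) * of_real (s - r) powr (q - 1)) =
     of_real s powr (p + q - 1) * (LINT t:{0<..<1}|lborel. ?f t)" .
qed

lemma
  fixes z :: complex
  assumes "Re z > 0"
  shows Gamma_set_integrable: "set_integrable lborel {0<..} (\<lambda>t. of_real t powr (z - 1) * of_real (exp (- t)))"
    and Gamma_set_integral: "(LINT t:{0<..}|lborel. of_real t powr (z - 1) * of_real (exp (- t))) = Gamma z"
proof -
  have eq: "(\<lambda>t. of_real t powr (z - 1) * of_real (exp (- t))) = (\<lambda>t::real. of_real t powr (z - 1) / of_real (exp t) :: complex)"
    by (auto simp: exp_minus field_simps)
  show *: "set_integrable lborel {0<..} (\<lambda>t. of_real t powr (z - 1) * of_real (exp (- t)))"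
    using absolutely_integrable_Gamma_integral'[OF assms]
    unfolding eq set_integrable_def
    by (subst (asm) integrable_completion) auto
  show "(LINT t:{0<..}|lborel. of_real t powr (z - 1) * of_real (exp (- t))) = Gamma z"
    using set_borel_integral_eq_integral(2)[OF *] Gamma_integral_complex'[OF assms]
    unfolding eq by (simp add: integral_unique)
qed

lemma not_nonpos_Ints_Re_pos: "Re z > 0 \<Longrightarrow> z \<notin> \<int>\<^sub>\<le>\<^sub>0"
  by (auto elim!: nonpos_Ints_cases)

lemma Gamma_nonzero_Re_pos: "Re z > 0 \<Longrightarrow> Gamma z \<noteq> 0"
  by (simp add: Gamma_eq_zero_iff not_nonpos_Ints_Re_pos)

text \<open>Integrate r^(p-1) (s-r)^(q-1) exp(-s) over 0 < r < s in both orders. Taking r first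
  leaves the Beta integral times Gamma(p+q); taking s first and translating by r leaves Gamma(p)
  Gamma(q).\<close>

theorem Beta_integral_complex:
  fixes p q :: complex
  assumes "Re p > 0" "Re q > 0"
  shows "(LINT t:{0<..<1}|lborel. of_real t powr (p - 1) * of_real (1 - t) powr (q - 1)) = Beta p q"
proof -
  define B where "B = (LINT t:{0<..<1}|lborel. of_real t powr (p - 1) * of_real (1 - t) powr (q - 1) :: complex)"
  let ?g = "\<lambda>r::real. of_real r powr (p - 1) :: complex" and ?h = "\<lambda>s::real. of_real (exp (- s)) :: complex"
  have "set_integrable lborel {0<..} (\<lambda>t. norm (of_real t powr ((p + q) - 1) * of_real (exp (- t)) :: complex))"
    by (rule set_integrable_norm[OF Gamma_set_integrable]) (use assms in simp)
  also have "?this \<longleftrightarrow> set_integrable lborel {0<..} (\<lambda>s. s powr (Re p + Re q - 1) * exp (- s))"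
    by (intro set_integrable_cong) (auto simp: norm_mult norm_powr_real_powr)
  finally have "set_integrable lborel {0<..} (\<lambda>s. Beta (Re p) (Re q) * (s powr (Re p + Re q - 1) * exp (- s)))"
    by simp
  also have "?this \<longleftrightarrow> set_integrable lborel {0<..}
      (\<lambda>s. norm (?h s) * (LINT r:{0<..<s}|lborel. norm (?g r) * (s - r) powr (Re q - 1)))"
  proof (intro set_integrable_cong refl, goal_cases)
    case (1 s)
    then have "(LINT r:{0<..<s}|lborel. norm (?g r) * (s - r) powr (Re q - 1)) =
        (LINT r:{0<..<s}|lborel. r powr (Re p - 1) * (s - r) powr (Re q - 1))"
      by (intro set_lebesgue_integral_cong) (auto simp: norm_powr_real_powr)
    with 1 show ?case
      using Beta_kernel_real_integral[of "Re p" "Re q" s] assms by simp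
  qed
  finally have outer: "set_integrable lborel {0<..}
      (\<lambda>s. norm (?h s) * (LINT r:{0<..<s}|lborel. norm (?g r) * (s - r) powr (Re q - 1)))" .
  have "(LINT s:{0<..}|lborel. ?h s * (LINT r:{0<..<s}|lborel. ?g r * of_real (s - r) powr (q - 1))) =
      (LINT r:{0<..}|lborel. ?g r * (LINT s:{r<..}|lborel. ?h s * of_real (s - r) powr (q - 1)))"
    by (rule convolution_Fubini(2)) (use outer Beta_kernel_complex(1)[OF assms] in auto)
  also have "(LINT s:{0<..}|lborel. ?h s * (LINT r:{0<..<s}|lborel. ?g r * of_real (s - r) powr (q - 1))) =
      (LINT s:{0<..}|lborel. B * (of_real s powr ((p + q) - 1) * ?h s))"
  proof (intro set_lebesgue_integral_cong allI impI, goal_cases)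
    case (2 s)
    then show ?case
      unfolding B_def by (subst Beta_kernel_complex(2)[OF assms, of s]) (auto simp only: greaterThan_iff mult_ac)
  qed simp
  also have "\<dots> = B * Gamma (p + q)"
    using Gamma_set_integral[of "p + q"] assms by simp
  also have "(LINT r:{0<..}|lborel. ?g r * (LINT s:{r<..}|lborel. ?h s * of_real (s - r) powr (q - 1))) =
     (LINT r:{0<..}|lborel. Gamma q * (?g r * ?h r))"
  proof (intro set_lebesgue_integral_cong, goal_cases)
    case 2
    show ?case
    proof safe
      fix r :: real
      have "(LINT s:{r<..}|lborel. ?h s * of_real (s - r) powr (q - 1)) =
         (LINT t|lborel. indicator {r<..} (r + t) *\<^sub>R (?h (r + t) * of_real t powr (q - 1)))"
        unfolding set_lebesgue_integral_def
        by (subst lborel_integral_real_affine[where c = 1 and t = r]) auto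
      also have "\<dots> = (LINT t:{0<..}|lborel. ?h r * (of_real t powr (q - 1) * ?h t))"
        unfolding set_lebesgue_integral_def
        by (intro Bochner_Integration.integral_cong) (auto simp: indicator_def exp_add exp_diff exp_minus field_simps)
      also have "\<dots> = ?h r * Gamma q"
        using Gamma_set_integral[of q] assms by simp
      finally show "?g r * (LINT s:{r<..}|lborel. ?h s * of_real (s - r) powr (q - 1)) = Gamma q * (?g r * ?h r)"
        by simp
    qed
  qed auto
  also have "\<dots> = Gamma q * Gamma p"
    using Gamma_set_integral[of p] assms by simp
  finally have "B * Gamma (p + q) = Gamma q * Gamma p" .
  moreover have "Gamma (p + q) \<noteq> 0"
    using Gamma_nonzero_Re_pos[of "p + q"] assms by simp
  ultimately show ?thesis
    unfolding Beta_def B_def[symmetric] by (simp add: field_simps)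
qed

text \<open>Absolute summability at the right endpoint \<open>s\<close> dominates the terms at every
  r < s, which justifies integrating term by term; each term is then a Beta integral.\<close>

lemma fractional_integral_power_series_sums:
  fixes p q :: complex and C :: "nat \<Rightarrow> complex"
  assumes p: "Re p > 0" and q: "Re q > 0" and s: "s > 0" and sum: "summable (\<lambda>n. norm (C n) * s ^ n)"
  shows "(\<lambda>n. C n * (Beta (p + of_nat n) q * of_real s powr (p + of_nat n + q - 1))) sums
    (LINT r:{0<..<s}|lborel. (\<Sum>n. C n * of_real r ^ n) * of_real r powr (p - 1) * of_real (s - r) powr (q - 1))"
proof -
  define f where "f = (\<lambda>n r. indicator {0<..<s} r *\<^sub>R
      (C n * (of_real r powr (p + of_nat n - 1) * of_real (s - r) powr (q - 1))))"
  have pn: "Re (p + of_nat n) > 0" for n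
    using p by (simp add: add_pos_nonneg)
  note ker = Beta_kernel_complex[OF pn q s]
  have int: "integrable lborel (f n)" for n
    using set_integrable_mult_right[OF ker(1)[of n], of "C n"]
    unfolding f_def set_integrable_def by simp
  have powr_split: "of_real r powr (p + of_nat n - 1) = of_real r ^ n * (of_real r powr (p - 1) :: complex)"
    if "r > 0" for r :: real and n
  proof -
    have "of_real r powr (p + of_nat n - 1) = of_real r powr (of_nat n) * (of_real r powr (p - 1) :: complex)"
      unfolding powr_add[symmetric] by (simp add: algebra_simps)
    with that show ?thesis by (simp add: powr_nat')
  qed
  have norm_le: "norm (C n) * r ^ n \<le> norm (C n) * s ^ n" if "0 < r" "r < s" for r n
    using that by (intro mult_left_mono power_mono) auto
  have sum_r: "summable (\<lambda>n. norm (C n * of_real r ^ n))" if "0 < r" "r < s" for r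
    by (rule summable_comparison_test'[OF sum]) (use norm_le that in \<open>auto simp: norm_mult norm_power\<close>)
  have f_eq: "f n r = indicator {0<..<s} r *\<^sub>R
      (C n * of_real r ^ n * (of_real r powr (p - 1) * of_real (s - r) powr (q - 1)))" for n r
    by (auto simp: f_def indicator_def powr_split)
  have 1: "AE r in lborel. summable (\<lambda>n. norm (f n r))"
  proof (intro AE_I2)
    fix r
    show "summable (\<lambda>n. norm (f n r))"
    proof (cases "0 < r \<and> r < s")
      case True
      from summable_mult2[OF sum_r, of r "norm (of_real r powr (p - 1) * of_real (s - r) powr (q - 1) :: complex)"] True
      show ?thesis by (simp add: f_eq norm_mult)
    qed (auto simp: f_eq)
  qed
  have 2: "summable (\<lambda>n. LINT r|lborel. norm (f n r))"
  proof (rule summable_comparison_test')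
    show "summable (\<lambda>n. norm (C n) * s ^ n * (LINT r:{0<..<s}|lborel. norm (of_real r powr (p - 1) * of_real (s - r) powr (q - 1) :: complex)))"
      by (rule summable_mult2[OF sum])
    fix n :: nat assume "n \<ge> 0"
    have "norm (LINT r|lborel. norm (f n r)) = (LINT r|lborel. norm (f n r))"
      by (simp add: integral_nonneg_AE)
    also have "\<dots> \<le> (LINT r|lborel. norm (C n) * s ^ n * (indicator {0<..<s} r *\<^sub>R norm (of_real r powr (p - 1) * of_real (s - r) powr (q - 1) :: complex)))"
    proof (rule integral_mono)
      show "integrable lborel (\<lambda>r. norm (C n) * s ^ n * (indicator {0<..<s} r *\<^sub>R norm (of_real r powr (p - 1) * of_real (s - r) powr (q - 1) :: complex)))"
        using set_integrable_norm[OF Beta_kernel_complex(1)[OF p q s]]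
        unfolding set_integrable_def by (rule integrable_mult_right)
      show "integrable lborel (\<lambda>r. norm (f n r))" using int by simp
      show "norm (f n r) \<le> norm (C n) * s ^ n * (indicator {0<..<s} r *\<^sub>R norm (of_real r powr (p - 1) * of_real (s - r) powr (q - 1) :: complex))" for r
        using mult_right_mono[OF norm_le[of r n], of "norm (of_real r powr (p - 1) * of_real (s - r) powr (q - 1) :: complex)"]
        by (auto simp: f_eq indicator_def norm_mult norm_power)
    qed
    finally show "norm (LINT r|lborel. norm (f n r)) \<le>
        norm (C n) * s ^ n * (LINT r:{0<..<s}|lborel. norm (of_real r powr (p - 1) * of_real (s - r) powr (q - 1) :: complex))"
      unfolding set_lebesgue_integral_def by simp
  qed
  have suminf: "(\<Sum>n. f n r) = indicator {0<..<s} r *\<^sub>R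
      ((\<Sum>n. C n * of_real r ^ n) * of_real r powr (p - 1) * of_real (s - r) powr (q - 1))" for r
  proof (cases "0 < r \<and> r < s")
    case True
    then show ?thesis
      using suminf_mult2[OF summable_norm_cancel[OF sum_r], of r "of_real r powr (p - 1) * of_real (s - r) powr (q - 1)"]
      by (simp add: f_eq mult.assoc)
  qed (auto simp: f_eq)
  have val: "integral\<^sup>L lborel (f n) = C n * (Beta (p + of_nat n) q * of_real s powr (p + of_nat n + q - 1))" for n
  proof -
    have "integral\<^sup>L lborel (f n) = C n * (LINT r:{0<..<s}|lborel. of_real r powr (p + of_nat n - 1) * of_real (s - r) powr (q - 1))"
      unfolding f_def set_lebesgue_integral_def mult_scaleR_right[symmetric]
      by (rule integral_mult_right_zero)
    then show ?thesis
      unfolding ker(2) Beta_integral_complex[OF pn q] by (simp add: algebra_simps)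
  qed
  show "(\<lambda>n. C n * (Beta (p + of_nat n) q * of_real s powr (p + of_nat n + q - 1))) sums
        (LINT r:{0<..<s}|lborel. (\<Sum>n. C n * of_real r ^ n) * of_real r powr (p - 1) * of_real (s - r) powr (q - 1))"
    using sums_integral[OF int 1 2] unfolding suminf val set_lebesgue_integral_def .
qed

section \<open>Analytic continuation of the hypergeometric series\<close>

definition cut_plane :: "complex set" where
  "cut_plane = - complex_of_real ` {1..}"

lemma cut_plane_iff: "z \<in> cut_plane \<longleftrightarrow> Im z \<noteq> 0 \<or> Re z < 1"
  by (auto simp: cut_plane_def image_iff complex_eq_iff not_le)

lemma open_cut_plane: "open cut_plane"
proof -
  have "cut_plane = {z. Im z \<noteq> 0} \<union> {z. Re z < 1}"
    using cut_plane_iff by auto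
  moreover have "open {z. Im z \<noteq> 0}"
    by (intro open_Collect_neq continuous_intros)
  ultimately show ?thesis
    by (metis open_Un open_halfspace_Re_lt)
qed

lemma scale_in_cut_plane:
  assumes "z \<in> cut_plane" "0 \<le> t" "t \<le> 1"
  shows "of_real t * z \<in> cut_plane"
proof (cases "Im z = 0 \<or> t = 0")
  case True
  have "t * Re z < 1" if "Re z < 1"
  proof (cases "Re z \<le> 0")
    case True
    then have "t * Re z \<le> 0" using assms by (simp add: mult_nonneg_nonpos)
    then show ?thesis by simp
  next
    case False
    then have "t * Re z \<le> 1 * Re z" using assms by (intro mult_right_mono) auto
    with that show ?thesis by simp
  qed
  with True assms(1) show ?thesis
    unfolding cut_plane_iff by auto
qed (use assms in \<open>auto simp: cut_plane_iff\<close>)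

lemma starlike_cut_plane: "starlike cut_plane"
proof -
  have "closed_segment 0 z \<subseteq> cut_plane" if "z \<in> cut_plane" for z
  proof
    fix w assume "w \<in> closed_segment 0 z"
    then obtain t where "0 \<le> t" "t \<le> 1" "w = t *\<^sub>R z"
      by (auto simp: in_segment)
    with scale_in_cut_plane[OF that] show "w \<in> cut_plane"
      by (simp add: scaleR_conv_of_real)
  qed
  moreover have "(0::complex) \<in> cut_plane"
    by (simp add: cut_plane_iff)
  ultimately show ?thesis
    unfolding starlike_def by blast
qed

lemma connected_cut_plane: "connected cut_plane"
  by (rule starlike_imp_connected[OF starlike_cut_plane])

lemma norm_less_1_cut_plane: "norm z < 1 \<Longrightarrow> z \<in> cut_plane"
  using abs_Re_le_cmod[of z] by (auto simp: cut_plane_iff)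

section \<open>Coefficients of the series and uniqueness of its continuation\<close>

definition hyp_coeff :: "complex \<Rightarrow> complex \<Rightarrow> complex \<Rightarrow> nat \<Rightarrow> complex" where
  "hyp_coeff a b c n = pochhammer a n * pochhammer b n * rGamma (c + of_nat n) / fact n"

text \<open>The predicate under the description in \<open>hypergeo_reg\<close>, isolated so that
  continuations can be transformed into one another before existence is known for all
  parameters.\<close>

definition hyp_continuation :: "complex \<Rightarrow> complex \<Rightarrow> complex \<Rightarrow> (complex \<Rightarrow> complex) \<Rightarrow> bool" where
  "hyp_continuation a b c f \<longleftrightarrow> f holomorphic_on cut_plane \<and>
     (\<forall>x. norm x < 1 \<longrightarrow> (\<lambda>n. hyp_coeff a b c n * x ^ n) sums f x)"

text \<open>Kept free of division so that it also covers c + n = 0, where the zero of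
  \<open>rGamma\<close> makes both sides vanish.\<close>

lemma hyp_coeff_rec:
  "(of_nat n + 1) * (c + of_nat n) * hyp_coeff a b c (Suc n) =
     (a + of_nat n) * (b + of_nat n) * hyp_coeff a b c n"
proof -
  have 1: "rGamma (c + of_nat n) = (c + of_nat n) * rGamma (c + of_nat (Suc n))"
    using rGamma_plus1[of "c + of_nat n"] by (simp add: add_ac)
  have 2: "of_nat n + 1 = (of_nat (Suc n) :: complex)"
    by simp
  have "(of_nat (Suc n) :: complex) \<noteq> 0"
    using of_nat_neq_0 by blast
  then show ?thesis
    unfolding hyp_coeff_def pochhammer_Suc fact_Suc 1 2 by (simp add: mult_ac del: of_nat_Suc)
qed

lemma hyp_coeff_lower: "(c + of_nat n) * hyp_coeff a b (c + 1) n = hyp_coeff a b c n"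
  using rGamma_plus1[of "c + of_nat n"] unfolding hyp_coeff_def by (simp add: add_ac mult_ac)

lemma hyp_coeff_diffs: "diffs (hyp_coeff a b c) n = a * b * hyp_coeff (a + 1) (b + 1) (c + 1) n"
proof -
  have eq: "c + of_nat (Suc n) = c + 1 + of_nat n"
    by simp
  have "(of_nat (Suc n) :: complex) \<noteq> 0"
    using of_nat_neq_0 by blast
  then show ?thesis
    unfolding diffs_def hyp_coeff_def pochhammer_rec fact_Suc eq
    by (simp add: mult_ac del: of_nat_Suc)
qed

text \<open>The factor between consecutive coefficients tends to 1, so the ratio test works with any
  r between \<open>norm x\<close> and 1; arguing eventually skips a possible n with c + n =
  0.\<close>

lemma summable_hyp_coeff:
  assumes "norm x < 1"
  shows "summable (\<lambda>n. norm (hyp_coeff a b c n * x ^ n))"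
proof -
  have cross: "X = A / P * (B / Q) * h" if "P \<noteq> 0" "Q \<noteq> 0" "P * Q * X = A * B * h" for A B P Q X h :: complex
    using that by (simp add: divide_simps) (simp add: mult_ac)
  have inf: "filterlim (\<lambda>n. w + of_nat n :: complex) at_infinity sequentially" for w
    by (rule tendsto_add_filterlim_at_infinity[OF tendsto_const tendsto_of_nat])
  have ratio: "(\<lambda>n. (v + of_nat n) / (w + of_nat n) :: complex) \<longlonglongrightarrow> 1" for v w
  proof -
    have lim: "(\<lambda>n. 1 + (v - w) / (w + of_nat n)) \<longlonglongrightarrow> 1 + 0"
      by (intro tendsto_intros tendsto_divide_0[OF tendsto_const inf])
    have "\<forall>\<^sub>F n in sequentially. w + of_nat n \<noteq> 0"
      by (rule filterlim_at_infinity_imp_eventually_ne[OF inf])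
    then have "\<forall>\<^sub>F n in sequentially. 1 + (v - w) / (w + of_nat n) = (v + of_nat n) / (w + of_nat n)"
      by eventually_elim (simp add: divide_simps)
    from Lim_transform_eventually[OF lim this] show ?thesis
      by simp
  qed
  have "(\<lambda>n. norm ((a + of_nat n) / (1 + of_nat n) * ((b + of_nat n) / (c + of_nat n)) * x))
      \<longlonglongrightarrow> norm (1 * 1 * x)"
    by (intro tendsto_intros ratio)
  moreover obtain r where r: "norm x < r" "r < 1"
    using assms dense by blast
  ultimately have "\<forall>\<^sub>F n in sequentially. norm ((a + of_nat n) / (1 + of_nat n) * ((b + of_nat n) / (c + of_nat n)) * x) < r"
    by (intro order_tendstoD(2)) auto
  moreover have "\<forall>\<^sub>F n in sequentially. c + of_nat n \<noteq> 0"
    by (rule filterlim_at_infinity_imp_eventually_ne[OF inf])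
  ultimately have "\<forall>\<^sub>F n in sequentially.
      norm (norm (hyp_coeff a b c (Suc n) * x ^ Suc n)) \<le> r * norm (norm (hyp_coeff a b c n * x ^ n))"
  proof eventually_elim
    case (elim n)
    have "(1 + of_nat n :: complex) \<noteq> 0"
      by (metis of_nat_Suc of_nat_neq_0)
    then have "hyp_coeff a b c (Suc n) =
        (a + of_nat n) / (1 + of_nat n) * ((b + of_nat n) / (c + of_nat n)) * hyp_coeff a b c n"
      using hyp_coeff_rec[of n c a b] elim(2) by (intro cross) (auto simp: add.commute)
    then have "norm (hyp_coeff a b c (Suc n) * x ^ Suc n) =
        norm ((a + of_nat n) / (1 + of_nat n) * ((b + of_nat n) / (c + of_nat n)) * x) * norm (hyp_coeff a b c n * x ^ n)"
      by (simp add: norm_mult norm_divide mult_ac)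
    also have "\<dots> \<le> r * norm (hyp_coeff a b c n * x ^ n)"
      using elim(1) by (intro mult_right_mono) auto
    finally show ?case by simp
  qed
  then obtain N where "\<forall>n\<ge>N. norm (norm (hyp_coeff a b c (Suc n) * x ^ Suc n)) \<le> r * norm (norm (hyp_coeff a b c n * x ^ n))"
    unfolding eventually_sequentially by blast
  then show ?thesis
    by (intro summable_ratio_test[OF r(2)]) auto
qed

lemma hyp_series_sums:
  assumes "norm x < 1"
  shows "(\<lambda>n. hyp_coeff a b c n * x ^ n) sums (\<Sum>n. hyp_coeff a b c n * x ^ n)"
  using summable_norm_cancel[OF summable_hyp_coeff[OF assms]] by (rule summable_sums)

text \<open>Two continuations sum the same series on the unit disc, hence agree on the connected
  \<open>cut_plane\<close>. So the description takes the value of whichever continuation is at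
  hand.\<close>

lemma hypergeo_reg_eqI:
  assumes f: "hyp_continuation a b c f" and z: "z \<in> cut_plane"
  shows "hypergeo_reg a b c z = f z"
proof -
  have eq: "pochhammer a n * pochhammer b n * rGamma (c + of_nat n) * (x ^ n / fact n) = hyp_coeff a b c n * x ^ n"
    for n x by (simp add: hyp_coeff_def)
  have unique: "g z = f z" if g: "hyp_continuation a b c g" for g
  proof (rule analytic_continuation_open[where s = "ball 0 1" and s' = cut_plane and f = g and g = f])
    show "g holomorphic_on cut_plane" "f holomorphic_on cut_plane"
      using f g unfolding hyp_continuation_def by auto
    show "ball 0 1 \<subseteq> cut_plane"
      using norm_less_1_cut_plane by auto
    show "g w = f w" if "w \<in> ball 0 1" for w
      using f g that unfolding hyp_continuation_def by (auto intro: sums_unique2)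
  qed (use z open_cut_plane connected_cut_plane in auto)
  have "hypergeo_reg a b c z = (THE v. \<exists>f. hyp_continuation a b c f \<and> v = f z)"
    unfolding hypergeo_reg_def eq cut_plane_def hyp_continuation_def by (simp only: conj_assoc)
  also have "\<dots> = f z"
  proof (rule the_equality)
    show "\<exists>g. hyp_continuation a b c g \<and> f z = g z"
      using f by blast
    show "v = f z" if "\<exists>g. hyp_continuation a b c g \<and> v = g z" for v
      using that unique by blast
  qed
  finally show ?thesis .
qed

lemma hyp_continuation_deriv_sums:
  assumes "hyp_continuation a b c f" "norm x < 1"
  shows "(\<lambda>n. of_nat n * hyp_coeff a b c n * x ^ n) sums (x * deriv f x)"
proof -
  have "f field_differentiable (at x)"
    using assms holomorphic_on_imp_differentiable_at[OF _ open_cut_plane] norm_less_1_cut_plane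
    unfolding hyp_continuation_def by blast
  then have "(f has_field_derivative deriv f x) (at x)"
    by (simp add: DERIV_deriv_iff_field_differentiable)
  then have "(\<lambda>n. diffs (hyp_coeff a b c) n * x ^ n) sums deriv f x"
    using assms unfolding hyp_continuation_def by (intro termdiffs_sums_strong[of 1]) auto
  from sums_mult[OF this, of x]
  have "(\<lambda>n. of_nat (Suc n) * hyp_coeff a b c (Suc n) * x ^ Suc n) sums (x * deriv f x)"
    by (simp add: diffs_def mult_ac)
  \<comment> \<open>The index shift costs nothing, because the term at n = 0 vanishes.\<close>
  then show ?thesis
    by (subst (asm) sums_Suc_iff) simp
qed

text \<open>The operator c + z d/dz multiplies the n-th coefficient by c + n, which is exactly the
  factor between the reciprocal Gamma values at c + 1 + n and c + n.\<close>

lemma hyp_continuation_lower: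
  assumes f: "hyp_continuation a b (c + 1) f"
  shows "hyp_continuation a b c (\<lambda>z. c * f z + z * deriv f z)"
  unfolding hyp_continuation_def
proof (intro conjI allI impI)
  have "f holomorphic_on cut_plane"
    using f unfolding hyp_continuation_def by simp
  then show "(\<lambda>z. c * f z + z * deriv f z) holomorphic_on cut_plane"
    by (intro holomorphic_intros holomorphic_deriv open_cut_plane)
  fix x :: complex assume x: "norm x < 1"
  have "(\<lambda>n. c * (hyp_coeff a b (c + 1) n * x ^ n) + of_nat n * hyp_coeff a b (c + 1) n * x ^ n)
      sums (c * f x + x * deriv f x)"
    using f x hyp_continuation_deriv_sums[OF f x] unfolding hyp_continuation_def
    by (intro sums_add sums_mult) auto
  moreover have "c * (hyp_coeff a b (c + 1) n * x ^ n) + of_nat n * hyp_coeff a b (c + 1) n * x ^ n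
      = hyp_coeff a b c n * x ^ n" for n
    unfolding hyp_coeff_lower[of c n a b, symmetric] by (simp add: algebra_simps)
  ultimately show "(\<lambda>n. hyp_coeff a b c n * x ^ n) sums (c * f x + x * deriv f x)"
    by simp
qed

text \<open>The derivative of F(a, b; c) is a b F(a+1, b+1; c+1), so the function with the smaller
  parameters is recovered as a primitive, which exists because \<open>cut_plane\<close> is
  star-shaped.\<close>

lemma hyp_continuation_primitive:
  assumes f: "hyp_continuation (a + 1) (b + 1) (c + 1) f"
  shows "\<exists>g. hyp_continuation a b c g"
proof -
  have "(\<lambda>z. a * b * f z) holomorphic_on cut_plane"
    using f unfolding hyp_continuation_def by (auto intro!: holomorphic_intros)
  then have "\<exists>g. \<forall>z\<in>cut_plane. (g has_field_derivative (a * b * f z)) (at z)"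
    by (intro holomorphic_starlike_primitive[OF _ starlike_cut_plane open_cut_plane finite.emptyI]
          holomorphic_on_imp_continuous_on)
      (auto intro: holomorphic_on_imp_differentiable_at open_cut_plane)
  then obtain g where g: "\<And>z. z \<in> cut_plane \<Longrightarrow> (g has_field_derivative (a * b * f z)) (at z)"
    by blast
  \<comment> \<open>The constant of integration is fixed by the value \<open>rGamma c\<close> of the
    series at 0.\<close>
  define G where "G = (\<lambda>z. rGamma c + g z - g 0)"
  have G: "(G has_field_derivative (a * b * f z)) (at z)" if "z \<in> cut_plane" for z
    unfolding G_def using that by (auto intro!: derivative_eq_intros g)
  define p where "p = (\<lambda>x. \<Sum>n. hyp_coeff a b c n * x ^ n)"
  have p: "(p has_field_derivative (a * b * f x)) (at x)" if x: "norm x < 1" for x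
  proof -
    have "(p has_field_derivative (\<Sum>n. diffs (hyp_coeff a b c) n * x ^ n)) (at x)"
      unfolding p_def
      by (rule termdiffs_strong'[of 1]) (use x summable_norm_cancel[OF summable_hyp_coeff] in auto)
    also have "(\<Sum>n. diffs (hyp_coeff a b c) n * x ^ n) = a * b * f x"
    proof -
      have "(\<lambda>n. a * b * (hyp_coeff (a + 1) (b + 1) (c + 1) n * x ^ n)) sums (a * b * f x)"
        using f x unfolding hyp_continuation_def by (intro sums_mult) auto
      then show ?thesis
        by (simp add: hyp_coeff_diffs sums_iff mult_ac)
    qed
    finally show ?thesis .
  qed
  have "p x = G x" if x: "norm x < 1" for x
  proof -
    have "\<exists>k. \<forall>x\<in>ball 0 1. p x - G x = k"
    proof (rule has_field_derivative_zero_constant)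
      show "((\<lambda>x. p x - G x) has_field_derivative 0) (at x within ball 0 1)" if "x \<in> ball 0 1" for x
        using DERIV_diff[OF p[of x] G[of x]] that norm_less_1_cut_plane[of x]
        by (auto intro: has_field_derivative_at_within)
    qed auto
    moreover have "p 0 - G 0 = 0"
      unfolding p_def powser_zero by (simp add: G_def hyp_coeff_def)
    ultimately show ?thesis
      using x by fastforce
  qed
  moreover have "G holomorphic_on cut_plane"
    by (rule holomorphic_onI) (use G in \<open>auto simp: field_differentiable_def intro: has_field_derivative_at_within\<close>)
  ultimately have "hyp_continuation a b c G"
    unfolding hyp_continuation_def using hyp_series_sums[of _ a b c] by (simp add: p_def)
  then show ?thesis by blast
qed

lemma one_minus_scale_not_nonpos:
  assumes "z \<in> cut_plane" "0 \<le> t" "t \<le> 1"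
  shows "1 - of_real t * z \<notin> \<real>\<^sub>\<le>\<^sub>0"
  using scale_in_cut_plane[OF assms] by (auto simp: cut_plane_iff complex_nonpos_Reals_iff)

lemma continuous_on_powr_off_nonpos:
  assumes "continuous_on S f" "\<And>x. x \<in> S \<Longrightarrow> f x \<notin> \<real>\<^sub>\<le>\<^sub>0"
  shows "continuous_on S (\<lambda>x. f x powr p :: complex)"
  using assms by (intro continuous_on_powr_complex) (force simp: complex_nonpos_Reals_iff)+

section \<open>Euler's integral on the slit plane\<close>

definition beta_weight :: "complex \<Rightarrow> complex \<Rightarrow> real \<Rightarrow> complex" where
  "beta_weight p q t = of_real t powr (p - 1) * of_real (1 - t) powr (q - 1)"

text \<open>Real parts above 1 rather than above 0 make both exponents positive, so the weight is
  continuous up to the endpoints and parameter integrals over the closed interval need no domination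
  argument.\<close>

lemma continuous_on_beta_weight:
  assumes "Re p > 1" "Re q > 1"
  shows "continuous_on {0..1} (beta_weight p q)"
  unfolding beta_weight_def using assms
  by (intro continuous_on_mult continuous_on_powr_complex continuous_intros) auto

text \<open>Differentiation under the integral sign is carried out on balls, since it asks for a
  convex domain; the slit planes used for \<open>U\<close> are not convex.\<close>

lemma beta_weight_integral_holomorphic:
  assumes pq: "Re p > 1" "Re q > 1" and U: "open U"
    and K: "\<And>z t. z \<in> U \<Longrightarrow> t \<in> {0..1} \<Longrightarrow> ((\<lambda>z. K z t) has_field_derivative K' z t) (at z)"
    and cont: "continuous_on (U \<times> {0..1}) (\<lambda>x. K (fst x) (snd x))"
    and cont': "continuous_on (U \<times> {0..1}) (\<lambda>x. K' (fst x) (snd x))"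
  shows "(\<lambda>z. integral {0..1} (\<lambda>t. beta_weight p q t * K z t)) holomorphic_on U"
proof -
  have ball: "(\<lambda>z. integral (cbox 0 1) (\<lambda>t. beta_weight p q t * K z t)) holomorphic_on ball w r"
    if sub: "ball w r \<subseteq> U" for w r
  proof (rule leibniz_rule_holomorphic)
    fix z t assume zt: "z \<in> ball w r" "t \<in> cbox (0::real) 1"
    then show "((\<lambda>z. beta_weight p q t * K z t) has_field_derivative beta_weight p q t * K' z t) (at z within ball w r)"
      using sub by (intro DERIV_cmult has_field_derivative_at_within[OF K]) auto
  next
    fix z assume "z \<in> ball w r"
    then have "continuous_on {0..1} (\<lambda>t. K (fst (z, t)) (snd (z, t)))"
      using sub by (intro continuous_on_compose2[OF cont] continuous_intros) auto
    then have "continuous_on {0..1} (\<lambda>t. beta_weight p q t * K z t)"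
      by (intro continuous_on_mult continuous_on_beta_weight pq) simp
    then show "(\<lambda>t. beta_weight p q t * K z t) integrable_on cbox 0 1"
      by (simp add: integrable_continuous_real)
  next
    have "continuous_on (ball w r \<times> cbox 0 1) (\<lambda>x. beta_weight p q (snd x))"
      by (rule continuous_on_compose2[OF continuous_on_beta_weight[OF pq] continuous_on_snd])
        (auto intro: continuous_intros)
    moreover have "continuous_on (ball w r \<times> cbox 0 1) (\<lambda>x. K' (fst x) (snd x))"
      by (rule continuous_on_subset[OF cont']) (use sub in auto)
    ultimately show "continuous_on (ball w r \<times> cbox 0 1) (\<lambda>(z, t). beta_weight p q t * K' z t)"
      unfolding case_prod_beta by (intro continuous_intros)
  qed auto
  show ?thesis
  proof (rule holomorphic_onI)
    fix z assume "z \<in> U"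
    then obtain r where "r > 0" "ball z r \<subseteq> U"
      using U open_contains_ball by blast
    from holomorphic_on_imp_differentiable_at[OF ball[OF this(2)] open_ball] this(1)
    show "(\<lambda>z. integral {0..1} (\<lambda>t. beta_weight p q t * K z t)) field_differentiable at z within U"
      by (simp add: field_differentiable_at_within)
  qed
qed

lemma Euler_integral_holomorphic:
  assumes "Re p > 1" "Re q > 1"
  shows "(\<lambda>z. integral {0..1} (\<lambda>t. beta_weight p q t * (1 - of_real t * z) powr (- a))) holomorphic_on cut_plane"
proof (rule beta_weight_integral_holomorphic[OF assms open_cut_plane])
  fix z t assume "z \<in> cut_plane" "t \<in> {0..1::real}"
  then have *: "1 - of_real t * z \<notin> \<real>\<^sub>\<le>\<^sub>0"
    by (intro one_minus_scale_not_nonpos) auto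
  show "((\<lambda>z. (1 - of_real t * z) powr (- a)) has_field_derivative
      (- a * (1 - of_real t * z) powr (- a - 1) * (- of_real t))) (at z)"
    by (rule DERIV_chain2[where f = "\<lambda>w. w powr (- a)" and g = "\<lambda>z. 1 - of_real t * z", OF has_field_derivative_powr[OF *]])
      (auto intro!: derivative_eq_intros)
next
  have *: "1 - complex_of_real (snd x) * fst x \<notin> \<real>\<^sub>\<le>\<^sub>0" if "x \<in> cut_plane \<times> {0..1}" for x
    using that by (intro one_minus_scale_not_nonpos) auto
  show "continuous_on (cut_plane \<times> {0..1}) (\<lambda>x. (1 - of_real (snd x) * fst x) powr (- a))"
    by (intro continuous_on_powr_off_nonpos * continuous_intros)
  have "continuous_on (cut_plane \<times> {0..1}) (\<lambda>x. (1 - complex_of_real (snd x) * fst x) powr (- a - 1))"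
    by (intro continuous_on_powr_off_nonpos * continuous_intros)
  then show "continuous_on (cut_plane \<times> {0..1})
      (\<lambda>x. - a * (1 - of_real (snd x) * fst x) powr (- a - 1) * (- of_real (snd x)))"
    by (intro continuous_on_mult continuous_on_minus continuous_on_of_real continuous_on_const continuous_on_snd continuous_on_id)
qed

lemma integral_eq_LINT_continuous:
  fixes f :: "real \<Rightarrow> complex"
  assumes "continuous_on {0..1} f"
  shows "integral {0..1} f = (LINT t:{0<..<1}|lborel. f t)"
proof -
  have "set_integrable lborel {0..1} f"
    using borel_integrable_compact[of "{0..1}" f] assms by (simp add: set_integrable_def)
  then have "set_integrable lborel {0<..<1} f"
    by (rule set_integrable_subset) auto
  from set_borel_integral_eq_integral(2)[OF this] show ?thesis
    by (simp add: integral_open_interval_real)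
qed

lemma binomial_series_scaled:
  fixes x a :: complex
  assumes "norm x < 1" "0 \<le> t" "t \<le> 1"
  shows "(\<lambda>n. pochhammer a n / fact n * x ^ n * of_real t ^ n) sums (1 - of_real t * x) powr (- a)"
proof -
  have "norm (of_real t * x) \<le> 1 * norm x"
    unfolding norm_mult using assms by (intro mult_right_mono) auto
  with assms have "norm (- (of_real t * x)) < 1" by simp
  from gen_binomial_complex[OF this, of "- a"]
  have "(\<lambda>n. (- a gchoose n) * (- (of_real t * x)) ^ n) sums (1 - of_real t * x) powr (- a)"
    by simp
  moreover have "(- a gchoose n) * (- (of_real t * x)) ^ n = pochhammer a n / fact n * x ^ n * of_real t ^ n" for n
  proof -
    have "(- a gchoose n) * (- (of_real t * x)) ^ n =
        pochhammer a n / fact n * ((- 1) ^ n * (- (of_real t * x)) ^ n)"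
      unfolding gbinomial_pochhammer by simp
    also have "(- 1) ^ n * (- (of_real t * x)) ^ n = (of_real t * x) ^ n"
      unfolding power_mult_distrib[symmetric] by simp
    finally show ?thesis
      by (simp add: power_mult_distrib)
  qed
  ultimately show ?thesis by simp
qed

text \<open>Expand (1 - t x)^(-a) by the binomial series and integrate: up to the factor Gamma(b)
  Gamma(c-b), the n-th Beta value is (b)_n / Gamma(c+n).\<close>

lemma Euler_integral_sums:
  assumes b: "Re b > 0" and c: "Re (c - b) > 0" and x: "norm x < 1"
  shows "(\<lambda>n. hyp_coeff a b c n * x ^ n) sums (rGamma b * rGamma (c - b) *
    (LINT t:{0<..<1}|lborel. beta_weight b (c - b) t * (1 - of_real t * x) powr (- a)))"
proof -
  define C where "C = (\<lambda>n. pochhammer a n / fact n * x ^ n)"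
  have "(LINT t:{0<..<1}|lborel. beta_weight b (c - b) t * (1 - of_real t * x) powr (- a)) =
     (LINT t:{0<..<1}|lborel. (\<Sum>n. C n * of_real t ^ n) * of_real t powr (b - 1) * of_real (1 - t) powr (c - b - 1))"
    using binomial_series_scaled[OF x]
    by (intro set_lebesgue_integral_cong) (auto simp: beta_weight_def sums_iff C_def)
  note I = this
  \<comment> \<open>The binomial series is the hypergeometric series with b = c = 1, so its
    summability is already available.\<close>
  have "hyp_coeff a 1 1 n * x ^ n = C n" for n
    by (simp add: hyp_coeff_def C_def pochhammer_fact[symmetric] rGamma_inverse_Gamma Gamma_fact divide_inverse mult_ac)
  then have "summable (\<lambda>n. norm (C n) * 1 ^ n)"
    using summable_hyp_coeff[OF x, of a 1 1] by simp
  from fractional_integral_power_series_sums[OF b c _ this]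
  have "(\<lambda>n. C n * Beta (b + of_nat n) (c - b)) sums
     (LINT t:{0<..<1}|lborel. beta_weight b (c - b) t * (1 - of_real t * x) powr (- a))"
    unfolding I by simp
  from sums_mult[OF this, of "rGamma b * rGamma (c - b)"]
  show ?thesis
  proof (rule back_subst[of "\<lambda>f. f sums _"])
    show "(\<lambda>n. rGamma b * rGamma (c - b) * (C n * Beta (b + of_nat n) (c - b))) = (\<lambda>n. hyp_coeff a b c n * x ^ n)"
    proof
      fix n
      have "Gamma b \<noteq> 0" "Gamma (c - b) \<noteq> 0" "b \<notin> \<int>\<^sub>\<le>\<^sub>0"
        using Gamma_nonzero_Re_pos[of b] Gamma_nonzero_Re_pos[of "c - b"] not_nonpos_Ints_Re_pos[of b] b c
        by auto
      then have 1: "rGamma b * Gamma (b + of_nat n) = pochhammer b n" "rGamma (c - b) * Gamma (c - b) = 1"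
        by (simp_all add: pochhammer_Gamma rGamma_inverse_Gamma divide_inverse)
      have "rGamma b * rGamma (c - b) * (C n * Beta (b + of_nat n) (c - b)) =
          (rGamma b * Gamma (b + of_nat n)) * (rGamma (c - b) * Gamma (c - b)) * C n * rGamma (c + of_nat n)"
        unfolding Beta_def rGamma_inverse_Gamma[of "c + of_nat n"] by (simp add: divide_inverse add_ac)
      then show "rGamma b * rGamma (c - b) * (C n * Beta (b + of_nat n) (c - b)) = hyp_coeff a b c n * x ^ n"
        unfolding 1 by (simp add: C_def hyp_coeff_def)
    qed
  qed
qed

lemma hyp_continuation_Euler:
  assumes b: "Re b > 1" and c: "Re (c - b) > 1"
  shows "hyp_continuation a b c
    (\<lambda>z. rGamma b * rGamma (c - b) * integral {0..1} (\<lambda>t. beta_weight b (c - b) t * (1 - of_real t * z) powr (- a)))"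
  unfolding hyp_continuation_def
proof (intro conjI allI impI)
  show "(\<lambda>z. rGamma b * rGamma (c - b) * integral {0..1} (\<lambda>t. beta_weight b (c - b) t * (1 - of_real t * z) powr (- a)))
      holomorphic_on cut_plane"
    by (intro holomorphic_intros Euler_integral_holomorphic b c)
  fix x :: complex assume x: "norm x < 1"
  have "continuous_on {0..1} (\<lambda>t. beta_weight b (c - b) t * (1 - of_real t * x) powr (- a))"
    using one_minus_scale_not_nonpos[OF norm_less_1_cut_plane[OF x]]
    by (intro continuous_on_mult continuous_on_beta_weight b c continuous_on_powr_off_nonpos continuous_intros) auto
  from integral_eq_LINT_continuous[OF this] Euler_integral_sums[of b c x a] b c x
  show "(\<lambda>n. hyp_coeff a b c n * x ^ n) sums (rGamma b * rGamma (c - b) *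
      integral {0..1} (\<lambda>t. beta_weight b (c - b) t * (1 - of_real t * x) powr (- a)))"
    by simp
qed

text \<open>Euler's integral covers \<open>Re b > 1\<close>, \<open>Re (c - b) > 1\<close>. Differentiation lowers \<open>c\<close>
  alone, integration lowers all three parameters, and the two steps reach every parameter.\<close>

lemma hyp_continuation_exists: "\<exists>f. hyp_continuation a b c f"
proof -
  have 1: "\<exists>f. hyp_continuation a b c f" if "Re b > 1" "Re (c - b) + real n > 1" for a b c n
    using that
  proof (induction n arbitrary: c)
    case 0
    then show ?case using hyp_continuation_Euler[of b c a] by auto
  next
    case (Suc n)
    then have "\<exists>f. hyp_continuation a b (c + 1) f" by (intro Suc.IH) auto
    then show ?case using hyp_continuation_lower by blast
  qed
  have 2: "\<exists>f. hyp_continuation a b c f" if "Re b + real m > 1" for a b c m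
    using that
  proof (induction m arbitrary: a b c)
    case 0
    obtain n where "1 - Re (c - b) < real n" using reals_Archimedean2 by blast
    with 0 show ?case by (intro 1[of b c n a]) auto
  next
    case (Suc m)
    then have "\<exists>f. hyp_continuation (a + 1) (b + 1) (c + 1) f" by (intro Suc.IH) auto
    then show ?case using hyp_continuation_primitive by blast
  qed
  obtain m where "1 - Re b < real m" using reals_Archimedean2 by blast
  then show ?thesis by (intro 2[of b m]) auto
qed

text \<open>Existence and uniqueness make the description itself a continuation, so holomorphy and
  the series hold for \<open>hypergeo_reg\<close> at all parameters.\<close>

theorem hyp_continuation_hypergeo_reg: "hyp_continuation a b c (hypergeo_reg a b c)"
proof -
  obtain f where f: "hyp_continuation a b c f"
    using hyp_continuation_exists by blast
  have eq: "hypergeo_reg a b c z = f z" if "z \<in> cut_plane" for z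
    using hypergeo_reg_eqI[OF f that] .
  then have "hypergeo_reg a b c holomorphic_on cut_plane \<longleftrightarrow> f holomorphic_on cut_plane"
    by (rule holomorphic_cong[OF refl])
  with f eq norm_less_1_cut_plane show ?thesis
    unfolding hyp_continuation_def by auto
qed

lemma hypergeo_reg_holomorphic: "hypergeo_reg a b c holomorphic_on cut_plane"
  using hyp_continuation_hypergeo_reg unfolding hyp_continuation_def by blast

lemma hypergeo_reg_sums:
  "norm x < 1 \<Longrightarrow> (\<lambda>n. hyp_coeff a b c n * x ^ n) sums hypergeo_reg a b c x"
  using hyp_continuation_hypergeo_reg unfolding hyp_continuation_def by blast

lemma hypergeo_reg_0: "hypergeo_reg a b c 0 = rGamma c"
  using sums_unique2[OF hypergeo_reg_sums[of 0 a b c] powser_sums_zero]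
  by (simp add: hyp_coeff_def)

lemma hypergeo_reg_commute: "hypergeo_reg a b c = hypergeo_reg b a c"
  unfolding hypergeo_reg_def by (simp add: mult.commute)

lemma hypergeo_reg_Euler:
  assumes "Re b > 1" "Re (c - b) > 1" "z \<in> cut_plane"
  shows "hypergeo_reg a b c z = rGamma b * rGamma (c - b) *
      integral {0..1} (\<lambda>t. beta_weight b (c - b) t * (1 - of_real t * z) powr (- a))"
  by (rule hypergeo_reg_eqI[OF hyp_continuation_Euler]) (use assms in auto)

section \<open>Linear fractional transformations\<close>

lemma of_real_powr_exp: "x > 0 \<Longrightarrow> complex_of_real x powr p = exp (p * of_real (ln x))"
  by (simp add: powr_def Ln_of_real)

text \<open>The midpoint of the interval is a limit point of the set of agreement, so the identity
  theorem applies. This lets substitutions be made where all bases of powers are positive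
  reals.\<close>

lemma analytic_continuation_real_interval:
  assumes "f holomorphic_on S" "g holomorphic_on S" "open S" "connected S" "l < u"
    and sub: "complex_of_real ` {l<..<u} \<subseteq> S"
    and eq: "\<And>x. l < x \<Longrightarrow> x < u \<Longrightarrow> f (of_real x) = g (of_real x)"
    and "z \<in> S"
  shows "f z = g z"
proof -
  let ?U = "complex_of_real ` {l<..<u}" and ?m = "(l + u) / 2"
  have m: "l < ?m" "?m < u"
    using \<open>l < u\<close> by auto
  have "of_real ?m islimpt ?U"
  proof (rule islimptI)
    fix T assume T: "complex_of_real ?m \<in> T" "open T"
    then have "open (complex_of_real -` T)"
      by (intro open_vimage continuous_intros)
    then obtain e where e: "e > 0" "ball ?m e \<subseteq> complex_of_real -` T"
      using T(1) unfolding open_contains_ball by (metis vimageI2)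
    define y where "y = ?m + min (e / 2) ((u - ?m) / 2)"
    have "y > ?m" "y < u" "y \<in> ball ?m e"
      using e(1) m(2) by (auto simp: y_def dist_real_def min_def field_simps)
    then show "\<exists>y\<in>?U. y \<in> T \<and> y \<noteq> of_real ?m"
      using e(2) m(1) by (intro bexI[of _ "of_real y"]) (auto simp del: of_real_add of_real_divide)
  qed
  moreover have "(\<lambda>z. f z - g z) holomorphic_on S"
    using assms by (intro holomorphic_intros)
  moreover have "of_real ?m \<in> S"
    using sub imageI[of ?m "{l<..<u}" complex_of_real] m by auto
  ultimately have "f z - g z = 0"
    using assms by (intro analytic_continuation[of "\<lambda>z. f z - g z" S ?U "of_real ?m" z]) auto
  then show ?thesis by simp
qed

text \<open>The plane slit along the nonpositive reals is star-shaped about 1; the map P to 1 - P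
  reduces this to \<open>cut_plane\<close> being star-shaped about 0.\<close>

lemma slit_plane_affine:
  fixes P :: complex
  assumes "P \<notin> \<real>\<^sub>\<le>\<^sub>0" "0 \<le> t" "t \<le> 1"
  shows "1 - of_real t + of_real t * P \<notin> \<real>\<^sub>\<le>\<^sub>0"
proof -
  have "1 - P \<in> cut_plane"
    using assms(1) by (auto simp: cut_plane_iff complex_nonpos_Reals_iff)
  from one_minus_scale_not_nonpos[OF this assms(2,3)] show ?thesis
    by (simp add: algebra_simps)
qed

text \<open>Euler's integral in homogeneous form: in the coordinate \<open>t / (1 - t)\<close> on the half line, a
  dilation multiplies both \<open>P\<close> and \<open>Q\<close> by the same factor. The choice of this factor yields the
  linear fractional transformations as well as the continuation through the cut.\<close>

definition homog_Euler :: "complex \<Rightarrow> complex \<Rightarrow> complex \<Rightarrow> complex \<Rightarrow> complex \<Rightarrow> complex" where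
  "homog_Euler a b c P Q = integral {0..1} (\<lambda>t. beta_weight a (c - a) t *
     ((1 - of_real t + of_real t * P) powr (- b) * (1 - of_real t + of_real t * Q) powr (b - c)))"

text \<open>The four exponents a - 1, c - a - 1, - b, b - c add up to -2, so the common denominators
  introduced by the dilation cancel against those of its derivative and only k^a remains.\<close>

lemma homog_Euler_scale:
  assumes a: "Re a > 1" and ca: "Re (c - a) > 1" and P: "P > 0" and Q: "Q > 0" and k: "k > 0"
  shows "homog_Euler a b c (of_real P) (of_real Q) =
    of_real k powr a * homog_Euler a b c (of_real (k * P)) (of_real (k * Q))"
proof -
  define f where "f = (\<lambda>t. beta_weight a (c - a) t *
     ((1 - of_real t + of_real t * of_real P) powr (- b) * (1 - of_real t + of_real t * of_real Q) powr (b - c)))"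
  define h where "h = (\<lambda>t. of_real k powr a * (beta_weight a (c - a) t *
     ((1 - of_real t + of_real t * of_real (k * P)) powr (- b) * (1 - of_real t + of_real t * of_real (k * Q)) powr (b - c))))"
  \<comment> \<open>In the coordinate t / (1 - t) this is multiplication by
    \<open>k\<close>.\<close>
  define g where "g = (\<lambda>s. k * s / (1 - s + k * s))"
  have pos: "1 - s + r * s > 0" if "0 \<le> s" "s \<le> 1" "r > 0" for r s :: real
    using that by (cases "s = 0") (auto intro!: add_nonneg_pos)
  have not_nonpos: "1 - of_real t + of_real t * complex_of_real r \<notin> \<real>\<^sub>\<le>\<^sub>0" if "t \<in> {0..1}" "r > 0" for t r
    using that by (intro slit_plane_affine) (auto simp: complex_nonpos_Reals_iff)
  have "((\<lambda>s. (k / (1 - s + k * s)\<^sup>2) *\<^sub>R f (g s)) has_integral (integral {g 0..g 1} f)) {0..1}"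
  proof (rule has_integral_substitution)
    show "continuous_on {0..1} f"
      unfolding f_def
      by (intro continuous_on_mult continuous_on_beta_weight a ca continuous_on_powr_off_nonpos continuous_intros not_nonpos P Q)
    show "g ` {0..1} \<subseteq> {0..1}"
    proof (safe)
      fix s :: real assume "s \<in> {0..1}"
      then have "0 < 1 - s + k * s" "0 \<le> k * s" "s \<le> 1" using pos[of s k] k by auto
      then show "g s \<in> {0..1}" by (auto simp: g_def divide_simps)
    qed
    show "(g has_field_derivative k / (1 - s + k * s)\<^sup>2) (at s within {0..1})" if "s \<in> {0..1}" for s
    proof -
      have "1 - s + k * s \<noteq> 0" using pos[of s k] that k by auto
      then show ?thesis
        unfolding g_def by (auto intro!: derivative_eq_intros simp: power2_eq_square field_simps)
    qed
  qed (auto simp: g_def)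
  then have "integral {0..1} f = integral {0..1} (\<lambda>s. (k / (1 - s + k * s)\<^sup>2) *\<^sub>R f (g s))"
    using k by (simp add: g_def integral_unique)
  \<comment> \<open>On the open interval all bases are positive, so every power is an exponential
    and the two integrands can be compared through their logarithms.\<close>
  also have "\<dots> = integral {0<..<1} (\<lambda>s. (k / (1 - s + k * s)\<^sup>2) *\<^sub>R f (g s))"
    by (simp add: integral_open_interval_real)
  also have "\<dots> = integral {0<..<1} h"
  proof (rule integral_cong)
    fix s :: real assume "s \<in> {0<..<1}"
    then have s: "0 < s" "s < 1" by auto
    define d where "d = 1 - s + k * s"
    define D where "D = (\<lambda>r. 1 - s + (k * r) * s)"
    have d: "d > 0" and D: "D P > 0" "D Q > 0"
      using pos[of s k] pos[of s "k * P"] pos[of s "k * Q"] s k P Q by (auto simp: d_def D_def)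
    have g1: "1 - g s = (1 - s) / d"
      using d by (simp add: g_def d_def field_simps)
    have gr: "1 - of_real (g s) + of_real (g s) * of_real r = complex_of_real (D r / d)" for r
    proof -
      have "1 - g s + g s * r = D r / d"
        unfolding g1 by (simp add: g_def d_def[symmetric] D_def add_divide_distrib mult_ac)
      from arg_cong[OF this, of complex_of_real] show ?thesis
        by (simp only: of_real_add of_real_diff of_real_mult of_real_1)
    qed
    have hr: "1 - of_real s + of_real s * of_real (k * r) = complex_of_real (D r)" for r
    proof -
      have "1 - s + s * (k * r) = D r"
        by (simp add: D_def mult_ac)
      from arg_cong[OF this, of complex_of_real] show ?thesis
        by (simp only: of_real_add of_real_diff of_real_mult of_real_1)
    qed
    have kd: "(k / d\<^sup>2) *\<^sub>R w = exp (of_real (ln k) - 2 * of_real (ln d)) * w" for w :: complex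
    proof -
      have "k / d\<^sup>2 = exp (ln k - 2 * ln d)"
        using d k by (simp add: exp_diff exp_double)
      then show ?thesis
        by (simp add: scaleR_conv_of_real flip: exp_of_real)
    qed
    have "(k / d\<^sup>2) *\<^sub>R f (g s) = exp (of_real (ln k) - 2 * of_real (ln d)) *
       (of_real (k * s / d) powr (a - 1) * of_real ((1 - s) / d) powr (c - a - 1) *
         (of_real (D P / d) powr (- b) * of_real (D Q / d) powr (b - c)))"
      unfolding f_def beta_weight_def gr g1 kd by (simp add: g_def d_def)
    also have "\<dots> = h s"
      unfolding h_def beta_weight_def hr
      using s k d D
      by (simp add: of_real_powr_exp ln_div ln_mult exp_add[symmetric] algebra_simps del: of_real_divide of_real_mult of_real_diff)
        (simp add: algebra_simps exp_add[symmetric])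
    finally show "(k / (1 - s + k * s)\<^sup>2) *\<^sub>R f (g s) = h s"
      by (simp add: d_def)
  qed
  also have "\<dots> = integral {0..1} h"
    by (simp add: integral_open_interval_real)
  finally show ?thesis
    by (simp add: f_def h_def homog_Euler_def)
qed

text \<open>If one of \<open>P\<close>, \<open>Q\<close> is 1, the kernel is that of Euler's
  integral. Dilation by 1 / (1 - z) carries the pair (1 - z, 1) to (1, 1 / (1 - z)), from one of the
  two forms to the other.\<close>

lemma homog_Euler_1:
  assumes "Re a > 1" "Re (c - a) > 1" "z \<in> cut_plane"
  shows "hypergeo_reg a b c z = rGamma a * rGamma (c - a) * homog_Euler a b c (1 - z) 1"
    and "hypergeo_reg a (c - b) c z = rGamma a * rGamma (c - a) * homog_Euler a b c 1 (1 - z)"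
proof -
  have *: "1 - t + t * (1 - z) = 1 - t * z" for t
    by (simp add: algebra_simps)
  show "hypergeo_reg a b c z = rGamma a * rGamma (c - a) * homog_Euler a b c (1 - z) 1"
    using hypergeo_reg_Euler[OF assms, of b]
    by (simp add: hypergeo_reg_commute[of a b] homog_Euler_def *)
  show "hypergeo_reg a (c - b) c z = rGamma a * rGamma (c - a) * homog_Euler a b c 1 (1 - z)"
    using hypergeo_reg_Euler[OF assms, of "c - b"]
    by (simp add: hypergeo_reg_commute[of a "c - b"] homog_Euler_def *)
qed

lemma integral_reflect_01:
  fixes f :: "real \<Rightarrow> complex"
  assumes "continuous_on {0..1} f"
  shows "integral {0..1} (\<lambda>t. f (1 - t)) = integral {0..1} f"
proof -
  have "continuous_on {0..1} (\<lambda>t::real. f (1 - t))"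
    by (intro continuous_on_compose2[OF assms] continuous_intros) auto
  then have "integral {0..1} (\<lambda>t. f (1 - t)) = (LINT t:{0<..<1}|lborel. f (1 - t))"
    by (rule integral_eq_LINT_continuous)
  also have "\<dots> = (LINT t|lborel. indicator {0<..<1} (1 + (-1) * t) *\<^sub>R f (1 + (-1) * t))"
    unfolding set_lebesgue_integral_def
    by (intro Bochner_Integration.integral_cong) (auto simp: indicator_def)
  also have "\<dots> = (LINT t:{0<..<1}|lborel. f t)"
    unfolding set_lebesgue_integral_def
    using lborel_integral_real_affine[of "-1" "\<lambda>t. indicator {0<..<1} t *\<^sub>R f t" 1] by simp
  also have "\<dots> = integral {0..1} f"
    using integral_eq_LINT_continuous[OF assms] by simp
  finally show ?thesis .
qed

lemma one_minus_square_cut_plane: "Re x > 0 \<Longrightarrow> 1 - x\<^sup>2 \<in> cut_plane"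
  by (auto simp: cut_plane_iff power2_eq_square)

section \<open>Pfaff transformations and continuation across the cut\<close>

context
  fixes a b c :: complex
  assumes a: "Re a > 1" and ca: "Re (c - a) > 1"
begin

text \<open>Dilation by 1 / x^2 carries the pair (x^2, 1) to (1, 1 / x^2). With z = 1 - x^2 the new
  argument is the usual z / (z - 1).\<close>

lemma hypergeo_reg_Pfaff_1:
  assumes "x > 0"
  shows "hypergeo_reg a b c (1 - of_real (x\<^sup>2)) =
    of_real x powr (- 2 * a) * hypergeo_reg a (c - b) c (1 - of_real (1 / x\<^sup>2))"
proof -
  have cut: "1 - complex_of_real (x\<^sup>2) \<in> cut_plane" "1 - complex_of_real (1 / x\<^sup>2) \<in> cut_plane"
    using assms by (auto simp: cut_plane_iff)
  have pow: "of_real (1 / x\<^sup>2) powr a = complex_of_real x powr (- 2 * a)"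
    using assms by (simp add: of_real_powr_exp ln_div ln_realpow mult_ac del: of_real_divide of_real_power)
  show ?thesis
    using homog_Euler_scale[OF a ca, of "x\<^sup>2" 1 "1 / x\<^sup>2" b] assms
    by (simp only: homog_Euler_1(1)[OF a ca cut(1)] homog_Euler_1(2)[OF a ca cut(2)] pow) simp
qed

text \<open>Here the reflection t to 1 - t in Euler's integral is used: it exchanges a and c - a in
  the weight and pulls the factor x^2 out of the base of the remaining power.\<close>

lemma hypergeo_reg_Pfaff_2:
  assumes x: "x > 0"
  shows "hypergeo_reg a b c (1 - of_real (x\<^sup>2)) =
    of_real x powr (- 2 * b) * hypergeo_reg b (c - a) c (1 - of_real (1 / x\<^sup>2))"
proof -
  have cut: "1 - complex_of_real (x\<^sup>2) \<in> cut_plane" "1 - complex_of_real (1 / x\<^sup>2) \<in> cut_plane"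
    using assms by (auto simp: cut_plane_iff)
  let ?w = "1 - complex_of_real (x\<^sup>2)" and ?v = "1 - complex_of_real (1 / x\<^sup>2)"
  define f where "f = (\<lambda>t. beta_weight (c - a) a t * (1 - of_real t * ?v) powr (- b))"
  have cont: "continuous_on {0..1} f"
    unfolding f_def using one_minus_scale_not_nonpos[OF cut(2)]
    by (intro continuous_on_mult continuous_on_beta_weight continuous_on_powr_off_nonpos continuous_intros a ca) auto
  have eq: "beta_weight a (c - a) t * (1 - of_real t * ?w) powr (- b) = of_real x powr (- 2 * b) * f (1 - t)"
    if t: "t \<in> {0..1}" for t
  proof -
    define E where "E = 1 - t + t * x\<^sup>2"
    have p: "E > 0"
      unfolding E_def using t x by (cases "t = 0") (auto intro!: add_nonneg_pos)
    have 1: "1 - of_real t * ?w = complex_of_real E"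
      by (simp add: E_def algebra_simps)
    have "1 - (1 - t) * (1 - 1 / x\<^sup>2) = E / x\<^sup>2"
      using x by (simp add: E_def field_simps)
    from arg_cong[OF this, of complex_of_real]
    have 2: "1 - of_real (1 - t) * ?v = complex_of_real (E / x\<^sup>2)"
      by (simp only: of_real_diff of_real_mult of_real_1)
    have "of_real x powr (- 2 * b) * of_real (E / x\<^sup>2) powr (- b) = complex_of_real E powr (- b)"
      using p x by (simp add: of_real_powr_exp ln_div ln_realpow exp_add[symmetric] del: of_real_divide of_real_power)
        (simp add: algebra_simps)
    then show ?thesis
      unfolding f_def 1 2 beta_weight_def by simp
  qed
  have "hypergeo_reg a b c ?w = rGamma a * rGamma (c - a) *
      integral {0..1} (\<lambda>t. of_real x powr (- 2 * b) * f (1 - t))"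
    unfolding hypergeo_reg_commute[of a b] hypergeo_reg_Euler[OF a ca cut(1)]
    by (simp only: integral_cong[OF eq])
  also have "\<dots> = of_real x powr (- 2 * b) * (rGamma a * rGamma (c - a) * integral {0..1} f)"
    using integral_reflect_01[OF cont] by simp
  also have "rGamma a * rGamma (c - a) * integral {0..1} f = hypergeo_reg b (c - a) c ?v"
    using hypergeo_reg_Euler[of "c - a" c ?v b] a ca cut(2) by (simp add: f_def mult_ac)
  finally show ?thesis .
qed

lemma homog_Euler_slit_holomorphic: "(\<lambda>x. homog_Euler a b c x (1 / x)) holomorphic_on (- \<real>\<^sub>\<le>\<^sub>0)"
proof -
  let ?A = "\<lambda>x t. 1 - complex_of_real t + of_real t * x"
  have inv: "1 / x \<notin> \<real>\<^sub>\<le>\<^sub>0" if "x \<notin> \<real>\<^sub>\<le>\<^sub>0" for x :: complex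
    using that by (simp add: complex_nonpos_Reals_iff) (auto simp: Re_divide Im_divide divide_simps)
  have nn: "?A x t \<notin> \<real>\<^sub>\<le>\<^sub>0" "?A (1 / x) t \<notin> \<real>\<^sub>\<le>\<^sub>0" if "x \<in> - \<real>\<^sub>\<le>\<^sub>0" "t \<in> {0..1}" for x t
    using that inv[of x] slit_plane_affine[of x t] slit_plane_affine[of "1 / x" t] by auto
  show ?thesis
    unfolding homog_Euler_def
  proof (rule beta_weight_integral_holomorphic[OF a ca])
    fix x :: complex and t :: real assume xt: "x \<in> - \<real>\<^sub>\<le>\<^sub>0" "t \<in> {0..1}"
    then have "x \<noteq> 0" by auto
    have d1: "((\<lambda>x. ?A x t powr (- b)) has_field_derivative (- b * ?A x t powr (- b - 1)) * of_real t) (at x)"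
      by (rule DERIV_chain2[where f = "\<lambda>w. w powr (- b)" and g = "\<lambda>x. ?A x t", OF has_field_derivative_powr[OF nn(1)[OF xt]]])
        (auto intro!: derivative_eq_intros)
    have d2: "((\<lambda>x. ?A (1 / x) t powr (b - c)) has_field_derivative
        ((b - c) * ?A (1 / x) t powr (b - c - 1)) * (of_real t * (- 1 / x\<^sup>2))) (at x)"
      by (rule DERIV_chain2[where f = "\<lambda>w. w powr (b - c)" and g = "\<lambda>x. ?A (1 / x) t", OF has_field_derivative_powr[OF nn(2)[OF xt]]])
        (use \<open>x \<noteq> 0\<close> in \<open>auto intro!: derivative_eq_intros simp: power2_eq_square field_simps\<close>)
    from DERIV_mult[OF d1 d2]
    show "((\<lambda>x. ?A x t powr (- b) * ?A (1 / x) t powr (b - c)) has_field_derivative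
       (((b - c) * ?A (1 / x) t powr (b - c - 1)) * (of_real t * (- 1 / x\<^sup>2)) * ?A x t powr (- b) +
        (- b * ?A x t powr (- b - 1)) * of_real t * ?A (1 / x) t powr (b - c))) (at x)"
      by (simp add: add.commute)
  next
    have nz: "fst y \<noteq> 0" if "y \<in> (- \<real>\<^sub>\<le>\<^sub>0) \<times> {0..1::real}" for y :: "complex \<times> real"
      using that by auto
    have c1: "continuous_on ((- \<real>\<^sub>\<le>\<^sub>0) \<times> {0..1}) (\<lambda>y. ?A (fst y) (snd y) powr e)" for e
      by (intro continuous_on_powr_off_nonpos continuous_intros nn(1)) auto
    have c2: "continuous_on ((- \<real>\<^sub>\<le>\<^sub>0) \<times> {0..1}) (\<lambda>y. ?A (1 / fst y) (snd y) powr e)" for e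
      by (intro continuous_on_powr_off_nonpos continuous_intros nn(2)) (use nz in auto)
    show "continuous_on ((- \<real>\<^sub>\<le>\<^sub>0) \<times> {0..1}) (\<lambda>y. ?A (fst y) (snd y) powr (- b) * ?A (1 / fst y) (snd y) powr (b - c))"
      by (intro continuous_on_mult c1 c2)
    show "continuous_on ((- \<real>\<^sub>\<le>\<^sub>0) \<times> {0..1}) (\<lambda>y.
       ((b - c) * ?A (1 / fst y) (snd y) powr (b - c - 1)) * (of_real (snd y) * (- 1 / (fst y)\<^sup>2)) * ?A (fst y) (snd y) powr (- b) +
        (- b * ?A (fst y) (snd y) powr (- b - 1)) * of_real (snd y) * ?A (1 / fst y) (snd y) powr (b - c))"
      by (intro continuous_on_mult continuous_on_add c1 c2 continuous_on_const continuous_on_of_real continuous_on_snd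
          continuous_on_id continuous_on_divide continuous_on_power continuous_on_fst) (use nz in auto)
  qed auto
qed

text \<open>For the pair (x^2, 1) the integral is holomorphic only while x^2 avoids the nonpositive
  reals, that is for Re x > 0. Dilation by 1 / x balances the pair to (x, 1 / x), at the price of
  the factor x^(-a); inversion preserves the slit plane, so this form is holomorphic for all x off
  the nonpositive reals.\<close>

lemma hypergeo_reg_continuation_slit:
  "\<exists>L. L holomorphic_on (- \<real>\<^sub>\<le>\<^sub>0) \<and> (\<forall>x. Re x > 0 \<longrightarrow> L x = hypergeo_reg a b c (1 - x\<^sup>2))"
proof (intro exI conjI allI impI)
  let ?L = "\<lambda>x. rGamma a * rGamma (c - a) * (x powr (- a) * homog_Euler a b c x (1 / x))"
  show L: "?L holomorphic_on (- \<real>\<^sub>\<le>\<^sub>0)"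
    by (intro holomorphic_intros homog_Euler_slit_holomorphic) auto
  fix x :: complex assume "Re x > 0"
  show "?L x = hypergeo_reg a b c (1 - x\<^sup>2)"
  proof (rule analytic_continuation_real_interval[where f = ?L and l = 0 and u = 1 and S = "{x. Re x > 0}"])
    show "?L holomorphic_on {x. Re x > 0}"
      by (rule holomorphic_on_subset[OF L]) (auto simp: complex_nonpos_Reals_iff)
    have "(hypergeo_reg a b c \<circ> (\<lambda>x. 1 - x\<^sup>2)) holomorphic_on {x. Re x > 0}"
      by (rule holomorphic_on_compose_gen[OF _ hypergeo_reg_holomorphic])
        (auto intro!: holomorphic_intros simp: one_minus_square_cut_plane)
    then show "(\<lambda>x. hypergeo_reg a b c (1 - x\<^sup>2)) holomorphic_on {x. Re x > 0}"
      by (simp add: o_def)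
    show "?L (of_real r) = hypergeo_reg a b c (1 - (of_real r)\<^sup>2)" if "0 < r" "r < 1" for r
    proof -
      have cut: "1 - complex_of_real (r\<^sup>2) \<in> cut_plane"
        using that by (auto simp: cut_plane_iff)
      have "(1 / r) * r\<^sup>2 = r"
        using that by (simp add: power2_eq_square)
      moreover have "of_real (1 / r) powr a = complex_of_real r powr (- a)"
        using that by (simp add: of_real_powr_exp ln_div del: of_real_divide)
      ultimately have "homog_Euler a b c (of_real (r\<^sup>2)) (of_real 1) = of_real r powr (- a) * homog_Euler a b c (of_real r) (of_real (1 / r))"
        using homog_Euler_scale[OF a ca, of "r\<^sup>2" 1 "1 / r" b] that by (simp only: mult_1_right) simp
      with homog_Euler_1(1)[OF a ca cut, of b] show ?thesis by simp
    qed
    show "connected {x. Re x > 0}"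
      by (intro convex_connected convex_halfspace_Re_gt)
  qed (use \<open>Re x > 0\<close> in \<open>auto simp: open_halfspace_Re_gt\<close>)
qed

end

section \<open>A quadratic transformation\<close>

lemma hypergeo_reg_fps:
  "hypergeo_reg a b c has_fps_expansion Abs_fps (hyp_coeff a b c)"
proof -
  have "hypergeo_reg a b c has_fps_expansion fps_expansion (hypergeo_reg a b c) 0"
    by (rule has_fps_expansion_fps_expansion[OF open_cut_plane _ hypergeo_reg_holomorphic])
      (simp add: norm_less_1_cut_plane)
  moreover have "eval_fps (Abs_fps (hyp_coeff a b c)) z = hypergeo_reg a b c z" if "z \<in> ball 0 1" for z
    using hypergeo_reg_sums[of z a b c] that by (simp add: eval_fps_def sums_iff)
  moreover have "fps_conv_radius (Abs_fps (hyp_coeff a b c)) > 0"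
  proof -
    have "ereal (norm (1 / 2 :: complex)) \<le> conv_radius (hyp_coeff a b c)"
      by (rule conv_radius_geI) (use hyp_series_sums[of "1/2" a b c] in \<open>auto simp: sums_iff\<close>)
    then have "conv_radius (hyp_coeff a b c) \<ge> ereal (1 / 2)"
      by simp
    then show ?thesis
      unfolding fps_conv_radius_def
      by (simp add: order.strict_trans2[of 0 "ereal (1/2)"])
  qed
  ultimately show ?thesis
    unfolding has_fps_expansion_def
    by (auto simp: eventually_nhds intro!: exI[of _ "ball 0 1"])
qed

text \<open>Near 0 the equation is \<open>hyp_coeff_rec\<close> read coefficient by coefficient; the
  identity theorem extends it to \<open>cut_plane\<close>.\<close>

lemma hypergeo_reg_ODE:
  assumes "z \<in> cut_plane"
  shows "z * (1 - z) * deriv (deriv (hypergeo_reg a b c)) z +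
    (c - (a + b + 1) * z) * deriv (hypergeo_reg a b c) z - a * b * hypergeo_reg a b c z = 0"
proof -
  let ?f = "hypergeo_reg a b c" and ?F = "Abs_fps (hyp_coeff a b c)"
  let ?E = "\<lambda>z. z * deriv (deriv ?f) z - z * (z * deriv (deriv ?f) z) + c * deriv ?f z -
     (a + b + 1) * (z * deriv ?f z) - a * b * ?f z"
  let ?G = "fps_X * fps_deriv (fps_deriv ?F) - fps_X * (fps_X * fps_deriv (fps_deriv ?F)) + fps_const c * fps_deriv ?F -
     fps_const (a + b + 1) * (fps_X * fps_deriv ?F) - fps_const (a * b) * ?F"
  have "?E has_fps_expansion ?G"
    by (intro has_fps_expansion_add has_fps_expansion_diff has_fps_expansion_mult has_fps_expansion_const
        has_fps_expansion_fps_X has_fps_expansion_deriv hypergeo_reg_fps)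
  also have "?G = 0"
  proof (rule fps_ext)
    fix n
    note rec = hyp_coeff_rec[of _ c a b]
    \<comment> \<open>Multiplication by \<open>fps_X\<close> shifts indices by up to two, so n = 0
      and n = 1 are treated separately.\<close>
    show "fps_nth ?G n = fps_nth 0 n"
    proof (cases n)
      case 0
      then show ?thesis using rec[of 0] by simp
    next
      case (Suc m)
      note n = this
      show ?thesis
      proof (cases m)
        case 0
        then show ?thesis using rec[of 1] n by (simp add: algebra_simps)
      next
        case (Suc k)
        then show ?thesis using rec[of n] n by (simp add: algebra_simps)
      qed
    qed
  qed
  finally have "?E has_fps_expansion 0" .
  moreover have "?E holomorphic_on cut_plane"
    by (intro holomorphic_intros holomorphic_deriv hypergeo_reg_holomorphic open_cut_plane)
  ultimately have "?E z = 0"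
    using open_cut_plane connected_cut_plane assms norm_less_1_cut_plane[of 0]
    by (intro has_fps_expansion_0_analytic_continuation[of ?E]) auto
  then show ?thesis by (simp add: algebra_simps)
qed

text \<open>Since \<open>A\<close> vanishes at the origin, the indicial polynomial is \<open>n (A\<^sub>1 (n - 1) + B\<^sub>0)\<close>; the
  hypothesis says that it has no positive integer root.\<close>

lemma fps_singular_ODE_unique:
  fixes A B C F :: "'a :: field_char_0 fps"
  assumes ode: "A * fps_deriv (fps_deriv F) + B * fps_deriv F + C * F = 0"
    and A0: "fps_nth A 0 = 0" and ind: "\<And>n. fps_nth A 1 * of_nat n + fps_nth B 0 \<noteq> 0"
    and F0: "fps_nth F 0 = 0"
  shows "F = 0"
proof (rule fps_ext)
  fix n show "fps_nth F n = fps_nth 0 n"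
  proof (induction n rule: less_induct)
    case (less n)
    show ?case
    proof (cases n)
      case 0
      then show ?thesis using F0 by simp
    next
      case (Suc m)
      then have low: "fps_nth F k = 0" if "k \<le> m" for k
        using less that by simp
      \<comment> \<open>Only i = 1 survives: for i = 0 the coefficient of \<open>A\<close> vanishes,
        and for i > 1 only coefficients of \<open>F\<close> up to index m occur. At m = 0 the
        right-hand side is 0 through the factor \<open>of_nat m\<close>.\<close>
      have "fps_nth A i * fps_nth (fps_deriv (fps_deriv F)) (m - i) =
          (if i = 1 then fps_nth A 1 * (of_nat m * of_nat (Suc m) * fps_nth F (Suc m)) else 0)" if "i \<le> m" for i
      proof (cases "i \<le> 1")
        case True
        then consider "i = 0" | "i = 1" by linarith
        then show ?thesis using that A0 by cases (auto simp: Suc_diff_Suc)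
      qed (use low that in \<open>auto simp: Suc_diff_le\<close>)
      then have 1: "fps_nth (A * fps_deriv (fps_deriv F)) m = fps_nth A 1 * (of_nat m * of_nat (Suc m) * fps_nth F (Suc m))"
        unfolding fps_mult_nth by (subst sum.cong[OF refl]) (auto simp: sum.delta)
      have "fps_nth B i * fps_nth (fps_deriv F) (m - i) =
          (if i = 0 then fps_nth B 0 * (of_nat (Suc m) * fps_nth F (Suc m)) else 0)" if "i \<le> m" for i
        using low that by auto
      then have 2: "fps_nth (B * fps_deriv F) m = fps_nth B 0 * (of_nat (Suc m) * fps_nth F (Suc m))"
        unfolding fps_mult_nth by (subst sum.cong[OF refl]) (auto simp: sum.delta)
      have 3: "fps_nth (C * F) m = 0"
        unfolding fps_mult_nth using low by (intro sum.neutral) auto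
      have "0 = fps_nth (A * fps_deriv (fps_deriv F) + B * fps_deriv F + C * F) m"
        using ode by simp
      also have "\<dots> = (fps_nth A 1 * of_nat m + fps_nth B 0) * (of_nat (Suc m) * fps_nth F (Suc m))"
        unfolding fps_add_nth 1 2 3 by (simp add: algebra_simps)
      finally have "of_nat (Suc m) * fps_nth F (Suc m) = 0"
        using ind[of m] by simp
      then show ?thesis
        using Suc by (simp del: of_nat_Suc)
    qed
  qed
qed

text \<open>A holomorphic solution vanishing at the regular singular point 0 has zero Taylor series
  there, hence is zero on the connected domain.\<close>

lemma singular_ODE_unique:
  fixes A B C d :: "complex \<Rightarrow> complex"
  assumes d: "d holomorphic_on U" "open U" "connected U" "0 \<in> U" "d 0 = 0"
    and exp: "A has_fps_expansion FA" "B has_fps_expansion FB" "C has_fps_expansion FC"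
    and ode: "\<And>e. e \<in> U \<Longrightarrow> A e * deriv (deriv d) e + B e * deriv d e + C e * d e = 0"
    and "fps_nth FA 0 = 0" "\<And>n. fps_nth FA 1 * of_nat n + fps_nth FB 0 \<noteq> 0"
    and "e \<in> U"
  shows "d e = 0"
proof -
  define F where "F = fps_expansion d 0"
  have F: "d has_fps_expansion F"
    unfolding F_def by (rule has_fps_expansion_fps_expansion) (use d in auto)
  have "(\<lambda>e. A e * deriv (deriv d) e + B e * deriv d e + C e * d e) has_fps_expansion
      (FA * fps_deriv (fps_deriv F) + FB * fps_deriv F + FC * F)"
    by (intro has_fps_expansion_add has_fps_expansion_mult has_fps_expansion_deriv exp F)
  moreover have "(\<lambda>e. A e * deriv (deriv d) e + B e * deriv d e + C e * d e) has_fps_expansion 0"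
    unfolding has_fps_expansion_def using d(2,4) ode
    by (auto simp: eventually_nhds intro!: exI[of _ U])
  ultimately have "FA * fps_deriv (fps_deriv F) + FB * fps_deriv F + FC * F = 0"
    by (rule fps_expansion_unique_complex)
  moreover have "fps_nth F 0 = 0"
    using has_fps_expansion_imp_0_eq_fps_nth_0[OF F] d(5) by simp
  ultimately have "F = 0"
    using assms by (intro fps_singular_ODE_unique[of FA F FB FC]) auto
  with F show ?thesis
    using has_fps_expansion_0_analytic_continuation[of d U e] assms by auto
qed

section \<open>The transformation proved by comparing differential equations\<close>

lemma DERIV_hypergeo_reg:
  assumes "z \<in> cut_plane"
  shows "(hypergeo_reg a b c has_field_derivative deriv (hypergeo_reg a b c) z) (at z)"
    and "(deriv (hypergeo_reg a b c) has_field_derivative deriv (deriv (hypergeo_reg a b c)) z) (at z)"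
  using holomorphic_derivI[OF hypergeo_reg_holomorphic open_cut_plane assms]
    holomorphic_derivI[OF holomorphic_deriv[OF hypergeo_reg_holomorphic open_cut_plane] open_cut_plane assms]
  by auto

text \<open>If the argument were a real r at least 1, then p + 1/p = 2 - 4 r would be negative,
  whereas p and 1/p both have positive real part.\<close>

lemma quadratic_argument_cut_plane:
  assumes "Re p > 0"
  shows "- ((1 - p)\<^sup>2) / (4 * p) \<in> cut_plane"
proof (rule ccontr)
  assume "- ((1 - p)\<^sup>2) / (4 * p) \<notin> cut_plane"
  then obtain r where r: "- ((1 - p)\<^sup>2) / (4 * p) = of_real r" "r \<ge> 1"
    unfolding cut_plane_def by auto
  have "p \<noteq> 0" using assms by auto
  with r(1) have "- ((1 - p)\<^sup>2) = of_real r * (4 * p)"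
    by (simp add: field_simps)
  then have "p * p + 1 = (2 - 4 * of_real r) * p"
    by (simp add: power2_eq_square algebra_simps)
  then have "p + inverse p = 2 - 4 * of_real r"
    using \<open>p \<noteq> 0\<close> by (simp add: field_simps)
  then have "Re (p + inverse p) = Re (2 - 4 * of_real r)"
    by simp
  then have "Re p + Re p / ((Re p)\<^sup>2 + (Im p)\<^sup>2) = 2 - 4 * r"
    by simp
  moreover have "Re p / ((Re p)\<^sup>2 + (Im p)\<^sup>2) \<ge> 0"
    using assms by (intro divide_nonneg_nonneg) auto
  ultimately show False
    using r(2) assms by linarith
qed

text \<open>Both sides solve the same second-order equation, which has a regular singular point at p
  = 1 with exponents 0 and 1 - 2m. Since Re m > 0, the second is not a positive integer, so a
  solution holomorphic there is determined by its value at 1, and the Gamma factors normalize both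
  sides to 1 at that point.\<close>

theorem hypergeo_reg_quadratic:
  fixes l m p :: complex
  assumes m: "Re m > 0" and p: "Re p > 0"
  shows "Gamma (2 * m) * (p powr (- l) * hypergeo_reg (- l) m (2 * m) (1 - p\<^sup>2)) =
    Gamma (m + 1 / 2) * hypergeo_reg (- l) (2 * m + l) (m + 1 / 2) (- ((1 - p)\<^sup>2) / (4 * p))"
proof -
  define f where "f = hypergeo_reg (- l) m (2 * m)"
  define g where "g = hypergeo_reg (- l) (2 * m + l) (m + 1 / 2)"
  define X where "X = (\<lambda>p::complex. 1 - p\<^sup>2)"
  define Y where "Y = (\<lambda>p::complex. - ((1 - p)\<^sup>2) / (4 * p))"
  define E where "E = (\<lambda>p::complex. p powr (- l))"
  \<comment> \<open>The \<open>J\<close> and \<open>K\<close> families are the two sides, apart from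
    their Gamma factors, with their first and second derivatives.\<close>
  define J0 where "J0 = (\<lambda>p. E p * f (X p))"
  define J1 where "J1 = (\<lambda>p. E p * (- l / p * f (X p) - 2 * p * deriv f (X p)))"
  define J2 where "J2 = (\<lambda>p. E p * ((l\<^sup>2 + l) / p\<^sup>2 * f (X p) + (4 * l - 2) * deriv f (X p) + 4 * p\<^sup>2 * deriv (deriv f) (X p)))"
  define K0 where "K0 = (\<lambda>p. g (Y p))"
  define K1 where "K1 = (\<lambda>p. deriv g (Y p) * ((1 - p\<^sup>2) / (4 * p\<^sup>2)))"
  define K2 where "K2 = (\<lambda>p. deriv (deriv g) (Y p) * ((1 - p\<^sup>2) / (4 * p\<^sup>2))\<^sup>2 - deriv g (Y p) / (2 * p ^ 3))"
  \<comment> \<open>Gegenbauer's differential equation in the variable \<open>p = exp (- \<theta>)\<close>, where \<open>u = cosh \<theta>\<close>\<close>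
  define ode where "ode = (\<lambda>p y0 y1 y2. (1 - p\<^sup>2) * p\<^sup>2 * y2 +
     ((1 - p\<^sup>2) * p - 2 * m * (1 + p\<^sup>2) * p) * y1 - l * (l + 2 * m) * (1 - p\<^sup>2) * y0 :: complex)"
  define D where "D = (\<lambda>p. Gamma (2 * m) * J0 p - Gamma (m + 1 / 2) * K0 p)"
  define D1 where "D1 = (\<lambda>p. Gamma (2 * m) * J1 p - Gamma (m + 1 / 2) * K1 p)"
  define D2 where "D2 = (\<lambda>p. Gamma (2 * m) * J2 p - Gamma (m + 1 / 2) * K2 p)"
  have X: "X p \<in> cut_plane" and Y: "Y p \<in> cut_plane" and nz: "p \<noteq> 0" if "Re p > 0" for p
    using that one_minus_square_cut_plane quadratic_argument_cut_plane by (auto simp: X_def Y_def)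
  note f' = DERIV_hypergeo_reg[of _ "- l" m "2 * m", folded f_def]
  note g' = DERIV_hypergeo_reg[of _ "- l" "2 * m + l" "m + 1 / 2", folded g_def]
  have dX: "(X has_field_derivative - 2 * p) (at p)" for p
    unfolding X_def by (auto intro!: derivative_eq_intros)
  have dY: "(Y has_field_derivative (1 - p\<^sup>2) / (4 * p\<^sup>2)) (at p)" if "p \<noteq> 0" for p
    unfolding Y_def using that by (auto intro!: derivative_eq_intros simp: power2_eq_square field_simps)
  have dE: "(E has_field_derivative - l * E p / p) (at p)" if "Re p > 0" for p
  proof -
    have "p \<notin> \<real>\<^sub>\<le>\<^sub>0" using that by (auto simp: complex_nonpos_Reals_iff)
    from has_field_derivative_powr[OF this, of "- l"] nz[OF that] show ?thesis
      by (simp add: E_def powr_diff)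
  qed
  have df: "((\<lambda>p. f (X p)) has_field_derivative deriv f (X p) * (- 2 * p)) (at p)"
    "((\<lambda>p. deriv f (X p)) has_field_derivative deriv (deriv f) (X p) * (- 2 * p)) (at p)"
    if "Re p > 0" for p
    using DERIV_chain2[OF f'(1) dX] DERIV_chain2[OF f'(2) dX] X[OF that] by auto
  have dg: "(K0 has_field_derivative K1 p) (at p)"
    "((\<lambda>p. deriv g (Y p)) has_field_derivative deriv (deriv g) (Y p) * ((1 - p\<^sup>2) / (4 * p\<^sup>2))) (at p)"
    if "Re p > 0" for p
    using DERIV_chain2[OF g'(1) dY] DERIV_chain2[OF g'(2) dY] Y[OF that] nz[OF that]
    by (auto simp: K0_def K1_def)
  have dJ0: "(J0 has_field_derivative J1 p) (at p)" if "Re p > 0" for p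
    unfolding J0_def
    by (rule DERIV_cong[OF DERIV_mult[OF dE[OF that] df(1)[OF that]]])
      (use nz[OF that] in \<open>simp add: J1_def field_simps\<close>)
  have dJ1: "(J1 has_field_derivative J2 p) (at p)" if "Re p > 0" for p
  proof -
    have dp: "((\<lambda>p. - l / p) has_field_derivative l / p\<^sup>2) (at p)"
      using nz[OF that] by (auto intro!: derivative_eq_intros simp: power2_eq_square)
    have "((\<lambda>p. - l / p * f (X p) - 2 * p * deriv f (X p)) has_field_derivative
        (l / p\<^sup>2 * f (X p) + deriv f (X p) * (- 2 * p) * (- l / p)) -
        (2 * deriv f (X p) + deriv (deriv f) (X p) * (- 2 * p) * (2 * p))) (at p)"
      by (intro DERIV_diff DERIV_mult dp df that) (auto intro!: derivative_eq_intros)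
    from DERIV_mult[OF dE[OF that] this] show ?thesis
      unfolding J1_def
      by (rule DERIV_cong) (use nz[OF that] in \<open>simp add: J2_def field_simps power2_eq_square\<close>)
  qed
  have dK1: "(K1 has_field_derivative K2 p) (at p)" if "Re p > 0" for p
  proof -
    have "((\<lambda>p. (1 - p\<^sup>2) / (4 * p\<^sup>2)) has_field_derivative - 1 / (2 * p ^ 3)) (at p)"
      using nz[OF that] by (auto intro!: derivative_eq_intros simp: power2_eq_square power3_eq_cube field_simps)
    from DERIV_mult[OF dg(2)[OF that] this] show ?thesis
      unfolding K1_def by (rule DERIV_cong) (simp add: K2_def power2_eq_square)
  qed
  have dD: "(D has_field_derivative D1 p) (at p)" "(D1 has_field_derivative D2 p) (at p)" if "Re p > 0" for p
    unfolding D_def[abs_def] D1_def D2_def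
    by (intro DERIV_diff DERIV_cmult dJ0 dJ1 dK1 dg that)+
  have ode_J: "ode p (J0 p) (J1 p) (J2 p) = 0" if "Re p > 0" for p
  proof -
    have 1: "p\<^sup>2 * J2 p = E p * ((l\<^sup>2 + l) * f (X p) + p\<^sup>2 * (4 * l - 2) * deriv f (X p) + 4 * p\<^sup>2 * p\<^sup>2 * deriv (deriv f) (X p))"
      and 2: "p * J1 p = E p * (- l * f (X p) - 2 * p\<^sup>2 * deriv f (X p))"
      using nz[OF that] by (simp_all add: J1_def J2_def field_simps power2_eq_square)
    have "ode p (J0 p) (J1 p) (J2 p) = (1 - p\<^sup>2) * (p\<^sup>2 * J2 p) +
        ((1 - p\<^sup>2) - 2 * m * (1 + p\<^sup>2)) * (p * J1 p) - l * (l + 2 * m) * (1 - p\<^sup>2) * J0 p"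
      by (simp add: ode_def algebra_simps)
    also have "\<dots> = 4 * p\<^sup>2 * E p * (X p * (1 - X p) * deriv (deriv f) (X p) +
        (2 * m - (- l + m + 1) * X p) * deriv f (X p) - - l * m * f (X p))"
      unfolding 1 2 J0_def by (simp add: X_def algebra_simps power2_eq_square)
    also have "\<dots> = 0"
      using hypergeo_reg_ODE[OF X[OF that], of "- l" m "2 * m"] by (simp add: f_def)
    finally show ?thesis .
  qed
  have ode_K: "ode p (K0 p) (K1 p) (K2 p) = 0" if "Re p > 0" for p
  proof -
    have 1: "p\<^sup>2 * ((1 - p\<^sup>2) / (4 * p\<^sup>2))\<^sup>2 = - (Y p * (1 - Y p))"
      using nz[OF that] by (simp add: Y_def field_simps power2_eq_square)
    have 2: "((1 - p\<^sup>2) * p - 2 * m * (1 + p\<^sup>2) * p) * ((1 - p\<^sup>2) / (4 * p\<^sup>2)) - (1 - p\<^sup>2) * p\<^sup>2 / (2 * p ^ 3) =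
        - (1 - p\<^sup>2) * (m + 1 / 2 - (2 * m + 1) * Y p)"
      using nz[OF that] by (simp add: Y_def field_simps power2_eq_square power3_eq_cube)
    have "ode p (K0 p) (K1 p) (K2 p) = (1 - p\<^sup>2) * (p\<^sup>2 * ((1 - p\<^sup>2) / (4 * p\<^sup>2))\<^sup>2) * deriv (deriv g) (Y p) +
        (((1 - p\<^sup>2) * p - 2 * m * (1 + p\<^sup>2) * p) * ((1 - p\<^sup>2) / (4 * p\<^sup>2)) - (1 - p\<^sup>2) * p\<^sup>2 / (2 * p ^ 3)) * deriv g (Y p) -
        l * (l + 2 * m) * (1 - p\<^sup>2) * g (Y p)"
      by (simp add: ode_def K0_def K1_def K2_def diff_divide_distrib add_divide_distrib ring_distribs mult_ac)
    also have "\<dots> = - (1 - p\<^sup>2) * (Y p * (1 - Y p) * deriv (deriv g) (Y p) +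
        (m + 1 / 2 - (- l + (2 * m + l) + 1) * Y p) * deriv g (Y p) - - l * (2 * m + l) * g (Y p))"
      unfolding 1 2 by (simp add: algebra_simps diff_divide_distrib)
    also have "\<dots> = 0"
      using hypergeo_reg_ODE[OF Y[OF that], of "- l" "2 * m + l" "m + 1 / 2"] by (simp add: g_def)
    finally show ?thesis .
  qed
  have ode_D: "ode p (D p) (D1 p) (D2 p) = 0" if "Re p > 0" for p
  proof -
    have "ode p (D p) (D1 p) (D2 p) = Gamma (2 * m) * ode p (J0 p) (J1 p) (J2 p) -
        Gamma (m + 1 / 2) * ode p (K0 p) (K1 p) (K2 p)"
      by (simp add: ode_def D_def D1_def D2_def algebra_simps)
    with ode_J ode_K that show ?thesis by simp
  qed
  \<comment> \<open>Translation moves the singular point p = 1 to the origin and the half plane Re p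
    > 0 to \<open>U\<close>.\<close>
  define d where "d = (\<lambda>e. D (1 + e))"
  define U where "U = {e. Re e > - 1}"
  have U: "open U" "connected U"
    unfolding U_def by (simp_all add: open_halfspace_Re_gt convex_connected convex_halfspace_Re_gt)
  have shift: "((\<lambda>e. 1 + e) has_field_derivative 1) (at e)" for e :: complex
    by (auto intro!: derivative_eq_intros)
  have d1: "(d has_field_derivative D1 (1 + e)) (at e)" if "e \<in> U" for e
    using DERIV_chain2[OF dD(1) shift, of e] that by (simp add: d_def U_def)
  have d2: "(deriv d has_field_derivative D2 (1 + e)) (at e)" if "e \<in> U" for e
  proof (rule has_field_derivative_transform_within_open[OF _ U(1) that])
    show "((\<lambda>e. D1 (1 + e)) has_field_derivative D2 (1 + e)) (at e)"
      using DERIV_chain2[OF dD(2) shift, of e] that by (simp add: U_def)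
  qed (use d1 DERIV_imp_deriv in metis)
  have "d (p - 1) = 0"
  proof (rule singular_ODE_unique[where d = d and U = U and e = "p - 1" and A = "\<lambda>e. e * (- (2 + e) * (1 + e)\<^sup>2)" and
        B = "\<lambda>e. (1 - (1 + e)\<^sup>2) * (1 + e) - 2 * m * (1 + (1 + e)\<^sup>2) * (1 + e)" and
        C = "\<lambda>e. - (l * (l + 2 * m) * (1 - (1 + e)\<^sup>2))"])
    show "d holomorphic_on U"
      using d1 U(1) by (auto simp: holomorphic_on_open)
    show "d 0 = 0"
      using m not_nonpos_Ints_Re_pos[of "2 * m"] not_nonpos_Ints_Re_pos[of "m + 1 / 2"]
      by (simp add: d_def D_def J0_def K0_def E_def X_def Y_def f_def g_def hypergeo_reg_0 rGamma_inverse_Gamma Gamma_eq_zero_iff)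
    show "e * (- (2 + e) * (1 + e)\<^sup>2) * deriv (deriv d) e +
        ((1 - (1 + e)\<^sup>2) * (1 + e) - 2 * m * (1 + (1 + e)\<^sup>2) * (1 + e)) * deriv d e +
        - (l * (l + 2 * m) * (1 - (1 + e)\<^sup>2)) * d e = 0" if "e \<in> U" for e
    proof -
      have eq: "e * (- (2 + e) * (1 + e)\<^sup>2) = (1 - (1 + e)\<^sup>2) * (1 + e)\<^sup>2"
        by (simp add: power2_eq_square algebra_simps)
      show ?thesis
        using ode_D[of "1 + e"] that
        unfolding eq DERIV_imp_deriv[OF d1[OF that]] DERIV_imp_deriv[OF d2[OF that]]
        by (simp add: ode_def d_def U_def)
    qed
    show "(\<lambda>e::complex. e * (- (2 + e) * (1 + e)\<^sup>2)) has_fps_expansion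
        fps_X * (- (fps_const 2 + fps_X) * (1 + fps_X)\<^sup>2)"
      by (intro fps_expansion_intros)
    show "(\<lambda>e. (1 - (1 + e)\<^sup>2) * (1 + e) - 2 * m * (1 + (1 + e)\<^sup>2) * (1 + e)) has_fps_expansion
        (1 - (1 + fps_X)\<^sup>2) * (1 + fps_X) - fps_const (2 * m) * (1 + (1 + fps_X)\<^sup>2) * (1 + fps_X)"
      by (intro fps_expansion_intros)
    show "(\<lambda>e. - (l * (l + 2 * m) * (1 - (1 + e)\<^sup>2))) has_fps_expansion
        - (fps_const (l * (l + 2 * m)) * (1 - (1 + fps_X)\<^sup>2))"
      by (intro fps_expansion_intros)
    \<comment> \<open>The two coefficients are -2 and -4m, so a zero would force 2m = -n.\<close>
    show "fps_nth (fps_X * (- (fps_const 2 + fps_X) * (1 + fps_X)\<^sup>2)) 1 * of_nat n +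
      fps_nth ((1 - (1 + fps_X)\<^sup>2) * (1 + fps_X) - fps_const (2 * m) * (1 + (1 + fps_X)\<^sup>2) * (1 + fps_X)) 0 \<noteq> 0" for n
    proof
      assume "fps_nth (fps_X * (- (fps_const 2 + fps_X) * (1 + fps_X)\<^sup>2)) 1 * of_nat n +
        fps_nth ((1 - (1 + fps_X)\<^sup>2) * (1 + fps_X) - fps_const (2 * m) * (1 + (1 + fps_X)\<^sup>2) * (1 + fps_X)) 0 = 0"
      then have "- of_nat n = 2 * m"
        by (simp add: fps_power_zeroth)
      then have "Re (- of_nat n) = Re (2 * m)" by simp
      with m show False by simp
    qed
  qed (use U p in \<open>auto simp: U_def\<close>)
  then have "D p = 0"
    by (simp add: d_def)
  then show ?thesis
    unfolding D_def J0_def K0_def E_def X_def Y_def f_def g_def by simp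
qed

section \<open>Iterated fractional integrals\<close>

text \<open>Inside the unit disc the series proof needs only positive real parts, unlike
  \<open>hypergeo_reg_Euler\<close>. This is essential for the kernel, where b = m and only Re m > 0
  is known.\<close>

lemma hypergeo_reg_Euler_LINT:
  assumes b: "Re b > 0" and c: "Re (c - b) > 0" and x: "norm x < 1"
  shows "(LINT t:{0<..<1}|lborel. beta_weight b (c - b) t * (1 - of_real t * x) powr (- a)) =
    Gamma b * Gamma (c - b) * hypergeo_reg a b c x"
proof -
  have "hypergeo_reg a b c x = rGamma b * rGamma (c - b) *
      (LINT t:{0<..<1}|lborel. beta_weight b (c - b) t * (1 - of_real t * x) powr (- a))"
    using sums_unique2[OF hypergeo_reg_sums[OF x] Euler_integral_sums[OF b c x]] .
  then show ?thesis
    using Gamma_nonzero_Re_pos[of b] Gamma_nonzero_Re_pos[of "c - b"] b c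
    by (simp add: rGamma_inverse_Gamma field_simps)
qed

lemma of_real_powr_mult:
  "x > 0 \<Longrightarrow> y > 0 \<Longrightarrow> complex_of_real (x * y) powr p = of_real x powr p * of_real y powr p"
  by (simp add: of_real_powr_exp ln_mult exp_add[symmetric] ring_distribs del: of_real_mult)

text \<open>Put r = Y - (Y - y) t. Both differences acquire a factor Y - y, while r = Y (1 - t v)
  with v = 1 - y / Y, so Euler's integral with weight exponents m and m remains.\<close>

lemma double_power_kernel:
  fixes m l :: complex
  assumes m: "Re m > 0" and y: "0 < y" "y < Y"
  shows "(LINT r:{y<..<Y}|lborel. of_real r powr l * of_real (Y - r) powr (m - 1) * of_real (r - y) powr (m - 1)) =
    of_real Y powr (2 * m - 1 + l) * of_real (1 - y / Y) powr (2 * m - 1) *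
      (Gamma m * Gamma m * hypergeo_reg (- l) m (2 * m) (of_real (1 - y / Y)))"
proof -
  let ?f = "\<lambda>r. of_real r powr l * of_real (Y - r) powr (m - 1) * of_real (r - y) powr (m - 1) :: complex"
  let ?v = "1 - y / Y"
  have Y: "Y > 0" and v: "0 < ?v" "?v < 1"
    using y by (auto simp: field_simps)
  have "(LINT r:{y<..<Y}|lborel. ?f r) = (Y - y) *\<^sub>R
      (LINT t|lborel. indicator {y<..<Y} (Y + (y - Y) * t) *\<^sub>R ?f (Y + (y - Y) * t))"
    unfolding set_lebesgue_integral_def
    using y by (subst lborel_integral_real_affine[of "y - Y" _ Y]) auto
  also have "(LINT t|lborel. indicator {y<..<Y} (Y + (y - Y) * t) *\<^sub>R ?f (Y + (y - Y) * t)) =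
     (LINT t:{0<..<1}|lborel. of_real (Y - y) powr (2 * m - 2) * of_real Y powr l *
        (beta_weight m (2 * m - m) t * (1 - of_real t * of_real ?v) powr (- (- l))))"
    unfolding set_lebesgue_integral_def
  proof (intro Bochner_Integration.integral_cong refl)
    fix t :: real
    have ind: "Y + (y - Y) * t \<in> {y<..<Y} \<longleftrightarrow> t \<in> {0<..<1}"
    proof -
      have "y < Y + (y - Y) * t \<longleftrightarrow> 0 < (Y - y) * (1 - t)" "Y + (y - Y) * t < Y \<longleftrightarrow> 0 < (Y - y) * t"
        by (auto simp: algebra_simps)
      with y show ?thesis by (auto simp: zero_less_mult_iff)
    qed
    show "indicator {y<..<Y} (Y + (y - Y) * t) *\<^sub>R ?f (Y + (y - Y) * t) =
       indicator {0<..<1} t *\<^sub>R (of_real (Y - y) powr (2 * m - 2) * of_real Y powr l *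
        (beta_weight m (2 * m - m) t * (1 - of_real t * of_real ?v) powr (- (- l))))"
    proof (cases "t \<in> {0<..<1}")
      case True
      have "t * ?v < 1 * 1"
        using True v by (intro mult_strict_mono) auto
      then have 1: "1 - t * ?v > 0" by simp
      have e1: "Y + (y - Y) * t = Y * (1 - t * ?v)"
        and e2: "Y - (Y + (y - Y) * t) = (Y - y) * t"
        and e3: "Y + (y - Y) * t - y = (Y - y) * (1 - t)"
        using Y by (auto simp: field_simps)
      have "of_real (Y - y) powr (2 * m - 2) = of_real (Y - y) powr (m - 1) * (of_real (Y - y) powr (m - 1) :: complex)"
        unfolding powr_add[symmetric] by simp
      moreover have "?f (Y + (y - Y) * t) = (of_real Y powr l * of_real (1 - t * ?v) powr l) *
          (of_real (Y - y) powr (m - 1) * of_real t powr (m - 1)) *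
          (of_real (Y - y) powr (m - 1) * of_real (1 - t) powr (m - 1))"
        unfolding e2 e3 unfolding e1
        using True y Y 1 by (simp only: of_real_powr_mult greaterThanLessThan_iff diff_gt_0_iff_gt)
      moreover have "of_real (1 - t * ?v) = 1 - complex_of_real t * of_real ?v"
        by simp
      ultimately show ?thesis
        using True ind by (simp add: beta_weight_def indicator_def)
    qed (use ind in \<open>auto simp: indicator_def\<close>)
  qed
  also have "\<dots> = of_real (Y - y) powr (2 * m - 2) * of_real Y powr l *
      (LINT t:{0<..<1}|lborel. beta_weight m (2 * m - m) t * (1 - of_real t * of_real ?v) powr (- (- l)))"
    by (rule set_integral_mult_right)
  also have "(LINT t:{0<..<1}|lborel. beta_weight m (2 * m - m) t * (1 - of_real t * of_real ?v) powr (- (- l))) =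
     Gamma m * Gamma (2 * m - m) * hypergeo_reg (- l) m (2 * m) (of_real ?v)"
    by (rule hypergeo_reg_Euler_LINT) (use m v in \<open>auto simp del: of_real_diff\<close>)
  finally have "(LINT r:{y<..<Y}|lborel. ?f r) = (of_real (Y - y) * of_real (Y - y) powr (2 * m - 2)) * of_real Y powr l *
      (Gamma m * Gamma m * hypergeo_reg (- l) m (2 * m) (of_real ?v))"
    by (simp add: scaleR_conv_of_real)
  also have "of_real (Y - y) * of_real (Y - y) powr (2 * m - 2) = complex_of_real (Y - y) powr (2 * m - 1)"
    using y powr_add[of "of_real (Y - y)" 1 "2 * m - 2"] by (simp del: of_real_diff)
  also have "Y - y = Y * ?v"
    using Y by (simp add: field_simps)
  also have "of_real (Y * ?v) powr (2 * m - 1) = of_real Y powr (2 * m - 1) * complex_of_real ?v powr (2 * m - 1)"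
    using Y v(1) by (rule of_real_powr_mult)
  finally show ?thesis
    by (simp add: powr_add mult_ac)
qed

text \<open>The Beta value at p + n and q is Gamma(p+n) Gamma(q) / Gamma(p+q+n), so termwise
  integration replaces (p+q)_n by (p)_n, up to a constant, and leaves the other two parameters
  alone.\<close>

lemma fractional_integral_hypergeo:
  fixes p q :: complex
  assumes p: "Re p > 0" and q: "Re q > 0" and s: "0 < s" "s < 1"
  shows "(LINT r:{0<..<s}|lborel.
      hypergeo_reg a (p + q) c (of_real r) * of_real r powr (p - 1) * of_real (s - r) powr (q - 1)) =
    Gamma p * Gamma q / Gamma (p + q) * of_real s powr (p + q - 1) * hypergeo_reg a p c (of_real s)"
proof -
  define C where "C = hyp_coeff a (p + q) c"
  have sum: "summable (\<lambda>n. norm (C n) * s ^ n)"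
    using summable_hyp_coeff[of "of_real s" a "p + q" c] s by (simp add: C_def norm_mult norm_power)
  have ser: "(\<Sum>n. C n * of_real r ^ n) = hypergeo_reg a (p + q) c (of_real r)" if "r \<in> {0<..<s}" for r
    using hypergeo_reg_sums[of "of_real r" a "p + q" c] that s by (simp add: C_def sums_iff)
  have "(LINT r:{0<..<s}|lborel. (\<Sum>n. C n * of_real r ^ n) * of_real r powr (p - 1) * of_real (s - r) powr (q - 1)) =
    (LINT r:{0<..<s}|lborel. hypergeo_reg a (p + q) c (of_real r) * of_real r powr (p - 1) * of_real (s - r) powr (q - 1))"
    by (rule set_lebesgue_integral_cong) (use ser in auto)
  with fractional_integral_power_series_sums[OF p q s(1) sum] have "(\<lambda>n. C n * (Beta (p + of_nat n) q * of_real s powr (p + of_nat n + q - 1))) sums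
      (LINT r:{0<..<s}|lborel. hypergeo_reg a (p + q) c (of_real r) * of_real r powr (p - 1) * of_real (s - r) powr (q - 1))"
    by simp
  also have "(\<lambda>n. C n * (Beta (p + of_nat n) q * of_real s powr (p + of_nat n + q - 1))) =
      (\<lambda>n. Gamma p * Gamma q / Gamma (p + q) * of_real s powr (p + q - 1) * (hyp_coeff a p c n * of_real s ^ n))"
  proof
    fix n
    have nz: "Gamma (p + q + of_nat n) \<noteq> 0" "Gamma (p + q) \<noteq> 0" "Gamma p \<noteq> 0"
      using p q Gamma_nonzero_Re_pos[of "p + q + of_nat n"] Gamma_nonzero_Re_pos[of "p + q"] Gamma_nonzero_Re_pos[of p]
      by auto
    have 1: "pochhammer (p + q) n = Gamma (p + q + of_nat n) / Gamma (p + q)" "Gamma (p + of_nat n) = pochhammer p n * Gamma p"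
      using nz not_nonpos_Ints_Re_pos[of "p + q"] not_nonpos_Ints_Re_pos[of p] p q by (auto simp: pochhammer_Gamma)
    have 2: "p + of_nat n + q = p + q + of_nat n" by simp
    have 3: "p + q + of_nat n - 1 = of_nat n + (p + q - 1)" by simp
    have 4: "of_real s powr (p + of_nat n + q - 1) = complex_of_real s ^ n * of_real s powr (p + q - 1)"
      unfolding 2 3 powr_add using s by (simp add: powr_nat')
    show "C n * (Beta (p + of_nat n) q * of_real s powr (p + of_nat n + q - 1)) =
      Gamma p * Gamma q / Gamma (p + q) * of_real s powr (p + q - 1) * (hyp_coeff a p c n * of_real s ^ n)"
      unfolding 4 unfolding C_def hyp_coeff_def Beta_def 2 1 using nz by simp
  qed
  finally have "(\<lambda>n. Gamma p * Gamma q / Gamma (p + q) * of_real s powr (p + q - 1) * (hyp_coeff a p c n * of_real s ^ n)) sums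
      (LINT r:{0<..<s}|lborel. hypergeo_reg a (p + q) c (of_real r) * of_real r powr (p - 1) * of_real (s - r) powr (q - 1))" .
  moreover have "(\<lambda>n. Gamma p * Gamma q / Gamma (p + q) * of_real s powr (p + q - 1) * (hyp_coeff a p c n * of_real s ^ n)) sums
      (Gamma p * Gamma q / Gamma (p + q) * of_real s powr (p + q - 1) * hypergeo_reg a p c (of_real s))"
    by (intro sums_mult hypergeo_reg_sums) (use s in auto)
  ultimately show "(LINT r:{0<..<s}|lborel.
      hypergeo_reg a (p + q) c (of_real r) * of_real r powr (p - 1) * of_real (s - r) powr (q - 1)) =
      Gamma p * Gamma q / Gamma (p + q) * of_real s powr (p + q - 1) * hypergeo_reg a p c (of_real s)"
    by (rule sums_unique2)
qed

lemma hypergeo_reg_bounded: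
  assumes "0 < Y" "Y < 1"
  obtains M where "M \<ge> 0" "\<And>y. 0 \<le> y \<Longrightarrow> y \<le> Y \<Longrightarrow> norm (hypergeo_reg a b c (of_real y)) \<le> M"
proof -
  have sub: "complex_of_real ` {0..Y} \<subseteq> cut_plane"
    using assms by (auto simp: cut_plane_iff)
  have "continuous_on {0..Y} (\<lambda>y. hypergeo_reg a b c (complex_of_real y))"
    by (rule continuous_on_compose2[OF holomorphic_on_imp_continuous_on[OF hypergeo_reg_holomorphic]])
      (use sub in \<open>auto intro!: continuous_intros\<close>)
  then have "bounded ((\<lambda>y. hypergeo_reg a b c (complex_of_real y)) ` {0..Y})"
    by (intro compact_imp_bounded compact_continuous_image) auto
  then obtain M where "\<forall>x\<in>(\<lambda>y. hypergeo_reg a b c (complex_of_real y)) ` {0..Y}. norm x \<le> M"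
    by (auto simp: bounded_iff)
  then show ?thesis
    by (intro that[of "max 0 M"]) (auto simp: le_max_iff_disj)
qed

text \<open>Fubini on the triangle 0 < y < r < Y: integrating over r first gives the integrand
  \<open>\<Phi>\<close>, integrating over y first gives two applications of
  \<open>fractional_integral_hypergeo\<close>.\<close>

theorem iterated_fractional_integral:
  fixes a b c m l :: complex
  defines "m \<equiv> a - b" and "l \<equiv> c - 2 * a"
  assumes b: "Re b > 0" and m: "Re m > 0" and ca: "Re (c - a) > 0" and Y: "0 < Y" "Y < 1"
  defines "\<Phi> \<equiv> \<lambda>y. of_real y powr (b - 1) * hypergeo_reg a (c - b) c (of_real y) *
     (of_real Y powr (2 * m - 1 + l) * of_real (1 - y / Y) powr (2 * m - 1) *
      (Gamma m * Gamma m * hypergeo_reg (- l) m (2 * m) (of_real (1 - y / Y))))"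
  shows "set_integrable lborel {0<..<Y} \<Phi>"
    and "(LINT y:{0<..<Y}|lborel. \<Phi> y) = Gamma b * Gamma (c - a) * Gamma m * Gamma m / (Gamma a * Gamma (c - b)) *
      of_real Y powr (c - b - 1) * hypergeo_reg b (c - a) c (of_real Y)"
proof -
  have cb: "Re (c - b) > 0" and a: "Re a > 0"
    using b m ca by (auto simp: m_def)
  define F where "F = (\<lambda>y. hypergeo_reg a (c - b) c (complex_of_real y))"
  \<comment> \<open>Both functions are cut off to (0, Y), so that they are measurable on the whole
    line and the integrals over half lines in \<open>convolution_Fubini\<close> become integrals up
    to \<open>Y\<close>.\<close>
  define g where "g = (\<lambda>y. indicator {0<..<Y} y *\<^sub>R (F y * of_real y powr (b - 1)))"
  define h where "h = (\<lambda>r. indicator {0<..<Y} r *\<^sub>R (of_real r powr l * of_real (Y - r) powr (m - 1) :: complex))"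
  have "continuous_on {0<..<Y} F"
    unfolding F_def
    by (rule continuous_on_compose2[OF holomorphic_on_imp_continuous_on[OF hypergeo_reg_holomorphic]])
      (use Y in \<open>auto intro!: continuous_intros simp: cut_plane_iff\<close>)
  then have "(\<lambda>y. indicator {0<..<Y} y *\<^sub>R F y) \<in> borel_measurable borel"
    by (intro borel_measurable_continuous_on_indicator) auto
  then have "(\<lambda>y. (indicator {0<..<Y} y *\<^sub>R F y) * of_real y powr (b - 1)) \<in> borel_measurable borel"
    by measurable
  then have g_meas [measurable]: "g \<in> borel_measurable borel"
    by (simp add: g_def)
  have h_meas [measurable]: "h \<in> borel_measurable borel"
    unfolding h_def by measurable
  obtain M where M: "M \<ge> 0" "\<And>y. 0 \<le> y \<Longrightarrow> y \<le> Y \<Longrightarrow> norm (F y) \<le> M"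
    using hypergeo_reg_bounded[OF Y, of a "c - b" c] unfolding F_def by blast
  have g_le: "norm (g r) \<le> M * r powr (Re b - 1)" if "r > 0" for r
    using M that by (auto simp: g_def indicator_def norm_mult norm_powr_real_powr intro!: mult_right_mono)
  have ker: "set_integrable lborel {0<..<s} (\<lambda>r. r powr (Re b - 1) * (s - r) powr (Re m - 1))" if "s > 0" for s
  proof -
    have "set_integrable lborel {0<..<s} (\<lambda>r. norm (of_real r powr (b - 1) * of_real (s - r) powr (m - 1) :: complex))"
      by (rule set_integrable_norm[OF Beta_kernel_complex(1)[OF b m that]])
    also have "?this \<longleftrightarrow> ?thesis"
      by (rule set_integrable_cong) (auto simp: norm_mult norm_powr_real_powr simp del: of_real_diff)
    finally show ?thesis .
  qed
  have inner: "set_integrable lborel {0<..<s} (\<lambda>r. g r * of_real (s - r) powr (m - 1))" if "s > 0" for s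
    unfolding set_integrable_def
  proof (rule Bochner_Integration.integrable_bound)
    show "integrable lborel (\<lambda>r. M * (indicator {0<..<s} r *\<^sub>R (r powr (Re b - 1) * (s - r) powr (Re m - 1))))"
      using ker[OF that] unfolding set_integrable_def by (intro integrable_mult_right)
    show "AE r in lborel. norm (indicator {0<..<s} r *\<^sub>R (g r * of_real (s - r) powr (m - 1)))
        \<le> norm (M * (indicator {0<..<s} r *\<^sub>R (r powr (Re b - 1) * (s - r) powr (Re m - 1))))"
    proof (intro AE_I2)
      fix r
      show "norm (indicator {0<..<s} r *\<^sub>R (g r * of_real (s - r) powr (m - 1)))
        \<le> norm (M * (indicator {0<..<s} r *\<^sub>R (r powr (Re b - 1) * (s - r) powr (Re m - 1))))"
        using g_le[of r] M(1) mult_right_mono[OF g_le[of r], of "(s - r) powr (Re m - 1)"]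
        by (auto simp: indicator_def norm_mult norm_powr_real_powr abs_mult mult_ac simp del: of_real_diff)
    qed
  qed measurable
  define G where "G = (\<lambda>s. LINT r:{0<..<s}|lborel. norm (g r) * (s - r) powr (Re m - 1))"
  have G_meas: "G \<in> borel_measurable borel"
  proof -
    have "G = (\<lambda>s. LINT r|lborel. (if 0 < r \<and> r < s then norm (g r) * (s - r) powr (Re m - 1) else 0))"
      unfolding G_def set_lebesgue_integral_def
      by (intro ext Bochner_Integration.integral_cong) (auto simp: indicator_def)
    also have "\<dots> \<in> borel_measurable borel"
      by measurable
    finally show ?thesis .
  qed
  have G_le: "0 \<le> G s" "G s \<le> M * (s powr (Re b + Re m - 1) * Beta (Re b) (Re m))" if "s > 0" for s
  proof -
    show "0 \<le> G s"
      unfolding G_def set_lebesgue_integral_def by (intro integral_nonneg_AE AE_I2) auto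
    have "G s \<le> (LINT r:{0<..<s}|lborel. M * (r powr (Re b - 1) * (s - r) powr (Re m - 1)))"
      unfolding G_def
    proof (rule set_integral_mono)
      have "set_integrable lborel {0<..<s} (\<lambda>r. norm (g r * of_real (s - r) powr (m - 1)))"
        by (rule set_integrable_norm[OF inner[OF that]])
      also have "?this \<longleftrightarrow> set_integrable lborel {0<..<s} (\<lambda>r. norm (g r) * (s - r) powr (Re m - 1))"
        by (rule set_integrable_cong) (auto simp: norm_mult norm_powr_real_powr simp del: of_real_diff)
      finally show "set_integrable lborel {0<..<s} (\<lambda>r. norm (g r) * (s - r) powr (Re m - 1))" .
      show "set_integrable lborel {0<..<s} (\<lambda>r. M * (r powr (Re b - 1) * (s - r) powr (Re m - 1)))"
        using ker[OF that] by simp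
      show "norm (g r) * (s - r) powr (Re m - 1) \<le> M * (r powr (Re b - 1) * (s - r) powr (Re m - 1))"
        if "r \<in> {0<..<s}" for r
        using mult_right_mono[OF g_le[of r], of "(s - r) powr (Re m - 1)"] that by (simp add: mult_ac)
    qed
    also have "\<dots> = M * (s powr (Re b + Re m - 1) * Beta (Re b) (Re m))"
      using Beta_kernel_real_integral[of "Re b" "Re m" s] b m that by simp
    finally show "G s \<le> M * (s powr (Re b + Re m - 1) * Beta (Re b) (Re m))" .
  qed
  \<comment> \<open>Bounding the hypergeometric factor by \<open>M\<close> leaves pure powers: the
    inner integral is at most a constant times s^(Re a - 1), and the outer one is then dominated by
    the Beta kernel with parameters c - a and m.\<close>
  have outer: "set_integrable lborel {0<..} (\<lambda>s. norm (h s) * G s)"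
    unfolding set_integrable_def
  proof (rule Bochner_Integration.integrable_bound)
    let ?k = "\<lambda>s. of_real s powr (c - a - 1) * of_real (Y - s) powr (m - 1) :: complex"
    show "integrable lborel (\<lambda>s. (M * Beta (Re b) (Re m)) * (indicator {0<..<Y} s *\<^sub>R norm (?k s)))"
      using set_integrable_norm[OF Beta_kernel_complex(1)[OF ca m Y(1)]]
      unfolding set_integrable_def by (intro integrable_mult_right)
    show "(\<lambda>s. indicator {0<..} s *\<^sub>R (norm (h s) * G s)) \<in> borel_measurable lborel"
      using G_meas by measurable
    show "AE s in lborel. norm (indicator {0<..} s *\<^sub>R (norm (h s) * G s))
        \<le> norm ((M * Beta (Re b) (Re m)) * (indicator {0<..<Y} s *\<^sub>R norm (?k s)))"
    proof (intro AE_I2)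
      fix s
      show "norm (indicator {0<..} s *\<^sub>R (norm (h s) * G s))
        \<le> norm ((M * Beta (Re b) (Re m)) * (indicator {0<..<Y} s *\<^sub>R norm (?k s)))"
      proof (cases "0 < s \<and> s < Y")
        case True
        have "norm (h s) = s powr (Re l) * (Y - s) powr (Re m - 1)"
          using True by (simp add: h_def norm_mult norm_powr_real_powr del: of_real_diff)
        moreover have "norm (?k s) = s powr (Re (c - a) - 1) * (Y - s) powr (Re m - 1)"
          using True by (simp add: norm_mult norm_powr_real_powr del: of_real_diff)
        moreover have "s powr (Re (c - a) - 1) = s powr Re l * s powr (Re b + Re m - 1)"
          by (simp add: powr_add[symmetric] l_def m_def algebra_simps)
        ultimately have "norm (h s) * G s \<le> (M * Beta (Re b) (Re m)) * norm (?k s)"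
          using mult_left_mono[OF G_le(2)[of s], of "norm (h s)"] True by (simp add: mult_ac)
        also have "\<dots> \<le> norm ((M * Beta (Re b) (Re m)) * norm (?k s))"
          by simp
        finally show ?thesis
          using True G_le(1)[of s] by (simp add: abs_mult)
      qed (auto simp: h_def indicator_def)
    qed
  qed
  note fub = convolution_Fubini[OF g_meas h_meas inner outer[unfolded G_def]]
  have kernel: "indicator {0<..} y *\<^sub>R (g y * (LINT s:{y<..}|lborel. h s * of_real (s - y) powr (m - 1))) =
      indicator {0<..<Y} y *\<^sub>R \<Phi> y" for y
  proof (cases "0 < y \<and> y < Y")
    case True
    have "(LINT s:{y<..}|lborel. h s * of_real (s - y) powr (m - 1)) =
      (LINT r:{y<..<Y}|lborel. of_real r powr l * of_real (Y - r) powr (m - 1) * of_real (r - y) powr (m - 1))"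
      unfolding set_lebesgue_integral_def h_def
      using True by (intro Bochner_Integration.integral_cong) (auto simp: indicator_def)
    also have "\<dots> = of_real Y powr (2 * m - 1 + l) * of_real (1 - y / Y) powr (2 * m - 1) *
      (Gamma m * Gamma m * hypergeo_reg (- l) m (2 * m) (of_real (1 - y / Y)))"
      by (rule double_power_kernel) (use m True in auto)
    finally show ?thesis
      using True by (simp add: g_def F_def \<Phi>_def mult_ac)
  qed (auto simp: g_def indicator_def)
  show "set_integrable lborel {0<..<Y} \<Phi>"
    using fub(1) unfolding set_integrable_def kernel .
  have "(LINT y:{0<..<Y}|lborel. \<Phi> y) = (LINT s:{0<..}|lborel. h s * (LINT r:{0<..<s}|lborel. g r * of_real (s - r) powr (m - 1)))"
    using fub(2) unfolding set_lebesgue_integral_def[of lborel "{0<..}" "\<lambda>y. g y * _ y"] kernel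
    by (simp add: set_lebesgue_integral_def)
  also have "\<dots> = (LINT s:{0<..<Y}|lborel. (Gamma b * Gamma m / Gamma a) *
      (hypergeo_reg b (c - b) c (of_real s) * of_real s powr (c - a - 1) * of_real (Y - s) powr (m - 1)))"
    unfolding set_lebesgue_integral_def[of lborel "{0<..}"] set_lebesgue_integral_def[of lborel "{0<..<Y}"]
  proof (intro Bochner_Integration.integral_cong refl, goal_cases)
    case (1 s)
    show ?case
    proof (cases "0 < s \<and> s < Y")
      case True
      have "(LINT r:{0<..<s}|lborel. g r * of_real (s - r) powr (m - 1)) =
         (LINT r:{0<..<s}|lborel. hypergeo_reg (c - b) (b + m) c (of_real r) * of_real r powr (b - 1) * of_real (s - r) powr (m - 1))"
        using True by (intro set_lebesgue_integral_cong) (auto simp: g_def F_def m_def hypergeo_reg_commute[of a "c - b"])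
      also have "\<dots> = Gamma b * Gamma m / Gamma (b + m) * of_real s powr (b + m - 1) * hypergeo_reg (c - b) b c (of_real s)"
        by (rule fractional_integral_hypergeo) (use b m True Y in auto)
      finally have I: "(LINT r:{0<..<s}|lborel. g r * of_real (s - r) powr (m - 1)) =
         Gamma b * Gamma m / Gamma a * of_real s powr (a - 1) * hypergeo_reg b (c - b) c (of_real s)"
        by (simp add: m_def hypergeo_reg_commute[of b "c - b"])
      \<comment> \<open>The choice l = c - 2a is made for this identity: it supplies the weight with
        which the second fractional integral lowers c - b = (c - a) + m to c - a.\<close>
      have "of_real s powr l * of_real s powr (a - 1) = complex_of_real s powr (c - a - 1)"
        unfolding powr_add[symmetric] by (simp add: l_def algebra_simps)
      then show ?thesis
        using True unfolding I by (simp add: h_def)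
    qed (auto simp: h_def indicator_def)
  qed
  also have "\<dots> = (Gamma b * Gamma m / Gamma a) * (LINT s:{0<..<Y}|lborel.
      hypergeo_reg b (c - a + m) c (of_real s) * of_real s powr (c - a - 1) * of_real (Y - s) powr (m - 1))"
    by (simp add: m_def)
  also have "(LINT s:{0<..<Y}|lborel.
      hypergeo_reg b (c - a + m) c (of_real s) * of_real s powr (c - a - 1) * of_real (Y - s) powr (m - 1)) =
      Gamma (c - a) * Gamma m / Gamma (c - a + m) * of_real Y powr (c - a + m - 1) * hypergeo_reg b (c - a) c (of_real Y)"
    by (rule fractional_integral_hypergeo[OF ca m Y])
  finally show "(LINT y:{0<..<Y}|lborel. \<Phi> y) = Gamma b * Gamma (c - a) * Gamma m * Gamma m / (Gamma a * Gamma (c - b)) *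
      of_real Y powr (c - b - 1) * hypergeo_reg b (c - a) c (of_real Y)"
    by (simp add: m_def mult_ac)
qed

section \<open>The integral equation for Jacobi functions\<close>

text \<open>For p = exp(-\<theta>) the argument is cosh(\<theta>). The duplication formula absorbs
  the square root of pi and the power of 2 from the definition when
  \<open>hypergeo_reg_quadratic\<close> is applied.\<close>

lemma gegenbauer_C_quadratic:
  fixes m l p :: complex
  assumes m: "Re m > 0" and p: "Re p > 0"
  shows "gegenbauer_C m l ((p + 1 / p) / 2) =
    Gamma (2 * m + l) / Gamma (l + 1) * p powr (- l) * hypergeo_reg (- l) m (2 * m) (1 - p\<^sup>2)"
proof -
  have "p \<noteq> 0" using p by auto
  then have arg: "(1 - (p + 1 / p) / 2) / 2 = - ((1 - p)\<^sup>2) / (4 * p)"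
    by (simp add: field_simps power2_eq_square)
  have nz: "Gamma m \<noteq> 0" "Gamma (m + 1 / 2) \<noteq> 0"
    using m Gamma_nonzero_Re_pos[of m] Gamma_nonzero_Re_pos[of "m + 1 / 2"] by auto
  have "m \<notin> \<int>\<^sub>\<le>\<^sub>0" "m + 1 / 2 \<notin> \<int>\<^sub>\<le>\<^sub>0"
    using m not_nonpos_Ints_Re_pos[of m] not_nonpos_Ints_Re_pos[of "m + 1 / 2"] by auto
  then have "Gamma m * Gamma (m + 1 / 2) = exp ((1 - 2 * m) * of_real (ln 2)) * of_real (sqrt pi) * Gamma (2 * m)"
    by (rule Gamma_legendre_duplication)
  also have "exp ((1 - 2 * m) * of_real (ln 2)) = 2 powr (1 - 2 * m)"
    using of_real_powr_exp[of 2 "1 - 2 * m"] by simp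
  also have "(2::complex) powr (1 - 2 * m) = 1 / 2 powr (2 * m - 1)"
    using powr_minus_divide[of "2 :: complex" "2 * m - 1"] by simp
  finally have dup: "of_real (sqrt pi) * Gamma (2 * m) = 2 powr (2 * m - 1) * (Gamma m * Gamma (m + 1 / 2))"
    by (simp add: field_simps)
  have "Gamma (m + 1 / 2) * (of_real (sqrt pi) * hypergeo_reg (- l) (2 * m + l) (m + 1 / 2) ((1 - (p + 1 / p) / 2) / 2)) =
     of_real (sqrt pi) * Gamma (2 * m) * (p powr (- l) * hypergeo_reg (- l) m (2 * m) (1 - p\<^sup>2))"
    unfolding arg using hypergeo_reg_quadratic[OF m p, of l] by (simp add: mult_ac)
  also have "\<dots> = Gamma (m + 1 / 2) * (2 powr (2 * m - 1) * Gamma m * (p powr (- l) * hypergeo_reg (- l) m (2 * m) (1 - p\<^sup>2)))"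
    unfolding dup by (simp add: mult_ac)
  finally have eq: "of_real (sqrt pi) * hypergeo_reg (- l) (2 * m + l) (m + 1 / 2) ((1 - (p + 1 / p) / 2) / 2) =
      2 powr (2 * m - 1) * Gamma m * (p powr (- l) * hypergeo_reg (- l) m (2 * m) (1 - p\<^sup>2))"
    using nz by simp
  have "gegenbauer_C m l ((p + 1 / p) / 2) =
      of_real (sqrt pi) * hypergeo_reg (- l) (2 * m + l) (m + 1 / 2) ((1 - (p + 1 / p) / 2) / 2) *
      (Gamma (2 * m + l) / (2 powr (2 * m - 1) * Gamma m * Gamma (l + 1)))"
    unfolding gegenbauer_C_def by (simp only: times_divide_eq_left times_divide_eq_right mult_ac)
  then show ?thesis
    unfolding eq using nz by simp
qed

lemma u_arg_eq:
  assumes w: "1 < w" and x: "1 < x"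
  defines "p \<equiv> sqrt ((1 - 1 / w\<^sup>2) / (1 - 1 / x\<^sup>2))"
  shows "u_arg x w = (p + 1 / p) / 2"
proof -
  define \<rho> \<sigma> where "\<rho> = sqrt (w\<^sup>2 - 1)" and "\<sigma> = sqrt (x\<^sup>2 - 1)"
  have pos: "w\<^sup>2 > 1" "x\<^sup>2 > 1"
    using w x by (simp_all add: one_less_power)
  then have rs: "\<rho> > 0" "\<sigma> > 0" "\<rho>\<^sup>2 = w\<^sup>2 - 1" "\<sigma>\<^sup>2 = x\<^sup>2 - 1"
    by (auto simp: \<rho>_def \<sigma>_def)
  have "(1 - 1 / w\<^sup>2) / (1 - 1 / x\<^sup>2) = ((w\<^sup>2 - 1) / w\<^sup>2) / ((x\<^sup>2 - 1) / x\<^sup>2)"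
    using w x by (simp add: diff_divide_distrib)
  also have "\<dots> = (\<rho> * x / (\<sigma> * w))\<^sup>2"
    using w x rs by (simp add: power_divide power_mult_distrib)
  finally have p: "p = \<rho> * x / (\<sigma> * w)"
    unfolding p_def using w x rs by simp
  have "(p + 1 / p) / 2 = (\<rho>\<^sup>2 * x\<^sup>2 + \<sigma>\<^sup>2 * w\<^sup>2) / (2 * x * w * (\<sigma> * \<rho>))"
    unfolding p using w x rs(1,2) by (simp add: field_simps power2_eq_square)
  also have "\<rho>\<^sup>2 * x\<^sup>2 + \<sigma>\<^sup>2 * w\<^sup>2 = 2 * x\<^sup>2 * w\<^sup>2 - x\<^sup>2 - w\<^sup>2"
    unfolding rs by (simp add: algebra_simps)
  also have "\<sigma> * \<rho> = sqrt ((x\<^sup>2 - 1) * (w\<^sup>2 - 1))"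
    by (simp add: \<rho>_def \<sigma>_def real_sqrt_mult)
  finally show ?thesis
    by (simp only: u_arg_def)
qed

lemma ln_one_minus_inverse_square:
  assumes "(1::real) < w"
  shows "1 - 1 / w\<^sup>2 > 0" "ln (1 - 1 / w\<^sup>2) = ln (w\<^sup>2 - 1) - 2 * ln w"
proof -
  have *: "w\<^sup>2 > 1" using assms by (simp add: one_less_power)
  then have ne: "w\<^sup>2 - 1 > 0" "w\<^sup>2 > 0" by auto
  have eq: "1 - 1 / w\<^sup>2 = (w\<^sup>2 - 1) / w\<^sup>2"
    using assms by (simp add: diff_divide_distrib)
  show "1 - 1 / w\<^sup>2 > 0"
    unfolding eq using ne by (intro divide_pos_pos)
  have "ln ((w\<^sup>2 - 1) / w\<^sup>2) = ln (w\<^sup>2 - 1) - ln (w\<^sup>2)"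
    by (rule ln_divide_pos) (use ne in linarith)+
  then show "ln (1 - 1 / w\<^sup>2) = ln (w\<^sup>2 - 1) - 2 * ln w"
    unfolding eq using assms by (simp add: ln_realpow)
qed

lemma jacobi_P_eq:
  "jacobi_P \<alpha> \<beta> \<gamma> (2 * x\<^sup>2 - 1) = Gamma (\<alpha> + \<gamma> + 1) / Gamma (\<gamma> + 1) *
     hypergeo_reg (- \<gamma>) (\<alpha> + \<beta> + \<gamma> + 1) (\<alpha> + 1) (1 - x\<^sup>2)"
proof -
  have eq: "(1 - (2 * x\<^sup>2 - 1)) / 2 = 1 - x\<^sup>2" by simp
  show ?thesis unfolding jacobi_P_def eq ..
qed

section \<open>Reduction of the Jacobi integral to the iterated fractional integral\<close>

context
  fixes \<alpha> \<beta> \<gamma> a b c m l :: complex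
  assumes Re1: "Re (\<alpha> + \<gamma>) > 0"
    and Re2: "Re (\<alpha> + \<beta> + \<gamma>) > 0"
    and Re3: "Re (- \<alpha> - \<beta> - 2 * \<gamma> - 1) > 0"
  defines "a \<equiv> - \<gamma>" and "b \<equiv> \<alpha> + \<beta> + \<gamma> + 1" and "c \<equiv> \<alpha> + 1" and "m \<equiv> a - b" and "l \<equiv> c - 2 * a"
begin

text \<open>The bound on Re a follows from a = b + m, since the assumptions give Re b > 1 and Re m >
  0.\<close>

lemma param_Re: "Re a > 1" "Re (c - a) > 1" "Re b > 0" "Re m > 0"
  using Re1 Re2 Re3 by (auto simp: a_def b_def c_def m_def)

text \<open>The integrand \<open>\<Phi>\<close> of \<open>iterated_fractional_integral\<close>, with
  its upper limit as an argument.\<close>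

definition kernel_fun :: "real \<Rightarrow> real \<Rightarrow> complex" where
  "kernel_fun Y y = of_real y powr (b - 1) * hypergeo_reg a (c - b) c (of_real y) *
     (of_real Y powr (2 * m - 1 + l) * of_real (1 - y / Y) powr (2 * m - 1) *
      (Gamma m * Gamma m * hypergeo_reg (- l) m (2 * m) (of_real (1 - y / Y))))"

text \<open>The factor 2 / w^3 is the derivative of 1 - 1 / w^2 and is set apart for the change of
  variables. The power of u^2 - 1 yields 2^(1-2m), of which this derivative takes one factor
  2.\<close>

lemma jacobi_integrand_eq:
  assumes w: "1 < w" "w < x"
  shows "jacobi_integrand \<alpha> \<beta> \<gamma> x w =
    Gamma (\<alpha> + \<gamma> + 1) / Gamma (\<gamma> + 1) * (Gamma (2 * m + l) / (Gamma (l + 1) * (Gamma m * Gamma m))) *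
    exp ((2 * m - 1 + l) * (of_real (ln x) - of_real (ln (x\<^sup>2 - 1)) / 2) - 2 * m * of_real (ln 2)) *
    ((2 / w ^ 3) *\<^sub>R kernel_fun (1 - 1 / x\<^sup>2) (1 - 1 / w\<^sup>2))"
proof -
  define y Y where "y = 1 - 1 / w\<^sup>2" and "Y = 1 - 1 / x\<^sup>2"
  define p where "p = sqrt (y / Y)"
  define Lx Lw s t v where "Lx = complex_of_real (ln x)" and "Lw = complex_of_real (ln w)"
    and "s = complex_of_real (ln (x\<^sup>2 - 1))" and "t = complex_of_real (ln (w\<^sup>2 - 1))"
    and "v = complex_of_real (ln (1 - p\<^sup>2))"
  have x: "1 < x" using w by simp
  have sq: "w\<^sup>2 > 1" "x\<^sup>2 > 1" "w\<^sup>2 < x\<^sup>2"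
    using w x by (simp_all add: one_less_power power_strict_mono)
  have y: "y > 0" "complex_of_real (ln y) = t - 2 * Lw"
    using ln_one_minus_inverse_square[OF w(1)] by (simp_all add: y_def t_def Lw_def)
  have Y: "Y > 0" "complex_of_real (ln Y) = s - 2 * Lx"
    using ln_one_minus_inverse_square[OF x] by (simp_all add: Y_def s_def Lx_def)
  have "y < Y"
    using sq w by (auto simp: y_def Y_def intro!: divide_strict_left_mono)
  have p: "p > 0" "p\<^sup>2 = y / Y" "p\<^sup>2 < 1"
    using y(1) Y(1) \<open>y < Y\<close> by (auto simp: p_def)
  have lnp: "complex_of_real (ln p) = (t - s) / 2 - Lw + Lx"
  proof -
    have "ln p = (ln y - ln Y) / 2"
      using y(1) Y(1) by (simp add: p_def ln_sqrt ln_div)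
    from arg_cong[OF this, of complex_of_real]
    have "complex_of_real (ln p) = (complex_of_real (ln y) - complex_of_real (ln Y)) / 2"
      by (simp only: of_real_divide of_real_diff of_real_numeral)
    then show ?thesis
      unfolding y(2) Y(2) by (simp add: field_simps)
  qed
  have u: "u_arg x w = (p + 1 / p) / 2"
    using u_arg_eq[OF w(1) x] by (simp add: p_def y_def Y_def)
  have q: "1 - p\<^sup>2 > 0"
    using p(3) by simp
  \<comment> \<open>With p = exp(-\<theta>) this says u^2 - 1 = sinh(\<theta>)^2; hence the exponent
    m - 1/2 becomes 2m - 1, the exponent of 1 - p^2 in the kernel.\<close>
  have usq: "(u_arg x w)\<^sup>2 - 1 = ((1 - p\<^sup>2) / (2 * p))\<^sup>2"
    unfolding u using p(1) by (simp add: power2_eq_square field_simps)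
  have u2: "(u_arg x w)\<^sup>2 - 1 > 0"
    unfolding usq using p(1) q by (intro zero_less_power divide_pos_pos) auto
  have "ln ((u_arg x w)\<^sup>2 - 1) = 2 * ln ((1 - p\<^sup>2) / (2 * p))"
    unfolding usq using p(1) q by (subst ln_realpow) auto
  also have "ln ((1 - p\<^sup>2) / (2 * p)) = ln (1 - p\<^sup>2) - ln (2 * p)"
    by (rule ln_divide_pos) (use p(1) q in linarith)+
  also have "ln (2 * p) = ln 2 + ln p"
    using p(1) by (simp add: ln_mult)
  finally have "ln ((u_arg x w)\<^sup>2 - 1) = 2 * (ln (1 - p\<^sup>2) - (ln 2 + ln p))" .
  from arg_cong[OF this, of complex_of_real]
  have lnu: "complex_of_real (ln ((u_arg x w)\<^sup>2 - 1)) = 2 * v - 2 * of_real (ln 2) - 2 * complex_of_real (ln p)"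
    unfolding v_def by (simp only: of_real_mult of_real_diff of_real_add of_real_numeral) (simp add: algebra_simps)
  have F1: "jacobi_integrand \<alpha> \<beta> \<gamma> x w = Gamma (\<alpha> + \<gamma> + 1) / Gamma (\<gamma> + 1) *
      (exp (- 2 * a * Lw) * hypergeo_reg a (c - b) c (of_real y)) *
      (exp ((\<alpha> - 2) / 2 * t) / exp (l * Lw)) *
      exp ((m - 1 / 2) * (2 * v - 2 * of_real (ln 2) - 2 * complex_of_real (ln p))) *
      (Gamma (2 * m + l) / Gamma (l + 1) * exp (- l * complex_of_real (ln p)) *
         hypergeo_reg (- l) m (2 * m) (of_real (1 - y / Y)))"
  proof -
    have "jacobi_P \<alpha> \<beta> \<gamma> (of_real (2 * w\<^sup>2 - 1)) = Gamma (\<alpha> + \<gamma> + 1) / Gamma (\<gamma> + 1) *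
        hypergeo_reg a b c (1 - of_real (w\<^sup>2))"
      using jacobi_P_eq[of \<alpha> \<beta> \<gamma> "of_real w"] by (simp add: a_def b_def c_def)
    also have "hypergeo_reg a b c (1 - of_real (w\<^sup>2)) = exp (- 2 * a * Lw) * hypergeo_reg a (c - b) c (of_real y)"
      using hypergeo_reg_Pfaff_1[OF param_Re(1,2), of w b] w by (simp add: of_real_powr_exp Lw_def y_def)
    finally have 1: "jacobi_P \<alpha> \<beta> \<gamma> (of_real (2 * w\<^sup>2 - 1)) = Gamma (\<alpha> + \<gamma> + 1) / Gamma (\<gamma> + 1) *
        (exp (- 2 * a * Lw) * hypergeo_reg a (c - b) c (of_real y))" .
    have 2: "gegenbauer_C (- (\<alpha> + \<beta> + 2 * \<gamma> + 1)) (\<alpha> + 2 * \<gamma> + 1) (of_real (u_arg x w)) =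
        Gamma (2 * m + l) / Gamma (l + 1) * exp (- l * complex_of_real (ln p)) *
         hypergeo_reg (- l) m (2 * m) (of_real (1 - y / Y))"
    proof -
      have ml: "- (\<alpha> + \<beta> + 2 * \<gamma> + 1) = m" "\<alpha> + 2 * \<gamma> + 1 = l"
        by (simp_all add: m_def l_def a_def b_def c_def)
      have pu: "complex_of_real (u_arg x w) = (of_real p + 1 / of_real p) / 2"
        by (simp add: u)
      have pq: "1 - (complex_of_real p)\<^sup>2 = of_real (1 - y / Y)"
        unfolding p(2)[symmetric] by simp
      have pp: "complex_of_real p powr (- l) = exp (- l * complex_of_real (ln p))"
        by (rule of_real_powr_exp[OF p(1)])
      show ?thesis
        unfolding ml pu pq[symmetric] pp[symmetric]
        by (rule gegenbauer_C_quadratic) (use param_Re(4) p(1) in auto)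
    qed
    have 3: "- \<alpha> - \<beta> - 2 * \<gamma> - 3 / 2 = m - 1 / 2" "\<alpha> + 2 * \<gamma> + 1 = l"
      by (simp_all add: m_def l_def a_def b_def c_def)
    have 4: "of_real (w\<^sup>2 - 1) powr ((\<alpha> - 2) / 2) = exp ((\<alpha> - 2) / 2 * t)"
      "of_real w powr l = exp (l * Lw)"
      "of_real ((u_arg x w)\<^sup>2 - 1) powr (m - 1 / 2) = exp ((m - 1 / 2) * (2 * v - 2 * of_real (ln 2) - 2 * complex_of_real (ln p)))"
      unfolding lnu[symmetric] t_def Lw_def
      by (rule of_real_powr_exp; use sq w u2 in simp)+
    show ?thesis
      unfolding jacobi_integrand_def 1 2 unfolding 3 4 by simp
  qed
  have F2: "(2 / w ^ 3) *\<^sub>R kernel_fun Y y = exp (of_real (ln 2) - 3 * Lw) * (exp ((b - 1) * (t - 2 * Lw)) * hypergeo_reg a (c - b) c (of_real y) *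
     (exp ((2 * m - 1 + l) * (s - 2 * Lx)) * exp ((2 * m - 1) * v) *
      (Gamma m * Gamma m * hypergeo_reg (- l) m (2 * m) (of_real (1 - y / Y)))))"
  proof -
    have "2 / w ^ 3 = exp (ln 2 - 3 * ln w)"
    proof -
      have "ln (2 / w ^ 3) = ln 2 - 3 * ln w"
        using w by (simp add: ln_div ln_realpow)
      then show ?thesis
        using w by (metis divide_pos_pos exp_ln less_trans zero_less_numeral zero_less_one zero_less_power)
    qed
    then have 1: "complex_of_real (2 / w ^ 3) = exp (of_real (ln 2) - 3 * Lw)"
      by (simp add: Lw_def flip: exp_of_real)
    have pos: "1 - y / Y > 0"
      using p by simp
    have 2: "of_real y powr (b - 1) = exp ((b - 1) * (t - 2 * Lw))"
      "of_real Y powr (2 * m - 1 + l) = exp ((2 * m - 1 + l) * (s - 2 * Lx))"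
      "of_real (1 - y / Y) powr (2 * m - 1) = exp ((2 * m - 1) * v)"
      using of_real_powr_exp[OF y(1), of "b - 1"] of_real_powr_exp[OF Y(1), of "2 * m - 1 + l"] of_real_powr_exp[OF pos, of "2 * m - 1"]
      unfolding y(2) Y(2) v_def p(2) by auto
    show ?thesis
      unfolding scaleR_conv_of_real 1 kernel_fun_def 2 ..
  qed
  have nz: "Gamma m \<noteq> 0"
    using Gamma_nonzero_Re_pos param_Re by blast
  \<comment> \<open>With all bases positive, the matching of powers is a linear identity in the
    logarithms of w, x, w^2 - 1, x^2 - 1, 1 - p^2 and 2.\<close>
  have e: "exp (- 2 * a * Lw) * (exp ((\<alpha> - 2) / 2 * t) / exp (l * Lw)) *
      exp ((m - 1 / 2) * (2 * v - 2 * of_real (ln 2) - 2 * complex_of_real (ln p))) * exp (- l * complex_of_real (ln p)) =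
      exp ((2 * m - 1 + l) * (Lx - s / 2) - 2 * m * of_real (ln 2)) * (exp (of_real (ln 2) - 3 * Lw) *
      (exp ((b - 1) * (t - 2 * Lw)) * (exp ((2 * m - 1 + l) * (s - 2 * Lx)) * exp ((2 * m - 1) * v))))"
    unfolding exp_add[symmetric] exp_diff[symmetric] lnp
    by (rule arg_cong[of _ _ exp]) (simp add: m_def l_def a_def b_def c_def field_simps)
  have "jacobi_integrand \<alpha> \<beta> \<gamma> x w = Gamma (\<alpha> + \<gamma> + 1) / Gamma (\<gamma> + 1) * (Gamma (2 * m + l) / Gamma (l + 1)) *
      (exp (- 2 * a * Lw) * (exp ((\<alpha> - 2) / 2 * t) / exp (l * Lw)) *
      exp ((m - 1 / 2) * (2 * v - 2 * of_real (ln 2) - 2 * complex_of_real (ln p))) * exp (- l * complex_of_real (ln p))) *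
      (hypergeo_reg a (c - b) c (of_real y) * hypergeo_reg (- l) m (2 * m) (of_real (1 - y / Y)))"
    unfolding F1 divide_inverse by (simp only: mult_ac)
  also have "\<dots> = Gamma (\<alpha> + \<gamma> + 1) / Gamma (\<gamma> + 1) * (Gamma (2 * m + l) / (Gamma (l + 1) * (Gamma m * Gamma m))) *
      exp ((2 * m - 1 + l) * (Lx - s / 2) - 2 * m * of_real (ln 2)) * ((2 / w ^ 3) *\<^sub>R kernel_fun Y y)"
    unfolding e F2 using nz by (simp add: mult_ac)
  finally show ?thesis
    unfolding Y_def y_def Lx_def s_def .
qed

text \<open>Substitute y = 1 - 1 / w^2. The two factors \<open>Gamma m\<close> from the fractional
  integrals cancel against those of the kernel, which leaves the constant in the form that precedes
  the reflection formulas.\<close>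

lemma jacobi_integrand_integral:
  assumes x: "1 < x"
  shows "jacobi_integrand \<alpha> \<beta> \<gamma> x absolutely_integrable_on {1..x}"
    and "integral {1..x} (jacobi_integrand \<alpha> \<beta> \<gamma> x) =
      Gamma (2 * m + l) * Gamma b * Gamma (c - a) / (Gamma (l + 1) * (Gamma a * Gamma (c - b))) *
      2 powr (- 2 * m) * (of_real x powr (\<alpha> + 2 * \<beta> + 2 * \<gamma> + 2) * of_real (x\<^sup>2 - 1) powr (\<alpha> / 2)) *
      jacobi_P \<alpha> \<beta> \<gamma> (2 * (of_real x)\<^sup>2 - 1)"
proof -
  define Y where "Y = 1 - 1 / x\<^sup>2"
  define g where "g = (\<lambda>w::real. 1 - 1 / w\<^sup>2)"
  define I where "I = Gamma b * Gamma (c - a) * Gamma m * Gamma m / (Gamma a * Gamma (c - b)) *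
      of_real Y powr (c - b - 1) * hypergeo_reg b (c - a) c (of_real Y)"
  define K where "K = Gamma (\<alpha> + \<gamma> + 1) / Gamma (\<gamma> + 1) * (Gamma (2 * m + l) / (Gamma (l + 1) * (Gamma m * Gamma m))) *
    exp ((2 * m - 1 + l) * (of_real (ln x) - of_real (ln (x\<^sup>2 - 1)) / 2) - 2 * m * of_real (ln 2))"
  have sq: "x\<^sup>2 > 1" using x by (simp add: one_less_power)
  have Y: "0 < Y" "Y < 1"
    using ln_one_minus_inverse_square(1)[OF x] x by (auto simp: Y_def)
  have ker: "set_integrable lborel {0<..<Y} (kernel_fun Y)" "(LINT y:{0<..<Y}|lborel. kernel_fun Y y) = I"
    using iterated_fractional_integral[OF param_Re(3) param_Re(4)[unfolded m_def] _ Y] param_Re(2)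
    unfolding kernel_fun_def m_def l_def I_def by auto
  have abs: "kernel_fun Y absolutely_integrable_on {0<..<Y}"
    using ker(1) unfolding set_integrable_def
    by (subst integrable_completion) (auto dest: borel_measurable_integrable)
  have int: "integral {0<..<Y} (kernel_fun Y) = I"
    using set_borel_integral_eq_integral(2)[OF ker(1)] ker(2) by simp
  have image: "g ` {1<..<x} = {0<..<Y}"
  proof (intro equalityI subsetI)
    fix y assume "y \<in> g ` {1<..<x}"
    then obtain w where w: "1 < w" "w < x" "y = g w" by auto
    have "w\<^sup>2 < x\<^sup>2" using w by (intro power_strict_mono) auto
    then show "y \<in> {0<..<Y}"
      using w ln_one_minus_inverse_square(1)[OF w(1)] by (auto simp: g_def Y_def intro!: divide_strict_left_mono)
  next
    fix y assume y: "y \<in> {0<..<Y}"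
    define w where "w = sqrt (1 / (1 - y))"
    have y': "0 < y" "y < 1" using y Y by auto
    then have w2: "w\<^sup>2 = 1 / (1 - y)" by (simp add: w_def)
    have "1 < w\<^sup>2" unfolding w2 using y' by simp
    moreover have "w\<^sup>2 < x\<^sup>2"
      unfolding w2 using y y' x by (simp add: Y_def field_simps)
    moreover have "w \<ge> 0" using y' by (simp add: w_def)
    ultimately have "1 < w" "w < x"
      using x power2_less_imp_less[of 1 w] power2_less_imp_less[of w x] by auto
    moreover have "g w = y" unfolding g_def w2 using y' by simp
    ultimately show "y \<in> g ` {1<..<x}" by auto
  qed
  have inj: "inj_on g {1<..<x}"
    by (rule inj_onI) (auto simp: g_def power2_eq_iff)
  have der: "(g has_field_derivative 2 / w ^ 3) (at w within {1<..<x})" if "w \<in> {1<..<x}" for w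
    unfolding g_def using that by (auto intro!: derivative_eq_intros simp: power2_eq_square power3_eq_cube)
  have cov: "(\<lambda>w. \<bar>2 / w ^ 3\<bar> *\<^sub>R kernel_fun Y (g w)) absolutely_integrable_on {1<..<x} \<and>
     integral {1<..<x} (\<lambda>w. \<bar>2 / w ^ 3\<bar> *\<^sub>R kernel_fun Y (g w)) = I"
    by (subst has_absolute_integral_change_of_variables_real[OF _ der inj]) (use abs int image in auto)
  have eq: "jacobi_integrand \<alpha> \<beta> \<gamma> x w = K * (\<bar>2 / w ^ 3\<bar> *\<^sub>R kernel_fun Y (g w))" if "w \<in> {1<..<x}" for w
    using jacobi_integrand_eq[of w x] that by (simp add: K_def Y_def g_def)
  have "(\<lambda>w. K * (\<bar>2 / w ^ 3\<bar> *\<^sub>R kernel_fun Y (g w))) absolutely_integrable_on {1<..<x}"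
    using cov by (intro set_integrable_mult_right) auto
  also have "?this \<longleftrightarrow> jacobi_integrand \<alpha> \<beta> \<gamma> x absolutely_integrable_on {1<..<x}"
    by (intro set_integrable_cong) (use eq in auto)
  \<comment> \<open>The values at the endpoints, where the intended powers may be singular, do not
    matter: two points are negligible.\<close>
  also have "\<dots> \<longleftrightarrow> jacobi_integrand \<alpha> \<beta> \<gamma> x absolutely_integrable_on {1..x}"
    by (rule absolutely_integrable_spike_set_eq) (rule negligible_subset[of "{1, x}"]; auto)+
  finally show "jacobi_integrand \<alpha> \<beta> \<gamma> x absolutely_integrable_on {1..x}" .
  have "integral {1..x} (jacobi_integrand \<alpha> \<beta> \<gamma> x) = integral {1<..<x} (jacobi_integrand \<alpha> \<beta> \<gamma> x)"
    by (simp add: integral_open_interval_real)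
  also have "\<dots> = integral {1<..<x} (\<lambda>w. K * (\<bar>2 / w ^ 3\<bar> *\<^sub>R kernel_fun Y (g w)))"
    by (rule integral_cong) (rule eq)
  also have "\<dots> = K * I"
    using cov by (simp only: integral_mult_right)
  also have "\<dots> = Gamma (\<alpha> + \<gamma> + 1) / Gamma (\<gamma> + 1) * (Gamma (2 * m + l) * Gamma b * Gamma (c - a) / (Gamma (l + 1) * (Gamma a * Gamma (c - b)))) *
      (exp ((2 * m - 1 + l) * (of_real (ln x) - of_real (ln (x\<^sup>2 - 1)) / 2) - 2 * m * of_real (ln 2)) * of_real Y powr (c - b - 1)) *
       hypergeo_reg b (c - a) c (of_real Y)"
    unfolding K_def I_def using Gamma_nonzero_Re_pos[OF param_Re(4)] by (simp add: field_simps)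
  \<comment> \<open>The power x^(-2b) is split off for the second Pfaff transformation, which turns
    the function of \<open>Y\<close> back into one of 1 - x^2.\<close>
  also have "exp ((2 * m - 1 + l) * (of_real (ln x) - of_real (ln (x\<^sup>2 - 1)) / 2) - 2 * m * of_real (ln 2)) * of_real Y powr (c - b - 1) =
      2 powr (- 2 * m) * (of_real x powr (\<alpha> + 2 * \<beta> + 2 * \<gamma> + 2) * of_real (x\<^sup>2 - 1) powr (\<alpha> / 2)) * of_real x powr (- 2 * b)"
  proof -
    define Lx s where "Lx = complex_of_real (ln x)" and "s = complex_of_real (ln (x\<^sup>2 - 1))"
    have lnY: "complex_of_real (ln Y) = s - 2 * Lx"
      using ln_one_minus_inverse_square(2)[OF x] by (simp add: Y_def s_def Lx_def)
    have 1: "of_real Y powr (c - b - 1) = exp ((c - b - 1) * (s - 2 * Lx))"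
      "of_real x powr (\<alpha> + 2 * \<beta> + 2 * \<gamma> + 2) = exp ((\<alpha> + 2 * \<beta> + 2 * \<gamma> + 2) * Lx)"
      "of_real x powr (- 2 * b) = exp (- 2 * b * Lx)"
      "of_real (x\<^sup>2 - 1) powr (\<alpha> / 2) = exp (\<alpha> / 2 * s)"
      unfolding lnY[symmetric] unfolding Lx_def s_def by (rule of_real_powr_exp; use x sq Y in simp)+
    have 2: "(2 :: complex) powr (- 2 * m) = exp (- 2 * m * of_real (ln 2))"
      using of_real_powr_exp[of 2 "- 2 * m"] by simp
    show ?thesis
      unfolding 1 2 Lx_def[symmetric] s_def[symmetric] exp_add[symmetric]
      by (rule arg_cong[of _ _ exp]) (simp add: m_def l_def a_def b_def c_def field_simps)
  qed
  finally have "integral {1..x} (jacobi_integrand \<alpha> \<beta> \<gamma> x) =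
     Gamma (2 * m + l) * Gamma b * Gamma (c - a) / (Gamma (l + 1) * (Gamma a * Gamma (c - b))) *
      2 powr (- 2 * m) * (of_real x powr (\<alpha> + 2 * \<beta> + 2 * \<gamma> + 2) * of_real (x\<^sup>2 - 1) powr (\<alpha> / 2)) *
      (Gamma (\<alpha> + \<gamma> + 1) / Gamma (\<gamma> + 1) * (of_real x powr (- 2 * b) * hypergeo_reg b (c - a) c (of_real Y)))"
    by (simp only: mult_ac times_divide_eq_left times_divide_eq_right)
  also have "of_real x powr (- 2 * b) * hypergeo_reg b (c - a) c (of_real Y) = hypergeo_reg a b c (1 - of_real (x\<^sup>2))"
    using hypergeo_reg_Pfaff_2[OF param_Re(1,2), of x b] x by (simp add: Y_def)
  also have "Gamma (\<alpha> + \<gamma> + 1) / Gamma (\<gamma> + 1) * hypergeo_reg a b c (1 - of_real (x\<^sup>2)) =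
      jacobi_P \<alpha> \<beta> \<gamma> (2 * (of_real x)\<^sup>2 - 1)"
    unfolding jacobi_P_eq by (simp add: a_def b_def c_def)
  finally show "integral {1..x} (jacobi_integrand \<alpha> \<beta> \<gamma> x) =
     Gamma (2 * m + l) * Gamma b * Gamma (c - a) / (Gamma (l + 1) * (Gamma a * Gamma (c - b))) *
      2 powr (- 2 * m) * (of_real x powr (\<alpha> + 2 * \<beta> + 2 * \<gamma> + 2) * of_real (x\<^sup>2 - 1) powr (\<alpha> / 2)) *
      jacobi_P \<alpha> \<beta> \<gamma> (2 * (of_real x)\<^sup>2 - 1)" .
qed

text \<open>On the imaginary axis 1 - x^2 lies on the cut, so the formula with
  \<open>jacobi_P\<close> is taken only for Re x > 0 and the rest of the domain is reached by
  \<open>hypergeo_reg_continuation_slit\<close>.\<close>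

lemma jacobi_P_continuation:
  "\<exists>L. L holomorphic_on (- complex_of_real ` {..1}) \<and>
     (\<forall>x. Re x > 0 \<longrightarrow> L x = jacobi_P \<alpha> \<beta> \<gamma> (2 * x\<^sup>2 - 1))"
proof -
  obtain L where L: "L holomorphic_on (- \<real>\<^sub>\<le>\<^sub>0)" "\<And>x. Re x > 0 \<Longrightarrow> L x = hypergeo_reg a b c (1 - x\<^sup>2)"
    using hypergeo_reg_continuation_slit[OF param_Re(1,2), of b] by blast
  have "- complex_of_real ` {..1} \<subseteq> - \<real>\<^sub>\<le>\<^sub>0"
    by (auto elim!: nonpos_Reals_cases)
  then have "(\<lambda>x. Gamma (\<alpha> + \<gamma> + 1) / Gamma (\<gamma> + 1) * L x) holomorphic_on (- complex_of_real ` {..1})"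
    by (intro holomorphic_intros holomorphic_on_subset[OF L(1)])
  moreover have "Gamma (\<alpha> + \<gamma> + 1) / Gamma (\<gamma> + 1) * L x = jacobi_P \<alpha> \<beta> \<gamma> (2 * x\<^sup>2 - 1)" if "Re x > 0" for x
    unfolding jacobi_P_eq L(2)[OF that] by (simp add: a_def b_def c_def)
  ultimately show ?thesis by blast
qed

end

text \<open>Three reflections pair Gamma(-\<gamma>) with Gamma(\<gamma>+1), Gamma(-\<beta>-\<gamma>)
  with Gamma(\<beta>+\<gamma>+1), and Gamma(2m+l) with Gamma(\<alpha>+2\<beta>+2\<gamma>+2). The
  sines they produce are those of the stated constant, and everything cancels.\<close>

lemma reflection_constant:
  fixes \<alpha> \<beta> \<gamma> :: complex
  assumes pole1: "\<alpha> + 2 * \<gamma> + 2 \<notin> \<int>\<^sub>\<le>\<^sub>0" and pole2: "\<alpha> + 2 * \<beta> + 2 * \<gamma> + 2 \<notin> \<int>\<^sub>\<le>\<^sub>0"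
    and pole3: "- (\<alpha> + 2 * \<beta> + 2 * \<gamma>) - 1 \<notin> \<int>\<^sub>\<le>\<^sub>0"
    and sin: "sin (of_real pi * \<gamma>) * sin (of_real pi * (\<beta> + \<gamma>)) \<noteq> 0"
    and Ga: "Gamma (\<alpha> + \<gamma> + 1) \<noteq> 0" and Gb: "Gamma (\<alpha> + \<beta> + \<gamma> + 1) \<noteq> 0"
  shows "of_real pi * sin (of_real pi * (\<alpha> + 2 * \<beta> + 2 * \<gamma>)) *
      Gamma (\<alpha> + 2 * \<gamma> + 2) * Gamma (\<alpha> + 2 * \<beta> + 2 * \<gamma> + 2) /
    (sin (of_real pi * \<gamma>) * sin (of_real pi * (\<beta> + \<gamma>)) *
      Gamma (\<gamma> + 1) * Gamma (\<alpha> + \<gamma> + 1) * Gamma (\<beta> + \<gamma> + 1) * Gamma (\<alpha> + \<beta> + \<gamma> + 1)) *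
    (Gamma (- (\<alpha> + 2 * \<beta> + 2 * \<gamma>) - 1) * Gamma (\<alpha> + \<beta> + \<gamma> + 1) * Gamma (\<alpha> + \<gamma> + 1) /
      (Gamma (\<alpha> + 2 * \<gamma> + 2) * (Gamma (- \<gamma>) * Gamma (- \<beta> - \<gamma>)))) = 1"
proof -
  define S1 S2 S3 where "S1 = sin (of_real pi * \<gamma>)" and "S2 = sin (of_real pi * (\<beta> + \<gamma>))"
    and "S3 = sin (of_real pi * (\<alpha> + 2 * \<beta> + 2 * \<gamma>))"
  have S: "S1 \<noteq> 0" "S2 \<noteq> 0" using sin by (auto simp: S1_def S2_def)
  have pi: "complex_of_real pi \<noteq> 0" by simp
  have r1: "Gamma (- \<gamma>) * Gamma (\<gamma> + 1) = - of_real pi / S1"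
    using Gamma_reflection_complex[of "- \<gamma>"] by (simp add: S1_def add.commute)
  have r2: "Gamma (- \<beta> - \<gamma>) * Gamma (\<beta> + \<gamma> + 1) = - of_real pi / S2"
  proof -
    have "1 - (- \<beta> - \<gamma>) = \<beta> + \<gamma> + 1" "of_real pi * (- \<beta> - \<gamma>) = - (of_real pi * (\<beta> + \<gamma>))"
      by (simp_all add: algebra_simps)
    with Gamma_reflection_complex[of "- \<beta> - \<gamma>"] show ?thesis by (simp add: S2_def)
  qed
  have r3: "Gamma (- (\<alpha> + 2 * \<beta> + 2 * \<gamma>) - 1) * Gamma (\<alpha> + 2 * \<beta> + 2 * \<gamma> + 2) = of_real pi / S3"
  proof -
    have 1: "1 - (- (\<alpha> + 2 * \<beta> + 2 * \<gamma>) - 1) = \<alpha> + 2 * \<beta> + 2 * \<gamma> + 2"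
      "of_real pi * (- (\<alpha> + 2 * \<beta> + 2 * \<gamma>) - 1) = - (of_real pi * (\<alpha> + 2 * \<beta> + 2 * \<gamma>) + of_real pi)"
      by (simp_all add: algebra_simps)
    have 2: "sin (- (of_real pi * (\<alpha> + 2 * \<beta> + 2 * \<gamma>) + of_real pi)) = S3"
      unfolding sin_minus sin_add S3_def by simp
    show ?thesis
      using Gamma_reflection_complex[of "- (\<alpha> + 2 * \<beta> + 2 * \<gamma>) - 1"] unfolding 1 2 .
  qed
  have "Gamma (- (\<alpha> + 2 * \<beta> + 2 * \<gamma>) - 1) * Gamma (\<alpha> + 2 * \<beta> + 2 * \<gamma> + 2) \<noteq> 0"
    using pole2 pole3 by (simp only: mult_eq_0_iff Gamma_eq_zero_iff) simp
  \<comment> \<open>Division by zero yields 0, so a vanishing sine would make the product of the two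
    Gamma values 0; they are nonzero because their arguments are not poles.\<close>
  then have S3: "S3 \<noteq> 0" unfolding r3 by auto
  have G1: "Gamma (\<alpha> + 2 * \<gamma> + 2) \<noteq> 0" using pole1 by (simp add: Gamma_eq_zero_iff)
  define U V W P Q where "U = Gamma (- (\<alpha> + 2 * \<beta> + 2 * \<gamma>) - 1)" and "V = Gamma (\<alpha> + 2 * \<beta> + 2 * \<gamma> + 2)"
    and "W = Gamma (\<alpha> + 2 * \<gamma> + 2)" and "P = Gamma (\<alpha> + \<gamma> + 1)" and "Q = Gamma (\<alpha> + \<beta> + \<gamma> + 1)"
  have "of_real pi * S3 * W * V / (S1 * S2 * Gamma (\<gamma> + 1) * P * Gamma (\<beta> + \<gamma> + 1) * Q) *
      (U * Q * P / (W * (Gamma (- \<gamma>) * Gamma (- \<beta> - \<gamma>)))) =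
      (of_real pi * S3 * (U * V)) * (W * P * Q) / ((S1 * S2 * (Gamma (- \<gamma>) * Gamma (\<gamma> + 1)) * (Gamma (- \<beta> - \<gamma>) * Gamma (\<beta> + \<gamma> + 1))) * (W * P * Q))"
    by (simp only: times_divide_times_eq mult_ac)
  also have "\<dots> = 1"
    using r3 S S3 pi G1 Ga Gb unfolding r1 r2 U_def[symmetric] V_def[symmetric] W_def[symmetric] P_def[symmetric] Q_def[symmetric]
    by simp
  finally show ?thesis
    unfolding S1_def S2_def S3_def U_def V_def W_def P_def Q_def .
qed

theorem theorem48:
  fixes z \<alpha> \<beta> \<gamma> :: complex
  assumes z: "z \<in> - complex_of_real ` {..1}"
    and nonzero: "\<alpha> \<noteq> 0" "\<beta> \<noteq> 0" "\<gamma> \<noteq> 0"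
    and Re1: "Re (\<alpha> + \<gamma>) > 0"
    and Re2: "Re (\<alpha> + \<beta> + \<gamma>) > 0"
    and Re3: "Re (- \<alpha> - \<beta> - 2 * \<gamma> - 1) > 0"
    and pole1: "\<alpha> + 2 * \<gamma> + 2 \<notin> \<int>\<^sub>\<le>\<^sub>0"
    and pole2: "\<alpha> + 2 * \<beta> + 2 * \<gamma> + 2 \<notin> \<int>\<^sub>\<le>\<^sub>0"
    \<comment> \<open>the factor \<open>\<Gamma>(2a + l)\<close> of the Gegenbauer function in the integrand is defined;
        the arguments of all other Gamma factors avoid the poles by the remaining assumptions\<close>
    and pole3: "2 * (- (\<alpha> + \<beta> + 2 * \<gamma> + 1)) + (\<alpha> + 2 * \<gamma> + 1) \<notin> \<int>\<^sub>\<le>\<^sub>0"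
    and sin: "sin (of_real pi * \<gamma>) * sin (of_real pi * (\<beta> + \<gamma>)) \<noteq> 0"
  shows "\<exists>L R.
    \<comment> \<open>\<open>L\<close> and \<open>R\<close> are the analytic continuations of the left-hand and right-hand sides\<close>
    L holomorphic_on (- complex_of_real ` {..1}) \<and>
    (\<forall>x \<in> - complex_of_real ` {..1}. Re x > 0 \<longrightarrow> L x = jacobi_P \<alpha> \<beta> \<gamma> (2 * x\<^sup>2 - 1)) \<and>
    R holomorphic_on (- complex_of_real ` {..1}) \<and>
    (\<forall>x::real. x > 1 \<longrightarrow>
       jacobi_integrand \<alpha> \<beta> \<gamma> x absolutely_integrable_on {1..x} \<and>
       R (of_real x) =
         of_real pi * sin (of_real pi * (\<alpha> + 2 * \<beta> + 2 * \<gamma>)) *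
           Gamma (\<alpha> + 2 * \<gamma> + 2) * Gamma (\<alpha> + 2 * \<beta> + 2 * \<gamma> + 2) /
         (2 powr (2 * \<alpha> + 2 * \<beta> + 4 * \<gamma> + 2) *
           sin (of_real pi * \<gamma>) * sin (of_real pi * (\<beta> + \<gamma>)) *
           Gamma (\<gamma> + 1) * Gamma (\<alpha> + \<gamma> + 1) * Gamma (\<beta> + \<gamma> + 1) * Gamma (\<alpha> + \<beta> + \<gamma> + 1)) *
         (1 / (of_real x powr (\<alpha> + 2 * \<beta> + 2 * \<gamma> + 2) * of_real (x\<^sup>2 - 1) powr (\<alpha> / 2))) *
         integral {1..x} (jacobi_integrand \<alpha> \<beta> \<gamma> x)) \<and>
    L z = R z"
proof -
  obtain L where L: "L holomorphic_on (- complex_of_real ` {..1})"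
      "\<And>x. Re x > 0 \<Longrightarrow> L x = jacobi_P \<alpha> \<beta> \<gamma> (2 * x\<^sup>2 - 1)"
    using jacobi_P_continuation[OF Re1 Re2 Re3] by blast
  have "2 * (- (\<alpha> + \<beta> + 2 * \<gamma> + 1)) + (\<alpha> + 2 * \<gamma> + 1) = - (\<alpha> + 2 * \<beta> + 2 * \<gamma>) - 1"
    by (simp add: algebra_simps)
  note pole3' = pole3[unfolded this]
  have G: "Gamma (\<alpha> + \<gamma> + 1) \<noteq> 0" "Gamma (\<alpha> + \<beta> + \<gamma> + 1) \<noteq> 0"
    using Gamma_nonzero_Re_pos[of "\<alpha> + \<gamma> + 1"] Gamma_nonzero_Re_pos[of "\<alpha> + \<beta> + \<gamma> + 1"] Re1 Re2 by auto
  have "jacobi_integrand \<alpha> \<beta> \<gamma> x absolutely_integrable_on {1..x} \<and>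
       L (of_real x) =
         of_real pi * sin (of_real pi * (\<alpha> + 2 * \<beta> + 2 * \<gamma>)) *
           Gamma (\<alpha> + 2 * \<gamma> + 2) * Gamma (\<alpha> + 2 * \<beta> + 2 * \<gamma> + 2) /
         (2 powr (2 * \<alpha> + 2 * \<beta> + 4 * \<gamma> + 2) *
           sin (of_real pi * \<gamma>) * sin (of_real pi * (\<beta> + \<gamma>)) *
           Gamma (\<gamma> + 1) * Gamma (\<alpha> + \<gamma> + 1) * Gamma (\<beta> + \<gamma> + 1) * Gamma (\<alpha> + \<beta> + \<gamma> + 1)) *
         (1 / (of_real x powr (\<alpha> + 2 * \<beta> + 2 * \<gamma> + 2) * of_real (x\<^sup>2 - 1) powr (\<alpha> / 2))) *
         integral {1..x} (jacobi_integrand \<alpha> \<beta> \<gamma> x)" if x: "x > 1" for x :: real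
  proof
    show "jacobi_integrand \<alpha> \<beta> \<gamma> x absolutely_integrable_on {1..x}"
      by (rule jacobi_integrand_integral(1)[OF Re1 Re2 Re3 x])
    define E where "E = complex_of_real x powr (\<alpha> + 2 * \<beta> + 2 * \<gamma> + 2) * of_real (x\<^sup>2 - 1) powr (\<alpha> / 2)"
    define T where "T = (2::complex) powr (2 * \<alpha> + 2 * \<beta> + 4 * \<gamma> + 2)"
    define C1 where "C1 = of_real pi * sin (of_real pi * (\<alpha> + 2 * \<beta> + 2 * \<gamma>)) *
      Gamma (\<alpha> + 2 * \<gamma> + 2) * Gamma (\<alpha> + 2 * \<beta> + 2 * \<gamma> + 2)"
    define C2 where "C2 = sin (of_real pi * \<gamma>) * sin (of_real pi * (\<beta> + \<gamma>)) *
      Gamma (\<gamma> + 1) * Gamma (\<alpha> + \<gamma> + 1) * Gamma (\<beta> + \<gamma> + 1) * Gamma (\<alpha> + \<beta> + \<gamma> + 1)"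
    define C3 where "C3 = Gamma (- (\<alpha> + 2 * \<beta> + 2 * \<gamma>) - 1) * Gamma (\<alpha> + \<beta> + \<gamma> + 1) * Gamma (\<alpha> + \<gamma> + 1) /
      (Gamma (\<alpha> + 2 * \<gamma> + 2) * (Gamma (- \<gamma>) * Gamma (- \<beta> - \<gamma>)))"
    have "x\<^sup>2 > 1" using x by (simp add: one_less_power)
    then have "complex_of_real (x\<^sup>2 - 1) \<noteq> 0"
      unfolding of_real_eq_0_iff by linarith
    then have nz: "E \<noteq> 0" "T \<noteq> 0"
      using x by (auto simp: E_def T_def simp del: of_real_diff)
    have C: "C1 / C2 * C3 = 1"
      using reflection_constant[OF pole1 pole2 pole3' sin G] unfolding C1_def C2_def C3_def .
    have 1: "2 * (- \<gamma> - (\<alpha> + \<beta> + \<gamma> + 1)) + (\<alpha> + 1 - 2 * - \<gamma>) = - (\<alpha> + 2 * \<beta> + 2 * \<gamma>) - 1"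
      "\<alpha> + 1 - - \<gamma> = \<alpha> + \<gamma> + 1" "\<alpha> + 1 - 2 * - \<gamma> + 1 = \<alpha> + 2 * \<gamma> + 2"
      "\<alpha> + 1 - (\<alpha> + \<beta> + \<gamma> + 1) = - \<beta> - \<gamma>"
      "- 2 * (- \<gamma> - (\<alpha> + \<beta> + \<gamma> + 1)) = 2 * \<alpha> + 2 * \<beta> + 4 * \<gamma> + 2"
      by (simp_all add: algebra_simps)
    have I: "integral {1..x} (jacobi_integrand \<alpha> \<beta> \<gamma> x) = C3 * T * E * L (of_real x)"
      using jacobi_integrand_integral(2)[OF Re1 Re2 Re3 x] L(2)[of "of_real x"] x
      unfolding 1 E_def T_def C3_def by simp
    have "C1 / (T * C2) * (1 / E) * (C3 * T * E * L (of_real x)) = (C1 / C2 * C3) * L (of_real x)"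
      using nz by (simp add: field_simps)
    then show "L (of_real x) =
         of_real pi * sin (of_real pi * (\<alpha> + 2 * \<beta> + 2 * \<gamma>)) *
           Gamma (\<alpha> + 2 * \<gamma> + 2) * Gamma (\<alpha> + 2 * \<beta> + 2 * \<gamma> + 2) /
         (2 powr (2 * \<alpha> + 2 * \<beta> + 4 * \<gamma> + 2) *
           sin (of_real pi * \<gamma>) * sin (of_real pi * (\<beta> + \<gamma>)) *
           Gamma (\<gamma> + 1) * Gamma (\<alpha> + \<gamma> + 1) * Gamma (\<beta> + \<gamma> + 1) * Gamma (\<alpha> + \<beta> + \<gamma> + 1)) *
         (1 / (of_real x powr (\<alpha> + 2 * \<beta> + 2 * \<gamma> + 2) * of_real (x\<^sup>2 - 1) powr (\<alpha> / 2))) *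
         integral {1..x} (jacobi_integrand \<alpha> \<beta> \<gamma> x)"
      unfolding I C E_def[symmetric] T_def[symmetric] C1_def[symmetric]
      by (simp add: C2_def mult.assoc)
  qed
  \<comment> \<open>The continuation of the left-hand side serves as \<open>R\<close> too: on x > 1
    it equals the right-hand formula, which is all that is asked of a continuation of that
    side.\<close>
  with L show ?thesis by blast
qed

end
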